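(* Every alternating non-split link diagram without a nugatory crossing is $H$-$(0,0)$-thick and $H$-$1$-thick.
   Context: Diagrams: $D$ is a diagram in the plane (disc) of an unoriented framed link, with ordered crossings. A diagram is non-split if it is connected (as a planar graph). A crossing is nugatory if there is a simple closed curve in the plane (sphere) meeting the diagram only at that crossing, transversally, with parts of the diagram on both sides. At each crossing there are two smoothings: the positive-marker smoothing ($A$-smoothing) joins the two local regions swept out when the overcrossing arc is rotated counterclockwise until it meets the undercrossing arc; the negative-marker smoothing joins the other two regions. A Kauffman state $s$ assigns $+1$ or $-1$ (a positive or negative marker) to each crossing; $D_s$ is the system of circles obtained by smoothing all crossings according to $s$, $|s|$ is the number of circles of $D_s$, and $\sigma(s)$ is the number of positive minus the number of negative markers. $s_+$ (resp. $s_-$) is the state with all markers positive (resp. negative). Khovanov homology: an enhanced state $S$ is a Kauffman state $s$ with a sign $+$ or $-$ on each circle of $D_s$; put $\sigma(S)=\sigma(s)$ and $\tau(S)=\#\{\text{positive circles}\}-\#\{\text{negative circles}\}$. $\mathcal{C}_{i,j}(D)$ is the free abelian group on enhanced states with $\sigma(S)=i$ and $\sigma(S)+2\tau(S)=j$. The differential $d_{i,j}:\mathcal{C}_{i,j}(D)\to\mathcal{C}_{i-2,j}(D)$ is $d(S)=\sum_{S'}(-1)^{t(S:S')}[S:S']S'$, the sum over enhanced states $S'$ generating $\mathcal C_{i-2,j}(D)$, where $[S:S']=1$ if the markers of $S$ and $S'$ differ at exactly one crossing $v$ and all circles not touching $v$ have the same sign in $S$ and $S'$, and $[S:S']=0$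 otherwise; $t(S:S')$ is the number of negative markers of $S$ at crossings bigger than $v$ in the ordering. $H_{i,j}(D)=\ker(d_{i,j})/\mathrm{im}(d_{i+2,j})$. Thickness: a diagram $D$ with $N$ crossings is $H$-$(k_1,k_2)$-thick if $H_{i,j}(D)=0$ with a possible exception of $i,j$ satisfying $N-2|s_-|-4k_2\le j-2i\le 2|s_+|-N+4k_1$. It is $H$-$k$-thick if it is $H$-$(k_1,k_2)$-thick for some $k_1,k_2$ with $k\ge k_1+k_2+\frac12(|s_+|+|s_-|-N)$. *)

theory Defs
  imports Complex_Main "HOL-Algebra.Free_Abelian_Groups"
begin

section \<open>Link diagrams\<close>

text \<open>
  A diagram is encoded combinatorially, as in a planar diagram code.  The crossings are
  \<open>0, ..., N - 1\<close>, in this order.  The four half-edges at crossing \<open>c\<close> are the pairs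
  \<open>(c, p)\<close> with \<open>p < 4\<close>, numbered counterclockwise in such a way that \<open>p = 0, 2\<close> lie
  on the undercrossing arc and \<open>p = 1, 3\<close> on the overcrossing arc.  The involution \<open>glue\<close>
  sends each half-edge to the other half of its edge.  Components without
  crossings carry no half-edges, so they are counted by \<open>free_circles\<close>.

  The relative position in the plane of different connected components of a diagram is not
  recorded; none of the notions below depends on it.
\<close>

record link_diagram =
  num_crossings :: nat
  glue :: "nat \<times> nat \<Rightarrow> nat \<times> nat"
  free_circles :: nat

definition crossings :: "link_diagram \<Rightarrow> nat set" where
  "crossings D = {..<num_crossings D}"

definition half_edges :: "link_diagram \<Rightarrow> (nat \<times> nat) set" where
  "half_edges D = crossings D \<times> {..<4}"

text \<open>
  The classes of points of \<open>X\<close> joined by the maps in \<open>F\<close>.  In every use \<open>X\<close> is finite and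
  is permuted by the maps in \<open>F\<close>, so the relation below is symmetric on \<open>X\<close>.
\<close>

definition joined_classes :: "('a \<Rightarrow> 'a) set \<Rightarrow> 'a set \<Rightarrow> 'a set set" where
  "joined_classes F X = X // {(x, f x) | x f. x \<in> X \<and> f \<in> F}\<^sup>*"

definition turn :: "nat \<Rightarrow> nat \<times> nat \<Rightarrow> nat \<times> nat" where
  "turn k h = (fst h, (snd h + k) mod 4)"

text \<open>
  \<open>(c, p)\<close> also names the corner of the diagram at \<open>c\<close> between the half-edges \<open>p\<close> and
  \<open>p + 1\<close>.  Leaving \<open>c\<close> along \<open>(c, p)\<close> with that corner on the left, one arrives along
  \<open>glue D (c, p)\<close>, and the next corner on the left is the one preceding it in the
  counterclockwise order.
\<close>

definition regions :: "link_diagram \<Rightarrow> (nat \<times> nat) set set" where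
  "regions D = joined_classes {turn 3 \<circ> glue D} (half_edges D)"

definition connected_pieces :: "link_diagram \<Rightarrow> (nat \<times> nat) set set" where
  "connected_pieces D = joined_classes {turn 1, glue D} (half_edges D)"

text \<open>
  The last condition is planarity.  With \<open>N\<close> vertices and \<open>2 N\<close> edges, every connected
  piece has Euler characteristic at most 2, with equality iff it lies on a sphere.
\<close>

definition is_link_diagram :: "link_diagram \<Rightarrow> bool" where
  "is_link_diagram D \<longleftrightarrow>
     (\<forall>h \<in> half_edges D. glue D h \<in> half_edges D \<and> glue D h \<noteq> h \<and> glue D (glue D h) = h) \<and>
     int (num_crossings D) - 2 * int (num_crossings D) + int (card (regions D))
       = 2 * int (card (connected_pieces D))"

definition non_split :: "link_diagram \<Rightarrow> bool" where
  "non_split D \<longleftrightarrow> card (connected_pieces D) + free_circles D = 1"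

text \<open>Each edge runs from an overcrossing to an undercrossing.\<close>

definition alternating :: "link_diagram \<Rightarrow> bool" where
  "alternating D \<longleftrightarrow> (\<forall>h \<in> half_edges D. odd (snd h) \<longleftrightarrow> even (snd (glue D h)))"

text \<open>
  A closed curve that meets the diagram only at \<open>c\<close>, transversally, leaves \<open>c\<close> through a
  corner, stays in one region and returns through the opposite corner; it then has two of
  the half-edges at \<open>c\<close> on each side.
\<close>

definition nugatory :: "link_diagram \<Rightarrow> nat \<Rightarrow> bool" where
  "nugatory D c \<longleftrightarrow>
     c \<in> crossings D \<and> (\<exists>R \<in> regions D. \<exists>p < 4. (c, p) \<in> R \<and> turn 2 (c, p) \<in> R)"

section \<open>Kauffman states\<close>

text \<open>
  A Kauffman state is given by the set of crossings with a positive marker.  Rotated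
  counterclockwise, the overcrossing arc \<open>{1, 3}\<close> sweeps the corners \<open>1-2\<close> and \<open>3-0\<close>;
  joining these two corners connects half-edge \<open>0\<close> to \<open>1\<close> and \<open>2\<close> to \<open>3\<close>.  The other
  smoothing connects \<open>1\<close> to \<open>2\<close> and \<open>3\<close> to \<open>0\<close>.
\<close>

type_synonym kauffman_state = "nat set"

definition smoothing :: "kauffman_state \<Rightarrow> nat \<times> nat \<Rightarrow> nat \<times> nat" where
  "smoothing s h = (if fst h \<in> s \<longleftrightarrow> even (snd h) then turn 1 h else turn 3 h)"

type_synonym circle = "(nat \<times> nat) set + nat"

definition state_circles :: "link_diagram \<Rightarrow> kauffman_state \<Rightarrow> circle set" where
  "state_circles D s =
     joined_classes {glue D, smoothing s} (half_edges D) <+> {..<free_circles D}"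

definition state_sign :: "link_diagram \<Rightarrow> kauffman_state \<Rightarrow> int" where
  "state_sign D s = int (card s) - int (card (crossings D - s))"

definition state_plus :: "link_diagram \<Rightarrow> kauffman_state" where
  "state_plus D = crossings D"

definition state_minus :: "link_diagram \<Rightarrow> kauffman_state" where
  "state_minus D = {}"

definition touches :: "circle \<Rightarrow> nat \<Rightarrow> bool" where
  "touches C v \<longleftrightarrow> (\<exists>p. \<exists>A. C = Inl A \<and> (v, p) \<in> A)"

section \<open>Khovanov homology\<close>

text \<open>A Kauffman state together with the set of its positive circles.\<close>

type_synonym enhanced_state = "kauffman_state \<times> circle set"

definition tau :: "link_diagram \<Rightarrow> enhanced_state \<Rightarrow> int" where
  "tau D S = int (card (snd S)) - int (card (state_circles D (fst S) - snd S))"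

definition enhanced_states :: "link_diagram \<Rightarrow> int \<Rightarrow> int \<Rightarrow> enhanced_state set" where
  "enhanced_states D i j =
     {S. fst S \<subseteq> crossings D \<and> snd S \<subseteq> state_circles D (fst S) \<and>
         state_sign D (fst S) = i \<and> state_sign D (fst S) + 2 * tau D S = j}"

definition chain_group ::
    "link_diagram \<Rightarrow> int \<Rightarrow> int \<Rightarrow> (enhanced_state \<Rightarrow>\<^sub>0 int) monoid" where
  "chain_group D i j = free_Abelian_group (enhanced_states D i j)"

definition incidence :: "link_diagram \<Rightarrow> enhanced_state \<Rightarrow> enhanced_state \<Rightarrow> int" where
  "incidence D S S' =
     (if \<exists>v. sym_diff (fst S) (fst S') = {v} \<and>
             (\<forall>C \<in> state_circles D (fst S). \<not> touches C v \<longrightarrow> (C \<in> snd S \<longleftrightarrow> C \<in> snd S'))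
      then 1 else 0)"

text \<open>Only relevant when the markers of \<open>S\<close> and \<open>S'\<close> differ at exactly one crossing.\<close>

definition sign_exponent :: "link_diagram \<Rightarrow> enhanced_state \<Rightarrow> enhanced_state \<Rightarrow> nat" where
  "sign_exponent D S S' =
     card {w \<in> crossings D - fst S. the_elem (sym_diff (fst S) (fst S')) < w}"

definition differential ::
    "link_diagram \<Rightarrow> int \<Rightarrow> int \<Rightarrow> (enhanced_state \<Rightarrow>\<^sub>0 int) \<Rightarrow> (enhanced_state \<Rightarrow>\<^sub>0 int)" where
  "differential D i j =
     frag_extend (\<lambda>S. \<Sum>S' \<in> enhanced_states D (i - 2) j.
       frag_cmul ((- 1) ^ sign_exponent D S S' * incidence D S S') (frag_of S'))"

definition khovanov_homology ::
    "link_diagram \<Rightarrow> int \<Rightarrow> int \<Rightarrow> (enhanced_state \<Rightarrow>\<^sub>0 int) set monoid" where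
  "khovanov_homology D i j =
     subgroup_generated (chain_group D i j)
       (kernel (chain_group D i j) (chain_group D (i - 2) j) (differential D i j))
     Mod (differential D (i + 2) j ` carrier (chain_group D (i + 2) j))"

section \<open>Thickness\<close>

definition H_thick2 :: "link_diagram \<Rightarrow> int \<Rightarrow> int \<Rightarrow> bool" where
  "H_thick2 D k1 k2 \<longleftrightarrow>
     (let N = int (num_crossings D);
          sp = int (card (state_circles D (state_plus D)));
          sm = int (card (state_circles D (state_minus D)))
      in \<forall>i j. \<not> (N - 2 * sm - 4 * k2 \<le> j - 2 * i \<and> j - 2 * i \<le> 2 * sp - N + 4 * k1)
           \<longrightarrow> trivial_group (khovanov_homology D i j))"

definition H_thick :: "link_diagram \<Rightarrow> int \<Rightarrow> bool" where
  "H_thick D k \<longleftrightarrow>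
     (\<exists>k1 k2. H_thick2 D k1 k2 \<and>
        real_of_int k \<ge> real_of_int k1 + real_of_int k2 +
          1 / 2 * (real (card (state_circles D (state_plus D)))
                   + real (card (state_circles D (state_minus D)))
                   - real (num_crossings D)))"

end

theory Submission
  imports Defs
begin

text \<open>
  Let \<open>A \<subseteq> B\<close> be states and consider the enhanced states between them, in which the crossings
  outside \<open>B - A\<close> are already smoothed.  Smoothing one more crossing \<open>v\<close> in the two possible ways
  presents this complex as an extension.  Choose one base point with a fixed sign on every component
  of the partially smoothed diagram.  Then the homology is concentrated on a single diagonal
  \<open>j - 2 i = const\<close>, by induction on the number of unsmoothed crossings.  If neither smoothing
  of \<open>v\<close> disconnects its component, both parts have their homology on the same diagonal.  If one of
  them does, then \<open>v\<close> merges (or splits) circles in every state; the states in which the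
  new component has the sign of the unit cancel against those with the other smoothing, and what
  remains is the disconnected diagram with one more base point.  When nothing is left to smooth, the
  signs of all circles are prescribed and there is only one generator.

  Planarity enters through the equality \<open>|s\<^sub>+| + |s\<^sub>-| = N + 2\<close>, which is the extreme case of a general
  inequality that is inherited by all partial smoothings; equality forces every change
  of marker to merge or to split circles.  A connected diagram needs one base point,
  whose two signs give the two diagonals.
\<close>

section \<open>Exactness of based complexes\<close>

text \<open>A circle without a base point has generators on two diagonals, and each further
  component widens the range; a prescribed sign at one point per component removes this freedom. The
  obstacle is the choice of the crossing \<open>v\<close>. The surviving states must form a
  subcomplex or a quotient of the whole, so the entries between them and the cancelling states have
  to vanish in one direction. The fixed sign at a base point \<open>p\<close> forces this, but only
  if \<open>p\<close> lies on a circle at \<open>v\<close> in every state in question; to lie in the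
  same component is not enough. Hence \<open>v\<close> is taken at the end of an arc from
  \<open>p\<close> that all these states share.

  All cancelled entries are 1 or -1, so that the argument works over the integers. A generator lies
  on the diagonal j - 2 i = 2 tau - sigma, and reversing the sign of one circle moves it by 4. This
  is the distance of the two final diagonals and, by the equality for the numbers of circles, also
  the length of the interval in the definition of thickness for k1 = k2 = 0.\<close>

definition boundary :: "('e \<Rightarrow> 'e \<Rightarrow> int) \<Rightarrow> 'e set \<Rightarrow> ('e \<Rightarrow> int) \<Rightarrow> 'e \<Rightarrow> int" where
  "boundary m X x T = (\<Sum>S\<in>X. x S * m S T)"

definition square_zero_on :: "('e \<Rightarrow> 'e \<Rightarrow> int) \<Rightarrow> 'e set \<Rightarrow> bool" where
  "square_zero_on m X \<longleftrightarrow> (\<forall>S\<in>X. \<forall>U\<in>X. (\<Sum>T\<in>X. m S T * m T U) = 0)"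

definition homogeneous_on :: "('e \<Rightarrow> 'e \<Rightarrow> int) \<Rightarrow> 'e set \<Rightarrow> 'e set \<Rightarrow> 'e set \<Rightarrow> bool" where
  "homogeneous_on m Q P X \<longleftrightarrow> (\<forall>S\<in>X. \<forall>T\<in>X. m S T \<noteq> 0 \<longrightarrow> (S \<in> Q \<longleftrightarrow> T \<in> P))"

text \<open>
  \<open>P\<close> and \<open>Q\<close> are the sets of generators in the degree considered and in the degree
  from which the differential arrives there.
\<close>

definition exact_on :: "('e \<Rightarrow> 'e \<Rightarrow> int) \<Rightarrow> 'e set \<Rightarrow> 'e set \<Rightarrow> 'e set \<Rightarrow> bool" where
  "exact_on m Q P X \<longleftrightarrow>
     (\<forall>x. (\<forall>S. x S \<noteq> 0 \<longrightarrow> S \<in> X \<inter> P) \<and> (\<forall>T\<in>X. boundary m X x T = 0) \<longrightarrow>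
        (\<exists>y. (\<forall>S. y S \<noteq> 0 \<longrightarrow> S \<in> X \<inter> Q) \<and> (\<forall>T\<in>X. boundary m X y T = x T)))"

lemma exact_onE:
  assumes "exact_on m Q P X" "\<And>S. x S \<noteq> 0 \<Longrightarrow> S \<in> X \<inter> P" "\<And>T. T \<in> X \<Longrightarrow> boundary m X x T = 0"
  obtains y where "\<And>S. y S \<noteq> 0 \<Longrightarrow> S \<in> X \<inter> Q" "\<And>T. T \<in> X \<Longrightarrow> boundary m X y T = x T"
  using assms(1)[unfolded exact_on_def, rule_format, of x] assms(2,3) by blast

lemma homogeneous_on_subset: "homogeneous_on m Q P X \<Longrightarrow> Y \<subseteq> X \<Longrightarrow> homogeneous_on m Q P Y"
  unfolding homogeneous_on_def by blast

lemma boundary_mono_neutral: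
  assumes "finite X" "Y \<subseteq> X" "\<And>S. S \<in> X - Y \<Longrightarrow> x S * m S T = 0"
  shows "boundary m X x T = boundary m Y x T"
  unfolding boundary_def using assms by (intro sum.mono_neutral_right) auto

lemma boundary_add: "boundary m X (\<lambda>S. x S + y S) T = boundary m X x T + boundary m X y T"
  by (simp add: boundary_def sum.distrib algebra_simps)

lemma boundary_diff: "boundary m X (\<lambda>S. x S - y S) T = boundary m X x T - boundary m X y T"
  by (simp add: boundary_def sum_subtractf algebra_simps)

lemma boundary_cong: "(\<And>S. S \<in> X \<Longrightarrow> x S = y S) \<Longrightarrow> boundary m X x T = boundary m X y T"
  by (simp add: boundary_def)

lemma boundary_boundary:
  assumes "square_zero_on m X" "U \<in> X"
  shows "boundary m X (boundary m X x) U = 0"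
proof -
  have "boundary m X (boundary m X x) U = (\<Sum>T\<in>X. \<Sum>S\<in>X. x S * (m S T * m T U))"
    by (simp add: boundary_def sum_distrib_right mult.assoc)
  also have "\<dots> = (\<Sum>S\<in>X. x S * (\<Sum>T\<in>X. m S T * m T U))"
    by (subst sum.swap) (simp add: sum_distrib_left)
  also have "\<dots> = 0"
    using assms by (intro sum.neutral) (auto simp: square_zero_on_def)
  finally show ?thesis .
qed

lemma square_zero_on_sub:
  assumes "finite X" "square_zero_on m X" "X = Y \<union> Z" "Y \<inter> Z = {}"
    and "\<And>y z. y \<in> Y \<Longrightarrow> z \<in> Z \<Longrightarrow> m y z = 0"
  shows "square_zero_on m Y" "square_zero_on m Z"
proof -
  have "(\<Sum>T\<in>Y. m S T * m T U) = (\<Sum>T\<in>X. m S T * m T U)" if "S \<in> Y" "U \<in> Y" for S U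
    using assms that by (intro sum.mono_neutral_left) auto
  then show "square_zero_on m Y"
    using assms by (simp add: square_zero_on_def)
  have "(\<Sum>T\<in>Z. m S T * m T U) = (\<Sum>T\<in>X. m S T * m T U)" if "S \<in> Z" "U \<in> Z" for S U
    using assms that by (intro sum.mono_neutral_left) auto
  then show "square_zero_on m Z"
    using assms by (simp add: square_zero_on_def)
qed

text \<open>A piece of the long exact sequence, with \<open>Y\<close> as subcomplex and
  \<open>Z\<close> as quotient: the \<open>Z\<close>-part of a cycle is bounded by some
  \<open>w\<close>, and the cycle minus the boundary of \<open>w\<close> lives in
  \<open>Y\<close>.\<close>

lemma exact_on_extension:
  assumes fin: "finite X" and sq: "square_zero_on m X" and hom: "homogeneous_on m Q P X"
    and X: "X = Y \<union> Z" "Y \<inter> Z = {}"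
    and sub: "\<And>y z. y \<in> Y \<Longrightarrow> z \<in> Z \<Longrightarrow> m y z = 0"
    and Y: "exact_on m Q P Y" and Z: "exact_on m Q P Z"
  shows "exact_on m Q P X"
  unfolding exact_on_def
proof (intro allI impI, elim conjE)
  fix x assume supp: "\<forall>S. x S \<noteq> 0 \<longrightarrow> S \<in> X \<inter> P" and cyc: "\<forall>T\<in>X. boundary m X x T = 0"
  define z where "z = (\<lambda>S. if S \<in> Z then x S else 0)"
  have "boundary m Z z T = 0" if T: "T \<in> Z" for T
  proof -
    have "boundary m Z z T = boundary m Z x T"
      by (rule boundary_cong) (simp add: z_def)
    also have "\<dots> = boundary m X x T"
      using X sub T fin by (intro boundary_mono_neutral[symmetric]) auto
    finally show ?thesis using cyc T X by auto
  qed
  moreover have "S \<in> Z \<inter> P" if "z S \<noteq> 0" for S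
    using that supp by (auto simp: z_def split: if_splits)
  ultimately obtain w where w: "\<And>S. w S \<noteq> 0 \<Longrightarrow> S \<in> Z \<inter> Q"
    "\<And>T. T \<in> Z \<Longrightarrow> boundary m Z w T = z T"
    using exact_onE[OF Z, of z] by metis
  have wX: "boundary m Z w T = boundary m X w T" for T
    using w X fin by (intro boundary_mono_neutral[symmetric]) auto
  \<comment> \<open>Cut off outside \<open>X\<close>, because the support condition in
    \<open>exact_on\<close> ranges over the whole type.\<close>
  define u where "u = (\<lambda>T. if T \<in> X then x T - boundary m X w T else 0)"
  have uZ: "u T = 0" if "T \<in> Z" for T
    using that w(2) X by (auto simp: u_def z_def wX)
  have "S \<in> Y \<inter> P" if "u S \<noteq> 0" for S
  proof -
    have SX: "S \<in> X" using that by (auto simp: u_def split: if_splits)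
    have "S \<in> P"
    proof (rule ccontr)
      assume nP: "S \<notin> P"
      then have "x S = 0" using supp by auto
      moreover have "boundary m X w S = 0" unfolding boundary_def
        using w(1) hom nP SX by (intro sum.neutral) (auto simp: homogeneous_on_def X)
      ultimately show False using that by (simp add: u_def split: if_splits)
    qed
    then show ?thesis using SX uZ that X by auto
  qed
  moreover have "boundary m Y u T = 0" if T: "T \<in> Y" for T
  proof -
    have "boundary m Y u T = boundary m X u T"
      using X uZ fin by (intro boundary_mono_neutral[symmetric]) auto
    also have "\<dots> = boundary m X (\<lambda>T. x T - boundary m X w T) T"
      by (rule boundary_cong) (simp add: u_def)
    also have "\<dots> = 0"
      using T X cyc boundary_boundary[OF sq] by (simp add: boundary_diff)
    finally show ?thesis .
  qed
  ultimately obtain w' where w': "\<And>S. w' S \<noteq> 0 \<Longrightarrow> S \<in> Y \<inter> Q"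
    "\<And>T. T \<in> Y \<Longrightarrow> boundary m Y w' T = u T"
    using exact_onE[OF Y, of u] by metis
  have w'X: "boundary m X w' T = boundary m Y w' T" for T
    using w' X fin by (intro boundary_mono_neutral) auto
  have "boundary m X w' T = u T" if "T \<in> X" for T
  proof (cases "T \<in> Y")
    case False
    then have TZ: "T \<in> Z" using that X by auto
    have "boundary m Y w' T = 0" unfolding boundary_def
      using sub TZ by (intro sum.neutral) auto
    then show ?thesis using uZ[OF TZ] by (simp add: w'X)
  qed (use w' w'X in auto)
  then have "\<forall>T\<in>X. boundary m X (\<lambda>S. w S + w' S) T = x T"
    by (auto simp: boundary_add u_def)
  moreover have "\<forall>S. w S + w' S \<noteq> 0 \<longrightarrow> S \<in> X \<inter> Q"
    using w(1) w'(1) unfolding X(1) by (metis Int_iff UnI1 UnI2 add_0)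
  ultimately show "\<exists>y. (\<forall>S. y S \<noteq> 0 \<longrightarrow> S \<in> X \<inter> Q) \<and> (\<forall>T\<in>X. boundary m X y T = x T)"
    by (intro exI[of _ "\<lambda>S. w S + w' S"] conjI)
qed

text \<open>\<open>X\<close> is the mapping cone of an isomorphism from \<open>Y\<close> to the
  subcomplex \<open>Z\<close>, given by a diagonal matrix with entries 1 or -1; such a cone is
  contractible. Entries inside \<open>Y\<close> and inside \<open>Z\<close> are restricted only by
  \<open>square_zero_on\<close> and the degrees.\<close>

lemma exact_on_matching:
  assumes fin: "finite X" and sq: "square_zero_on m X" and hom: "homogeneous_on m Q P X"
    and X: "X = Y \<union> Z" "Y \<inter> Z = {}"
    and sub: "\<And>y z. y \<in> Y \<Longrightarrow> z \<in> Z \<Longrightarrow> m z y = 0"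
    and f: "bij_betw f Y Z"
    and unit: "\<And>y. y \<in> Y \<Longrightarrow> m y (f y) * m y (f y) = 1"
    and diag: "\<And>y z. y \<in> Y \<Longrightarrow> z \<in> Z \<Longrightarrow> z \<noteq> f y \<Longrightarrow> m y z = 0"
  shows "exact_on m Q P X"
  unfolding exact_on_def
proof (intro allI impI, elim conjE)
  fix x assume supp: "\<forall>S. x S \<noteq> 0 \<longrightarrow> S \<in> X \<inter> P" and cyc: "\<forall>T\<in>X. boundary m X x T = 0"
  have fin': "finite Y" "finite Z" using fin X by auto
  have fY: "f y \<in> Z" if "y \<in> Y" for y using f that by (auto simp: bij_betw_def)
  have at_f: "boundary m Y w (f y) = w y * m y (f y)" if y: "y \<in> Y" for w y
  proof -
    have "boundary m Y w (f y) = (\<Sum>S\<in>Y. if S = y then w y * m y (f y) else 0)"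
      unfolding boundary_def
    proof (intro sum.cong refl)
      fix S assume S: "S \<in> Y"
      have "m S (f y) = 0" if "S \<noteq> y"
        using diag[OF S fY[OF y]] f S y that by (auto simp: bij_betw_def inj_on_def)
      then show "w S * m S (f y) = (if S = y then w y * m y (f y) else 0)" by simp
    qed
    then show ?thesis using y fin' by simp
  qed
  \<comment> \<open>The preimage of the \<open>Z\<close>-part of \<open>x\<close> under the diagonal
    map; an entry of square 1 is its own inverse.\<close>
  define w where "w = (\<lambda>S. if S \<in> Y then x (f S) * m S (f S) else 0)"
  have wX: "boundary m X w T = boundary m Y w T" for T
    using X fin by (intro boundary_mono_neutral) (auto simp: w_def)
  have wZ: "boundary m X w T = x T" if T: "T \<in> Z" for T
  proof -
    obtain y where y: "y \<in> Y" "T = f y" using f T by (auto simp: bij_betw_def)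
    have "boundary m X w T = w y * m y (f y)"
      unfolding wX y(2) by (rule at_f[OF y(1)])
    also have "\<dots> = x T * (m y (f y) * m y (f y))"
      using y by (simp add: w_def mult.assoc)
    finally show ?thesis using unit[OF y(1)] by (metis mult.right_neutral)
  qed
  define u where "u = (\<lambda>T. x T - boundary m X w T)"
  have u: "boundary m X u T = 0" if "T \<in> X" for T
    using that cyc boundary_boundary[OF sq] by (simp add: u_def boundary_diff)
  have uY: "boundary m X u T = boundary m Y u T" for T
    using X fin wZ by (intro boundary_mono_neutral) (auto simp: u_def)
  \<comment> \<open>The remainder is supported on \<open>Y\<close>, where the cycle condition at
    \<open>f y\<close> sees the coefficient at \<open>y\<close> alone.\<close>
  have "u y = 0" if y: "y \<in> Y" for y
  proof -
    have "u y * m y (f y) = 0"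
      using u[of "f y"] uY at_f[OF y] fY[OF y] X by auto
    then show ?thesis using unit[OF y] by auto
  qed
  then have "\<forall>T\<in>X. boundary m X w T = x T"
    using wZ X by (auto simp: u_def)
  moreover have "S \<in> X \<inter> Q" if "w S \<noteq> 0" for S
  proof -
    have S: "S \<in> Y" "x (f S) \<noteq> 0" "m S (f S) \<noteq> 0"
      using that by (auto simp: w_def split: if_splits)
    then show ?thesis using supp hom fY[OF S(1)] X unfolding homogeneous_on_def by blast
  qed
  ultimately show "\<exists>y. (\<forall>S. y S \<noteq> 0 \<longrightarrow> S \<in> X \<inter> Q) \<and> (\<forall>T\<in>X. boundary m X y T = x T)"
    by (intro exI[of _ w] conjI) auto
qed

section \<open>Fusing classes of an equivalence relation\<close>

text \<open>The closure used in \<open>joined_classes\<close> is reflexive on the whole type;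
  restricted to \<open>X\<close> it can satisfy \<open>equiv X\<close>.\<close>

definition joined :: "('a \<Rightarrow> 'a) set \<Rightarrow> 'a set \<Rightarrow> ('a \<times> 'a) set" where
  "joined F X = {(x, f x) | x f. x \<in> X \<and> f \<in> F}\<^sup>* \<inter> X \<times> X"

lemma joined_step:
  assumes "x \<in> X" "f \<in> F" "f x \<in> X"
  shows "(x, f x) \<in> joined F X"
  using assms by (auto simp: joined_def)

lemma joined_refl: "x \<in> X \<Longrightarrow> (x, x) \<in> joined F X"
  by (simp add: joined_def)

lemma joined_trans: "(x, y) \<in> joined F X \<Longrightarrow> (y, z) \<in> joined F X \<Longrightarrow> (x, z) \<in> joined F X"
  by (auto simp: joined_def intro: rtrancl_trans)

lemma joined_induct [consumes 1, case_names closed base step]: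
  assumes "(x, y) \<in> joined F X" "\<And>f z. f \<in> F \<Longrightarrow> z \<in> X \<Longrightarrow> f z \<in> X"
    and "P x" "\<And>z f. (x, z) \<in> joined F X \<Longrightarrow> z \<in> X \<Longrightarrow> f \<in> F \<Longrightarrow> P z \<Longrightarrow> P (f z)"
  shows "P y"
proof -
  have x: "x \<in> X" and "(x, y) \<in> {(x, f x) | x f. x \<in> X \<and> f \<in> F}\<^sup>*"
    using assms(1) by (auto simp: joined_def)
  from this(2) have "y \<in> X \<and> P y"
  proof (induction rule: rtrancl_induct)
    case base
    then show ?case using x assms(3) by simp
  next
    case (step z w)
    then obtain f where "f \<in> F" "w = f z" "z \<in> X" by auto
    moreover from this have "(x, z) \<in> joined F X"
      using step x by (auto simp: joined_def)
    ultimately show ?case using assms(2,4) step by auto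
  qed
  then show ?thesis ..
qed

lemma joined_classes_eq:
  assumes "\<And>f x. f \<in> F \<Longrightarrow> x \<in> X \<Longrightarrow> f x \<in> X"
  shows "joined_classes F X = X // joined F X"
proof -
  let ?R = "{(x, f x) | x f. x \<in> X \<and> f \<in> F}"
  have "y \<in> X" if "(x, y) \<in> ?R\<^sup>*" "x \<in> X" for x y
    using that by (induction rule: rtrancl_induct) (use assms in auto)
  then have "?R\<^sup>* `` {x} = joined F X `` {x}" if "x \<in> X" for x
    using that by (auto simp: joined_def)
  then show ?thesis by (auto simp: joined_classes_def quotient_def)
qed

lemma equiv_joined:
  assumes "\<And>f x. f \<in> F \<Longrightarrow> x \<in> X \<Longrightarrow> f x \<in> X" "\<And>f x. f \<in> F \<Longrightarrow> x \<in> X \<Longrightarrow> f (f x) = x"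
  shows "equiv X (joined F X)"
proof (rule equivI)
  show "joined F X \<subseteq> X \<times> X" by (auto simp: joined_def)
  show "refl_on X (joined F X)" by (auto simp: refl_on_def joined_def)
  show "trans (joined F X)" by (auto intro: transI joined_trans)
  show "sym (joined F X)"
  proof (rule symI)
    fix x y assume "(x, y) \<in> joined F X"
    then show "(y, x) \<in> joined F X"
    proof (induction rule: joined_induct)
      case base
      then show ?case using \<open>(x, y) \<in> joined F X\<close> by (auto simp: joined_def)
    next
      case (step z f)
      then have "(f z, f (f z)) \<in> joined F X"
        using assms by (intro joined_step) auto
      then show ?case using step assms(2)[of f z] by (auto intro: joined_trans)
    qed (use assms in auto)
  qed
qed

lemma joined_least:
  assumes "equiv X E" "\<And>f x. f \<in> F \<Longrightarrow> x \<in> X \<Longrightarrow> (x, f x) \<in> E"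
  shows "joined F X \<subseteq> E"
proof safe
  fix x y assume "(x, y) \<in> joined F X"
  then show "(x, y) \<in> E"
  proof (induction rule: joined_induct)
    case base
    then show ?case using assms(1) \<open>(x, y) \<in> joined F X\<close>
      by (auto simp: joined_def equiv_def refl_on_def)
  next
    case (step z f)
    then show ?case using assms by (meson equivE transE)
  qed (use assms in \<open>auto simp: equiv_def refl_on_def\<close>)
qed

text \<open>No transitive closure is needed when only two classes are united, and so the new classes
  can be read off directly.\<close>

definition fuse :: "('a \<times> 'a) set \<Rightarrow> 'a \<Rightarrow> 'a \<Rightarrow> ('a \<times> 'a) set" where
  "fuse E x y = E \<union> E `` {x} \<times> E `` {y} \<union> E `` {y} \<times> E `` {x}"

lemma fuse_absorb: "equiv X E \<Longrightarrow> (x, y) \<in> E \<Longrightarrow> fuse E x y = E"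
  unfolding fuse_def equiv_def sym_def trans_def by blast

lemma fuse_least: "equiv X E \<Longrightarrow> E' \<subseteq> E \<Longrightarrow> (x, y) \<in> E \<Longrightarrow> fuse E' x y \<subseteq> E"
  unfolding fuse_def equiv_def by (auto; meson subsetD symD transD)

lemma equiv_fuse:
  assumes "equiv X E" "x \<in> X" "y \<in> X"
  shows "equiv X (fuse E x y)" "(x, y) \<in> fuse E x y"
proof -
  have "refl_on X E" "sym E" "trans E" "E \<subseteq> X \<times> X" using assms by (auto simp: equiv_def)
  note E = this[unfolded refl_on_def sym_def trans_def]
  show "equiv X (fuse E x y)"
  proof (rule equivI)
    show "fuse E x y \<subseteq> X \<times> X" using E unfolding fuse_def by blast
    show "refl_on X (fuse E x y)" using E unfolding fuse_def refl_on_def by blast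
    show "sym (fuse E x y)" using E unfolding fuse_def sym_def by blast
    show "trans (fuse E x y)" using E unfolding fuse_def trans_def by blast
  qed
  show "(x, y) \<in> fuse E x y" using E assms unfolding fuse_def by blast
qed

lemma fuse_class:
  assumes "equiv X E" "x \<in> X" "y \<in> X" "z \<in> X"
  shows "fuse E x y `` {z} =
    (if (x, z) \<in> E \<or> (y, z) \<in> E then E `` {x} \<union> E `` {y} else E `` {z})"
proof -
  have "refl_on X E" "sym E" "trans E" using assms by (auto simp: equiv_def)
  note E = this[unfolded refl_on_def sym_def trans_def]
  show ?thesis
  proof (cases "(x, z) \<in> E \<or> (y, z) \<in> E")
    case True
    then have "fuse E x y `` {z} = E `` {x} \<union> E `` {y}"
      using E assms(2-4) unfolding fuse_def by blast
    then show ?thesis using True by simp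
  next
    case False
    then have "fuse E x y `` {z} = E `` {z}"
      using E assms(2-4) unfolding fuse_def by blast
    then show ?thesis using False by simp
  qed
qed

lemma quotient_fuse:
  assumes "equiv X E" "x \<in> X" "y \<in> X"
  shows "X // fuse E x y = insert (E `` {x} \<union> E `` {y}) (X // E - {E `` {x}, E `` {y}})"
proof (rule Set.set_eqI, rule iffI)
  fix C assume "C \<in> X // fuse E x y"
  then obtain z where z: "z \<in> X" "C = fuse E x y `` {z}" by (auto simp: quotient_def)
  have neq: "E `` {z} \<noteq> E `` {w}" if "(w, z) \<notin> E" "w \<in> X" for w
    using eq_equiv_class_iff[OF assms(1) that(2) z(1)] that(1) by metis
  show "C \<in> insert (E `` {x} \<union> E `` {y}) (X // E - {E `` {x}, E `` {y}})"
  proof (cases "(x, z) \<in> E \<or> (y, z) \<in> E")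
    case True
    then show ?thesis using z assms by (simp add: fuse_class)
  next
    case False
    then have "C = E `` {z}" using z assms by (simp add: fuse_class)
    then show ?thesis using False neq assms z by (simp add: quotientI)
  qed
next
  fix C assume C: "C \<in> insert (E `` {x} \<union> E `` {y}) (X // E - {E `` {x}, E `` {y}})"
  have xx: "(x, x) \<in> E" using assms by (simp add: equiv_def refl_on_def)
  show "C \<in> X // fuse E x y"
  proof (cases "C = E `` {x} \<union> E `` {y}")
    case True
    then have "C = fuse E x y `` {x}"
      using xx assms fuse_class[OF assms assms(2)] by simp
    then show ?thesis using assms by (simp add: quotientI)
  next
    case False
    then have CE: "C \<in> X // E" "C \<noteq> E `` {x}" "C \<noteq> E `` {y}" using C by auto
    from CE(1) obtain z where z: "z \<in> X" "C = E `` {z}" by (rule quotientE)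
    with CE have "(x, z) \<notin> E" "(y, z) \<notin> E"
      using assms equiv_class_eq[OF assms(1)] by metis+
    then have "C = fuse E x y `` {z}"
      using fuse_class[OF assms z(1)] z(2) by simp
    then show ?thesis using z by (simp add: quotientI)
  qed
qed

lemma union_class_notin_quotient:
  assumes "equiv X E" "x \<in> X" "y \<in> X" "(x, y) \<notin> E"
  shows "E `` {x} \<union> E `` {y} \<notin> X // E"
proof
  assume "E `` {x} \<union> E `` {y} \<in> X // E"
  moreover have "x \<in> E `` {x} \<union> E `` {y}" "y \<in> E `` {x} \<union> E `` {y}"
    using assms by (auto simp: equiv_def refl_on_def)
  ultimately show False using quotient_eq_iff[OF assms(1)] assms(4) by blast
qed

lemma card_quotient_fuse:
  assumes "finite X" "equiv X E" "x \<in> X" "y \<in> X" "(x, y) \<notin> E"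
  shows "card (X // E) = Suc (card (X // fuse E x y))"
proof -
  have fin: "finite (X // E)" using assms by (simp add: finite_quotient equiv_type)
  have two: "E `` {x} \<in> X // E" "E `` {y} \<in> X // E" "E `` {x} \<noteq> E `` {y}"
    using assms eq_equiv_class_iff[OF assms(2)] by (auto simp: quotientI)
  have "card (X // fuse E x y) = Suc (card (X // E - {E `` {x}, E `` {y}}))"
    using union_class_notin_quotient[OF assms(2-5)] fin assms
    by (subst quotient_fuse) auto
  moreover have "card (X // E - {E `` {x}, E `` {y}}) = card (X // E) - 2"
    using two fin by (subst card_Diff_subset) auto
  moreover have "card (X // E) \<ge> 2"
    using two fin card_mono[of "X // E" "{E `` {x}, E `` {y}}"] by auto
  ultimately show ?thesis by linarith
qed

lemma even_card_involution:
  assumes "finite A" "\<And>x. x \<in> A \<Longrightarrow> f x \<in> A" "\<And>x. x \<in> A \<Longrightarrow> f x \<noteq> x" "\<And>x. x \<in> A \<Longrightarrow> f (f x) = x"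
  shows "even (card A)"
  using assms
proof (induction "card A" arbitrary: A rule: less_induct)
  case less
  show ?case
  proof (cases "A = {}")
    case False
    then obtain x where x: "x \<in> A" by auto
    let ?B = "A - {x, f x}"
    have two: "card {x, f x} = 2" using less.prems(3)[OF x] by auto
    have card: "card A = card ?B + 2"
    proof -
      have sub: "{x, f x} \<subseteq> A" using x less.prems(2) by simp
      then have "card ?B = card A - card {x, f x}" by (intro card_Diff_subset) auto
      moreover have "card {x, f x} \<le> card A" by (rule card_mono[OF less.prems(1) sub])
      ultimately show ?thesis using two by linarith
    qed
    have "f y \<in> ?B" if y: "y \<in> ?B" for y
    proof -
      have "y \<in> A" "y \<noteq> x" "y \<noteq> f x" using y by auto
      moreover have "f (f y) = y" "f (f x) = x" using less.prems(4) x y by auto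
      ultimately show ?thesis using less.prems(2) by fastforce
    qed
    then have "even (card ?B)"
      using card less.prems by (intro less.hyps) auto
    then show ?thesis using card by simp
  qed simp
qed

section \<open>Partial smoothings\<close>

text \<open>For \<open>s\<close> inside \<open>t\<close>, these are the components of the diagram
  whose crossings in \<open>s\<close> are smoothed positively, those outside \<open>t\<close>
  negatively, and those in \<open>t - s\<close> not at all: both smoothings together tie all four
  half-edges. For \<open>s = t\<close> the classes are the circles of the state.\<close>

definition linked :: "link_diagram \<Rightarrow> kauffman_state \<Rightarrow> kauffman_state \<Rightarrow> ((nat \<times> nat) \<times> (nat \<times> nat)) set" where
  "linked D s t = joined {glue D, smoothing s, smoothing t} (half_edges D)"

definition num_classes :: "link_diagram \<Rightarrow> kauffman_state \<Rightarrow> kauffman_state \<Rightarrow> nat" where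
  "num_classes D s t = card (half_edges D // linked D s t)"

text \<open>Join the circles of \<open>s\<close> to those of \<open>t\<close> by a cobordism with
  one saddle for each crossing of \<open>t - s\<close> and cap it with discs. The defect is twice
  the number of components of this closed surface minus its Euler characteristic. For a full plane
  diagram this is twice the genus of the Turaev surface.\<close>

definition defect :: "link_diagram \<Rightarrow> kauffman_state \<Rightarrow> kauffman_state \<Rightarrow> int" where
  "defect D s t = int (card (t - s)) + 2 * int (num_classes D s t)
     - int (num_classes D s s) - int (num_classes D t t)"

lemma smoothing_simps [simp]:
  "smoothing s (c, 0) = (c, if c \<in> s then Suc 0 else 3)"
  "smoothing s (c, Suc 0) = (c, if c \<in> s then 0 else 2)"
  "smoothing s (c, 2) = (c, if c \<in> s then 3 else Suc 0)"
  "smoothing s (c, 3) = (c, if c \<in> s then 2 else 0)"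
  by (auto simp: smoothing_def turn_def)

lemma finite_half_edges [simp]: "finite (half_edges D)"
  by (simp add: half_edges_def crossings_def)

lemma finite_crossings [simp]: "finite (crossings D)"
  by (simp add: crossings_def)

lemma half_edge_iff [simp]: "(c, p) \<in> half_edges D \<longleftrightarrow> c \<in> crossings D \<and> p < 4"
  by (auto simp: half_edges_def)

lemma half_edge_cases:
  assumes "h \<in> half_edges D"
  obtains c where "c \<in> crossings D" "h = (c, 0) \<or> h = (c, Suc 0) \<or> h = (c, 2) \<or> h = (c, 3)"
proof -
  obtain c p where h: "h = (c, p)" "c \<in> crossings D" "p < 4"
    using assms by (auto simp: half_edges_def)
  have "p = 0 \<or> p = Suc 0 \<or> p = 2 \<or> p = 3" using h(3) by auto
  then show thesis using that h by auto
qed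

lemma smoothing_involution:
  assumes "h \<in> half_edges D"
  shows "smoothing s h \<in> half_edges D" "smoothing s h \<noteq> h" "smoothing s (smoothing s h) = h"
    "fst (smoothing s h) = fst h"
  using assms by (auto elim!: half_edge_cases split: if_splits)

lemma smoothing_cong: "(fst h \<in> s \<longleftrightarrow> fst h \<in> t) \<Longrightarrow> smoothing s h = smoothing t h"
  by (simp add: smoothing_def)

locale gauss_diagram =
  fixes D :: link_diagram
  assumes glue_in [simp]: "h \<in> half_edges D \<Longrightarrow> glue D h \<in> half_edges D"
    and glue_neq: "h \<in> half_edges D \<Longrightarrow> glue D h \<noteq> h"
    and glue_glue [simp]: "h \<in> half_edges D \<Longrightarrow> glue D (glue D h) = h"
begin

lemma equiv_linked: "equiv (half_edges D) (linked D s t)"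
  unfolding linked_def by (rule equiv_joined) (auto simp: smoothing_involution)

lemma linked_in: "(x, y) \<in> linked D s t \<Longrightarrow> x \<in> half_edges D \<and> y \<in> half_edges D"
  by (auto simp: linked_def joined_def)

lemma linked_refl: "x \<in> half_edges D \<Longrightarrow> (x, x) \<in> linked D s t"
  by (simp add: linked_def joined_refl)

lemma linked_sym: "(x, y) \<in> linked D s t \<Longrightarrow> (y, x) \<in> linked D s t"
  using equiv_linked by (meson equivE symD)

lemma linked_trans: "(x, y) \<in> linked D s t \<Longrightarrow> (y, z) \<in> linked D s t \<Longrightarrow> (x, z) \<in> linked D s t"
  using equiv_linked by (meson equivE transD)

lemma linked_glue: "x \<in> half_edges D \<Longrightarrow> (x, glue D x) \<in> linked D s t"
  by (simp add: linked_def joined_step)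

lemma linked_smoothing:
  "x \<in> half_edges D \<Longrightarrow> (x, smoothing s x) \<in> linked D s t"
  "x \<in> half_edges D \<Longrightarrow> (x, smoothing t x) \<in> linked D s t"
  by (simp_all add: linked_def joined_step smoothing_involution)

lemma linked_least:
  assumes "equiv (half_edges D) R" "\<And>x. x \<in> half_edges D \<Longrightarrow> (x, glue D x) \<in> R"
    and "\<And>x. x \<in> half_edges D \<Longrightarrow> (x, smoothing s x) \<in> R"
    and "\<And>x. x \<in> half_edges D \<Longrightarrow> (x, smoothing t x) \<in> R"
  shows "linked D s t \<subseteq> R"
  unfolding linked_def using assms by (intro joined_least) auto

lemma linked_mono:
  assumes "s \<subseteq> s'" "s' \<subseteq> t" "s \<subseteq> t'" "t' \<subseteq> t"
  shows "linked D s' t' \<subseteq> linked D s t"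
proof (rule linked_least[OF equiv_linked linked_glue])
  fix x assume x: "x \<in> half_edges D"
  have "smoothing u x = smoothing s x \<or> smoothing u x = smoothing t x" if "s \<subseteq> u" "u \<subseteq> t" for u
    using that smoothing_cong[of x u s] smoothing_cong[of x u t] by blast
  then show "(x, smoothing s' x) \<in> linked D s t" "(x, smoothing t' x) \<in> linked D s t"
    using assms linked_smoothing[OF x] by metis+
qed

lemma linked_corner:
  assumes "v \<in> crossings D"
  shows "v \<in> s \<Longrightarrow> ((v, 0), (v, Suc 0)) \<in> linked D s t" "v \<in> s \<Longrightarrow> ((v, 2), (v, 3)) \<in> linked D s t"
    "v \<notin> s \<Longrightarrow> ((v, 0), (v, 3)) \<in> linked D s t" "v \<notin> s \<Longrightarrow> ((v, 2), (v, Suc 0)) \<in> linked D s t"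
    "v \<in> t \<Longrightarrow> ((v, 0), (v, Suc 0)) \<in> linked D s t" "v \<in> t \<Longrightarrow> ((v, 2), (v, 3)) \<in> linked D s t"
    "v \<notin> t \<Longrightarrow> ((v, 0), (v, 3)) \<in> linked D s t" "v \<notin> t \<Longrightarrow> ((v, 2), (v, Suc 0)) \<in> linked D s t"
  using linked_smoothing(1)[of "(v, 0)" s t] linked_smoothing(1)[of "(v, 2)" s t]
    linked_smoothing(2)[of "(v, 0)" t s] linked_smoothing(2)[of "(v, 2)" t s] assms by auto

lemma linked_mixed:
  assumes "v \<in> crossings D" "v \<notin> s" "v \<in> t"
  shows "((v, 0), (v, 2)) \<in> linked D s t"
  using assms by (intro linked_trans[OF linked_corner(5) linked_sym[OF linked_corner(4)]])

text \<open>The positive smoothing leaves the arcs 0-1 and 2-3 at \<open>v\<close>, and restoring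
  the crossing only ties them together. Half-edges 0 and 2 lie on different arcs for the negative
  smoothing as well, which is why \<open>(v, 0)\<close> and \<open>(v, 2)\<close> represent the two
  sides of \<open>v\<close> throughout.\<close>

lemma linked_add_crossing:
  assumes "v \<in> crossings D" "v \<notin> s" "v \<in> t" "s \<subseteq> t"
  shows "linked D s t = fuse (linked D (insert v s) t) (v, 0) (v, 2)"
proof
  let ?E = "linked D (insert v s) t" and ?R = "fuse (linked D (insert v s) t) (v, 0) (v, 2)"
  have R: "equiv (half_edges D) ?R" "((v, 0), (v, 2)) \<in> ?R"
    using assms by (auto intro!: equiv_fuse equiv_linked)
  have sub: "?E \<subseteq> ?R" by (auto simp: fuse_def)
  show "linked D s t \<subseteq> ?R"
  proof (rule linked_least[OF R(1)])
    fix x assume x: "x \<in> half_edges D"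
    show "(x, glue D x) \<in> ?R" "(x, smoothing t x) \<in> ?R"
      using sub linked_glue[OF x] linked_smoothing[OF x] by blast+
    show "(x, smoothing s x) \<in> ?R"
    proof (cases "fst x = v")
      case False
      then have "smoothing s x = smoothing (insert v s) x" by (intro smoothing_cong) auto
      then show ?thesis using sub linked_smoothing[OF x] by auto
    next
      case True
      have c: "((v, 0), (v, Suc 0)) \<in> ?R" "((v, 2), (v, 3)) \<in> ?R"
        using sub linked_corner[OF assms(1)] by auto
      have sym: "(b, a) \<in> ?R" if "(a, b) \<in> ?R" for a b
        using R(1) that by (meson equivE symD)
      have trans: "(a, c) \<in> ?R" if "(a, b) \<in> ?R" "(b, c) \<in> ?R" for a b c
        using R(1) that by (meson equivE transD)
      have "((v, 0), (v, 3)) \<in> ?R" "((v, 2), (v, Suc 0)) \<in> ?R"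
        using trans[OF R(2) c(2)] trans[OF sym[OF R(2)] c(1)] by auto
      then show ?thesis using x True assms(2) sym by (auto elim!: half_edge_cases)
    qed
  qed
  show "?R \<subseteq> linked D s t"
    using assms linked_mixed[of v s t]
    by (intro fuse_least[OF equiv_linked] linked_mono) auto
qed

lemma linked_remove_crossing:
  assumes "v \<in> crossings D" "v \<notin> s" "v \<in> t" "s \<subseteq> t"
  shows "linked D s t = fuse (linked D s (t - {v})) (v, 0) (v, 2)"
proof
  let ?E = "linked D s (t - {v})" and ?R = "fuse (linked D s (t - {v})) (v, 0) (v, 2)"
  have R: "equiv (half_edges D) ?R" "((v, 0), (v, 2)) \<in> ?R"
    using assms by (auto intro!: equiv_fuse equiv_linked)
  have sub: "?E \<subseteq> ?R" by (auto simp: fuse_def)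
  show "linked D s t \<subseteq> ?R"
  proof (rule linked_least[OF R(1)])
    fix x assume x: "x \<in> half_edges D"
    show "(x, glue D x) \<in> ?R" "(x, smoothing s x) \<in> ?R"
      using sub linked_glue[OF x] linked_smoothing[OF x] by blast+
    show "(x, smoothing t x) \<in> ?R"
    proof (cases "fst x = v")
      case False
      then have "smoothing t x = smoothing (t - {v}) x" by (intro smoothing_cong) auto
      then show ?thesis using sub linked_smoothing[OF x] by auto
    next
      case True
      have c: "((v, 0), (v, 3)) \<in> ?R" "((v, 2), (v, Suc 0)) \<in> ?R"
        using sub linked_corner[OF assms(1)] by auto
      have sym: "(b, a) \<in> ?R" if "(a, b) \<in> ?R" for a b
        using R(1) that by (meson equivE symD)
      have trans: "(a, c) \<in> ?R" if "(a, b) \<in> ?R" "(b, c) \<in> ?R" for a b c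
        using R(1) that by (meson equivE transD)
      have "((v, 0), (v, Suc 0)) \<in> ?R" "((v, 2), (v, 3)) \<in> ?R"
        using trans[OF R(2) c(2)] trans[OF sym[OF R(2)] c(1)] by auto
      then show ?thesis using x True assms(3) sym by (auto elim!: half_edge_cases)
    qed
  qed
  show "?R \<subseteq> linked D s t"
    using assms linked_mixed[of v s t]
    by (intro fuse_least[OF equiv_linked] linked_mono) auto
qed

lemma num_classes_add:
  assumes "v \<in> crossings D" "v \<notin> s" "v \<in> t" "s \<subseteq> t"
  shows "num_classes D (insert v s) t =
    num_classes D s t + (if ((v, 0), (v, 2)) \<in> linked D (insert v s) t then 0 else 1)"
  unfolding num_classes_def linked_add_crossing[OF assms]
  using assms by (auto simp: fuse_absorb[OF equiv_linked] intro!: card_quotient_fuse equiv_linked)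

lemma num_classes_remove:
  assumes "v \<in> crossings D" "v \<notin> s" "v \<in> t" "s \<subseteq> t"
  shows "num_classes D s (t - {v}) =
    num_classes D s t + (if ((v, 0), (v, 2)) \<in> linked D s (t - {v}) then 0 else 1)"
  unfolding num_classes_def linked_remove_crossing[OF assms]
  using assms by (auto simp: fuse_absorb[OF equiv_linked] intro!: card_quotient_fuse equiv_linked)

text \<open>Each of the two states arises from the diagram with \<open>v\<close> unsmoothed by
  pulling its arcs apart, which creates a new class exactly when the arcs end up on different
  circles.\<close>

lemma num_circles_change:
  assumes "v \<in> crossings D" "v \<notin> s"
  shows "num_classes D (insert v s) (insert v s) = num_classes D s (insert v s) +
      (if ((v, 0), (v, 2)) \<in> linked D (insert v s) (insert v s) then 0 else 1)"
    and "num_classes D s s = num_classes D s (insert v s) +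
      (if ((v, 0), (v, 2)) \<in> linked D s s then 0 else 1)"
  using num_classes_add[OF assms, of "insert v s"] num_classes_remove[OF assms, of "insert v s"] assms(2)
  by (simp_all add: subset_insertI)

text \<open>
  Otherwise the intersection of the two circles through \<open>(v, 0)\<close> would contain no other half-edge
  at \<open>v\<close>: it would be closed under gluing, hence even, and closed under smoothing except for
  \<open>(v, 0)\<close>, hence odd.
\<close>

lemma not_both_split:
  assumes v: "v \<in> crossings D" "v \<notin> s"
  shows "((v, 0), (v, 2)) \<in> linked D s s \<or>
    ((v, 0), (v, 2)) \<in> linked D (insert v s) (insert v s)"
proof (rule ccontr)
  let ?s' = "insert v s"
  assume "\<not> ?thesis"
  then have no: "((v, 0), (v, 2)) \<notin> linked D s s" "((v, 0), (v, 2)) \<notin> linked D ?s' ?s'" by auto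
  define K where "K = {x. ((v, 0), x) \<in> linked D s s \<and> ((v, 0), x) \<in> linked D ?s' ?s'}"
  have KH: "K \<subseteq> half_edges D" using linked_in by (auto simp: K_def)
  then have fin: "finite K" using finite_subset finite_half_edges by blast
  have v0: "(v, 0) \<in> K" using v by (simp add: K_def linked_refl)
  \<comment> \<open>Half-edge 1 is joined to 2 in \<open>s\<close>, and half-edge 3 is joined to 2
    in \<open>?s'\<close>; any second half-edge at \<open>v\<close> would thus link
    \<open>(v, 0)\<close> to \<open>(v, 2)\<close> in one of the states.\<close>
  have off: "fst x \<noteq> v" if x: "x \<in> K" "x \<noteq> (v, 0)" for x
  proof
    assume "fst x = v"
    moreover have "x \<in> half_edges D" using x KH by auto
    ultimately have "x = (v, Suc 0) \<or> x = (v, 2) \<or> x = (v, 3)"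
      using x(2) by (auto elim!: half_edge_cases)
    moreover have "((v, 0), x) \<in> linked D s s" "((v, 0), x) \<in> linked D ?s' ?s'"
      using x(1) by (simp_all add: K_def)
    moreover have "((v, Suc 0), (v, 2)) \<in> linked D s s"
      using linked_corner(4)[OF v] by (rule linked_sym)
    moreover have "((v, 3), (v, 2)) \<in> linked D ?s' ?s'"
      using linked_corner(2)[OF v(1), of ?s'] by (blast intro: linked_sym)
    ultimately show False using no linked_trans by blast
  qed
  have "even (card K)"
    using fin KH
    by (intro even_card_involution[of K "glue D"])
      (auto simp: K_def glue_neq intro: linked_trans linked_glue dest: linked_in)
  moreover have "even (card (K - {(v, 0)}))"
  proof (rule even_card_involution[of _ "smoothing s"])
    fix x assume x: "x \<in> K - {(v, 0)}"
    then have fx: "fst x \<noteq> v" and xH: "x \<in> half_edges D" using off KH by auto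
    have "smoothing s x = smoothing ?s' x" using fx by (intro smoothing_cong) auto
    then have "smoothing s x \<in> K"
      using x linked_smoothing(1)[OF xH] unfolding K_def by (metis (mono_tags, lifting) DiffE linked_trans mem_Collect_eq)
    moreover have "smoothing s x \<noteq> (v, 0)" using fx smoothing_involution(4)[OF xH, of s] by auto
    ultimately show "smoothing s x \<in> K - {(v, 0)}" by simp
    show "smoothing s x \<noteq> x" "smoothing s (smoothing s x) = x"
      using smoothing_involution[OF xH] by auto
  qed (use fin in simp)
  moreover have "card K = Suc (card (K - {(v, 0)}))"
    using fin v0 by (metis card_Suc_Diff1)
  ultimately show False by simp
qed

text \<open>If the smoothing disconnects a component, the ends of \<open>v\<close> are also apart in
  the state \<open>insert v s\<close>, so by \<open>not_both_split\<close> that state has one circle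
  more than \<open>s\<close>: the change is -1 + 2 - 1 = 0. Otherwise the number of classes stays,
  at most one circle is lost, and the change is at most -1 + 1.\<close>

lemma defect_add:
  assumes "v \<in> crossings D" "v \<notin> s" "v \<in> t" "s \<subseteq> t" "finite t"
  shows "defect D (insert v s) t \<le> defect D s t"
proof -
  have "linked D (insert v s) (insert v s) \<subseteq> linked D (insert v s) t"
    using assms by (intro linked_mono) auto
  moreover have "card (t - s) = Suc (card (t - insert v s))"
    using assms by (metis DiffI Diff_insert card_Suc_Diff1 finite_Diff)
  ultimately show ?thesis
    using not_both_split[OF assms(1,2)] num_classes_add[OF assms(1-4)]
      num_circles_change[OF assms(1,2)]
    by (auto simp: defect_def split: if_splits)
qed

lemma defect_remove:
  assumes "v \<in> crossings D" "v \<notin> s" "v \<in> t" "s \<subseteq> t" "finite t"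
  shows "defect D s (t - {v}) \<le> defect D s t"
proof -
  have t: "insert v t = t" using assms by auto
  have "linked D (t - {v}) (t - {v}) \<subseteq> linked D s (t - {v})"
    using assms by (intro linked_mono) auto
  moreover have "card (t - s) = Suc (card (t - {v} - s))"
    using assms by (metis DiffI Diff_insert Diff_insert2 card_Suc_Diff1 finite_Diff)
  ultimately show ?thesis
    using not_both_split[OF assms(1), of "t - {v}"] num_classes_remove[OF assms(1-4)]
      num_circles_change[OF assms(1), of "t - {v}"]
    by (auto simp: defect_def t split: if_splits)
qed

lemma defect_mono:
  assumes "s \<subseteq> s'" "s' \<subseteq> t'" "t' \<subseteq> t" "t \<subseteq> crossings D"
  shows "defect D s' t' \<le> defect D s t"
proof -
  have fin: "finite t" using assms finite_subset finite_crossings by blast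
  have "defect D (s \<union> A) t \<le> defect D s t" if "finite A" "A \<subseteq> t - s" for A
    using that
  proof (induction A rule: finite_induct)
    case (insert v A)
    have "defect D (insert v (s \<union> A)) t \<le> defect D (s \<union> A) t"
      using insert assms fin by (intro defect_add) auto
    then show ?case using insert by auto
  qed simp
  from this[of "s' - s"] have 1: "defect D s' t \<le> defect D s t"
    using assms fin finite_subset[of "s' - s" t] by (auto simp: Un_absorb1)
  have "defect D s' (t - A) \<le> defect D s' t" if "finite A" "A \<subseteq> t - s'" for A
    using that
  proof (induction A rule: finite_induct)
    case (insert v A)
    have "defect D s' (t - A - {v}) \<le> defect D s' (t - A)"
      using insert assms fin by (intro defect_remove) auto
    moreover have "t - insert v A = t - A - {v}" by auto
    ultimately show ?case using insert by auto
  qed simp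
  from this[of "t - t'"] have "defect D s' t' \<le> defect D s' t"
    using assms fin by (auto simp: double_diff)
  then show ?thesis using 1 by simp
qed

end

locale planar_diagram = gauss_diagram +
  assumes planar: "defect D {} (crossings D) = 0"
    and no_free_circles: "free_circles D = 0"
begin

text \<open>The value is squeezed between the defect of a complete smoothing, which is 0 by
  definition, and that of the whole diagram.\<close>

lemma defect_eq_0:
  assumes "s \<subseteq> t" "t \<subseteq> crossings D"
  shows "defect D s t = 0"
proof -
  have "defect D s t \<le> 0"
    using defect_mono[of "{}" s t "crossings D"] assms planar by simp
  moreover have "defect D s s \<le> defect D s t" using assms by (intro defect_mono) auto
  moreover have "defect D s s = 0" by (simp add: defect_def)
  ultimately show ?thesis by simp
qed

text \<open>Let c be the number of classes with \<open>v\<close> unsmoothed. Defect 0 says that the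
  two states have 2 c + 1 circles together, so exactly one of them has the ends of \<open>v\<close>
  on different circles. This excludes a change of marker that turns one circle into one
  circle.\<close>

lemma split_iff:
  assumes "v \<in> crossings D" "v \<notin> s" "s \<subseteq> crossings D"
  shows "((v, 0), (v, 2)) \<in> linked D s s \<longleftrightarrow>
    ((v, 0), (v, 2)) \<notin> linked D (insert v s) (insert v s)"
proof -
  have "defect D s (insert v s) = 0" using assms by (intro defect_eq_0) auto
  moreover have "insert v s - s = {v}" using assms by auto
  ultimately show ?thesis
    using not_both_split[OF assms(1,2)] num_circles_change[OF assms(1,2)]
    by (auto simp: defect_def split: if_splits)
qed

section \<open>Circles of a state\<close>

text \<open>A half-edge names a circle in every state at once. The circle itself is a set of
  half-edges, so circles away from a changed crossing are literally equal in both states, as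
  \<open>incidence\<close> presupposes.\<close>

definition circ :: "kauffman_state \<Rightarrow> nat \<times> nat \<Rightarrow> circle" where
  "circ s h = Inl (linked D s s `` {h})"

lemma state_circles_eq: "state_circles D s = circ s ` half_edges D"
proof -
  have "joined_classes {glue D, smoothing s} (half_edges D) = half_edges D // linked D s s"
    unfolding linked_def by (subst joined_classes_eq) (auto simp: smoothing_involution)
  then show ?thesis
    by (auto simp: state_circles_def no_free_circles circ_def quotient_def Plus_def)
qed

lemma circ_in [simp]: "h \<in> half_edges D \<Longrightarrow> circ s h \<in> state_circles D s"
  by (simp add: state_circles_eq)

lemma finite_state_circles [simp]: "finite (state_circles D s)"
  by (simp add: state_circles_eq)

lemma card_state_circles: "card (state_circles D s) = num_classes D s s"
proof -
  have "state_circles D s = Inl ` (half_edges D // linked D s s)"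
    by (auto simp: state_circles_eq circ_def quotient_def)
  then show ?thesis by (simp add: num_classes_def card_image)
qed

lemma circ_eq_iff:
  "h \<in> half_edges D \<Longrightarrow> k \<in> half_edges D \<Longrightarrow> circ s h = circ s k \<longleftrightarrow> (h, k) \<in> linked D s s"
  using eq_equiv_class_iff[OF equiv_linked] by (simp add: circ_def)

lemma touches_circ:
  assumes "h \<in> half_edges D" "v \<in> crossings D"
  shows "touches (circ s h) v \<longleftrightarrow> circ s h = circ s (v, 0) \<or> circ s h = circ s (v, 2)"
proof
  assume "touches (circ s h) v"
  then obtain p where p: "(h, (v, p)) \<in> linked D s s" by (auto simp: touches_def circ_def)
  then have "(v, p) = (v, 0) \<or> (v, p) = (v, Suc 0) \<or> (v, p) = (v, 2) \<or> (v, p) = (v, 3)"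
    using linked_in[OF p] by auto
  moreover have "((v, Suc 0), (v, 0)) \<in> linked D s s \<or> ((v, Suc 0), (v, 2)) \<in> linked D s s"
    "((v, 3), (v, 0)) \<in> linked D s s \<or> ((v, 3), (v, 2)) \<in> linked D s s"
    using linked_corner[OF assms(2), of s s] linked_sym by blast+
  ultimately show "circ s h = circ s (v, 0) \<or> circ s h = circ s (v, 2)"
    using p assms by (auto simp: circ_eq_iff intro: linked_trans)
next
  assume "circ s h = circ s (v, 0) \<or> circ s h = circ s (v, 2)"
  then show "touches (circ s h) v"
    using assms by (auto simp: circ_eq_iff) (auto simp: touches_def circ_def)
qed

text \<open>Two states that differ at \<open>v\<close>, where \<open>w\<close> has one circle in
  place of two circles of \<open>u\<close>. Either of them may be the one with the positive marker,
  so merging and splitting share the same facts about circles.\<close>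

definition fuses :: "nat \<Rightarrow> kauffman_state \<Rightarrow> kauffman_state \<Rightarrow> bool" where
  "fuses v u w \<longleftrightarrow> v \<in> crossings D \<and> ((v, 0), (v, 2)) \<notin> linked D u u \<and>
     linked D w w = fuse (linked D u u) (v, 0) (v, 2)"

lemma fuses_cases:
  assumes "v \<in> s" "s \<subseteq> crossings D"
  shows "((v, 0), (v, 2)) \<notin> linked D s s \<Longrightarrow> fuses v s (s - {v})"
    "((v, 0), (v, 2)) \<in> linked D s s \<Longrightarrow> fuses v (s - {v}) s"
proof -
  have v: "v \<in> crossings D" "v \<notin> s - {v}" "insert v s = s" "v \<in> s" "s - {v} \<subseteq> s"
    using assms by auto
  have sp: "((v, 0), (v, 2)) \<in> linked D (s - {v}) (s - {v}) \<longleftrightarrow> ((v, 0), (v, 2)) \<notin> linked D s s"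
    using split_iff[OF v(1,2)] v assms by auto
  have 1: "linked D (s - {v}) s = fuse (linked D s s) (v, 0) (v, 2)"
    using linked_add_crossing[OF v(1,2,4,5)] by (simp add: v(3))
  have 2: "linked D (s - {v}) s = fuse (linked D (s - {v}) (s - {v})) (v, 0) (v, 2)"
    using linked_remove_crossing[OF v(1,2,4,5)] .
  show "((v, 0), (v, 2)) \<notin> linked D s s \<Longrightarrow> fuses v s (s - {v})"
    using sp 1 2 v(1) fuse_absorb[OF equiv_linked] by (simp add: fuses_def)
  show "((v, 0), (v, 2)) \<in> linked D s s \<Longrightarrow> fuses v (s - {v}) s"
    using sp 1 2 v(1) fuse_absorb[OF equiv_linked] by (simp add: fuses_def)
qed

lemma fuses_circ:
  assumes "fuses v u w" "h \<in> half_edges D"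
  shows "circ w h =
    (if circ u h = circ u (v, 0) \<or> circ u h = circ u (v, 2) then circ w (v, 0) else circ u h)"
proof -
  have v: "(v, 0) \<in> half_edges D" "(v, 2) \<in> half_edges D"
    using assms by (auto simp: fuses_def)
  have lw: "linked D w w = fuse (linked D u u) (v, 0) (v, 2)" using assms by (simp add: fuses_def)
  have iff: "circ u h = circ u (v, p) \<longleftrightarrow> ((v, p), h) \<in> linked D u u"
    if "(v, p) \<in> half_edges D" for p
    using circ_eq_iff[OF that assms(2)] by metis
  show ?thesis
    using iff[OF v(1)] iff[OF v(2)] linked_refl[OF v(1), of u u]
    unfolding circ_def lw
    by (simp add: fuse_class[OF equiv_linked v assms(2)] fuse_class[OF equiv_linked v v(1)])
qed

lemma fuses_props:
  assumes "fuses v u w"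
  shows "circ u (v, 0) \<noteq> circ u (v, 2)" "circ w (v, 2) = circ w (v, 0)"
    "circ w (v, 0) \<notin> state_circles D u"
    "state_circles D w = insert (circ w (v, 0)) (state_circles D u - {circ u (v, 0), circ u (v, 2)})"
proof -
  have v: "(v, 0) \<in> half_edges D" "(v, 2) \<in> half_edges D"
    and no: "((v, 0), (v, 2)) \<notin> linked D u u"
    and lw: "linked D w w = fuse (linked D u u) (v, 0) (v, 2)"
    using assms by (auto simp: fuses_def)
  show "circ u (v, 0) \<noteq> circ u (v, 2)" using no v by (simp add: circ_eq_iff)
  show "circ w (v, 2) = circ w (v, 0)" using fuses_circ[OF assms v(2)] by simp
  have "circ w (v, 0) = Inl (linked D u u `` {(v, 0)} \<union> linked D u u `` {(v, 2)})"
    unfolding circ_def lw using fuse_class[OF equiv_linked v v(1)] linked_refl[OF v(1), of u u] by simp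
  moreover have "linked D u u `` {(v, 0)} \<union> linked D u u `` {(v, 2)} \<notin> half_edges D // linked D u u"
    using union_class_notin_quotient[OF equiv_linked v no] .
  ultimately show "circ w (v, 0) \<notin> state_circles D u"
    by (auto simp: state_circles_eq circ_def quotient_def)
  show "state_circles D w = insert (circ w (v, 0)) (state_circles D u - {circ u (v, 0), circ u (v, 2)})"
  proof (rule Set.set_eqI, rule iffI)
    fix C assume "C \<in> state_circles D w"
    then obtain h where "h \<in> half_edges D" "C = circ w h" by (auto simp: state_circles_eq)
    then show "C \<in> insert (circ w (v, 0)) (state_circles D u - {circ u (v, 0), circ u (v, 2)})"
      using fuses_circ[OF assms] by auto
  next
    fix C assume C: "C \<in> insert (circ w (v, 0)) (state_circles D u - {circ u (v, 0), circ u (v, 2)})"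
    show "C \<in> state_circles D w"
    proof (cases "C = circ w (v, 0)")
      case False
      then obtain h where h: "h \<in> half_edges D" "C = circ u h" "C \<noteq> circ u (v, 0)" "C \<noteq> circ u (v, 2)"
        using C by (auto simp: state_circles_eq)
      then have "circ w h = C" using fuses_circ[OF assms h(1)] by simp
      then show ?thesis using h circ_in by blast
    qed (use v in simp)
  qed
qed

text \<open>The condition on \<open>tau\<close> preserves the second degree: reversing a positive
  marker lowers the state sign by 2.\<close>

definition targets :: "nat \<Rightarrow> enhanced_state \<Rightarrow> enhanced_state set" where
  "targets v S = {S'. fst S' = fst S - {v} \<and> snd S' \<subseteq> state_circles D (fst S') \<and>
     (\<forall>C\<in>state_circles D (fst S). \<not> touches C v \<longrightarrow> (C \<in> snd S \<longleftrightarrow> C \<in> snd S')) \<and>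
     tau D S' = tau D S + 1}"

lemma tau_eq:
  assumes "P \<subseteq> state_circles D s"
  shows "tau D (s, P) = 2 * int (card P) - int (card (state_circles D s))"
proof -
  have "card (state_circles D s - P) = card (state_circles D s) - card P"
    using assms by (intro card_Diff_subset) (auto intro: finite_subset)
  moreover have "card P \<le> card (state_circles D s)" using assms by (intro card_mono) auto
  ultimately show ?thesis by (simp add: tau_def)
qed

lemma untouched_circles:
  assumes "v \<in> crossings D"
  shows "(\<forall>C\<in>state_circles D s. \<not> touches C v \<longrightarrow> Q C) \<longleftrightarrow>
    (\<forall>C\<in>state_circles D s - {circ s (v, 0), circ s (v, 2)}. Q C)"
  using touches_circ[OF _ assms] by (auto simp: state_circles_eq)

text \<open>Signs away from \<open>v\<close> are inherited, so only the sign of the new circle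
  \<open>c\<close> is open, and the degree decides it.\<close>

lemma targets_merge:
  assumes f: "fuses v s (s - {v})" and P: "P \<subseteq> state_circles D s"
  defines "a \<equiv> circ s (v, 0)" and "b \<equiv> circ s (v, 2)" and "c \<equiv> circ (s - {v}) (v, 0)"
  shows "targets v (s, P) =
    (if a \<in> P \<and> b \<in> P then {} else if a \<in> P \<or> b \<in> P then {(s - {v}, insert c (P - {a, b}))}
     else {(s - {v}, P)})"
proof -
  let ?t = "s - {v}"
  define R where "R = state_circles D s - {a, b}"
  have v: "v \<in> crossings D" using f by (simp add: fuses_def)
  have ab: "a \<noteq> b" "c \<notin> state_circles D s" "state_circles D ?t = insert c R"
    using fuses_props[OF f] by (auto simp: a_def b_def c_def R_def)
  have abS: "a \<in> state_circles D s" "b \<in> state_circles D s" using v by (auto simp: a_def b_def)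
  have S: "state_circles D s = insert a (insert b R)" "a \<notin> R" "b \<notin> R" "c \<notin> R" "finite R"
    "c \<noteq> a" "c \<noteq> b"
    using abS ab by (auto simp: R_def)
  define Q where "Q = P \<inter> R"
  have Qfin: "finite Q" "a \<notin> Q" "b \<notin> Q" "c \<notin> Q" "Q \<subseteq> R" using S by (auto simp: Q_def)
  have cards: "card (state_circles D s) = card R + 2" "card (state_circles D ?t) = card R + 1"
    using S ab by simp_all
  have Pcases: "P = Q \<union> (P \<inter> {a, b})" using P S by (auto simp: Q_def)
  \<comment> \<open>There is one circle less, and \<open>tau\<close> is twice the number of positive
    circles minus the number of circles; it rises by 1 exactly if the number of positive circles
    stays.\<close>
  have tgt: "(?t, P') \<in> targets v (s, P) \<longleftrightarrow>
      P' \<subseteq> insert c R \<and> P' \<inter> R = Q \<and> card P' = card P" for P'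
  proof (cases "P' \<subseteq> insert c R")
    case True
    have "(\<forall>C\<in>R. C \<in> P \<longleftrightarrow> C \<in> P') \<longleftrightarrow> P' \<inter> R = Q" by (auto simp: Q_def)
    then show ?thesis
      using True P ab cards untouched_circles[OF v, of s "\<lambda>C. C \<in> P \<longleftrightarrow> C \<in> P'"]
      by (auto simp: targets_def tau_eq R_def a_def b_def)
  qed (simp add: targets_def ab)
  have shape: "P' \<subseteq> insert c R \<and> P' \<inter> R = Q \<longleftrightarrow> P' = Q \<or> P' = insert c Q" for P'
    using Qfin(5) S(4) by auto
  have "card (insert c Q) = card Q + 1" using Qfin by simp
  then have mem: "(?t, P') \<in> targets v (s, P) \<longleftrightarrow>
      P' = Q \<and> card Q = card P \<or> P' = insert c Q \<and> card Q + 1 = card P" for P'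
    using tgt[of P'] shape[of P'] by auto
  have eq: "targets v (s, P) = (if card Q = card P then {(?t, Q)} else {}) \<union>
      (if card Q + 1 = card P then {(?t, insert c Q)} else {})" (is "_ = ?rhs")
  proof (rule Set.set_eqI)
    fix S' show "S' \<in> targets v (s, P) \<longleftrightarrow> S' \<in> ?rhs"
    proof (cases "fst S' = ?t")
      case True
      then obtain P' where "S' = (?t, P')" by (cases S') auto
      then show ?thesis using mem[of P'] by auto
    qed (auto simp: targets_def split: if_splits)
  qed
  consider "a \<in> P" "b \<in> P" | "a \<in> P" "b \<notin> P" | "a \<notin> P" "b \<in> P" | "a \<notin> P" "b \<notin> P" by blast
  then show ?thesis
  proof cases
    case 1
    then have "P = insert a (insert b Q)" using Pcases by blast
    then have "card P = card Q + 2" using Qfin ab(1) by simp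
    then show ?thesis using 1 eq by simp
  next
    case 2
    then have "P = insert a Q" using Pcases by blast
    moreover from this have "card P = card Q + 1" "P - {a, b} = Q" using Qfin by auto
    ultimately show ?thesis using 2 eq by simp
  next
    case 3
    then have "P = insert b Q" using Pcases by blast
    moreover from this have "card P = card Q + 1" "P - {a, b} = Q" using Qfin by auto
    ultimately show ?thesis using 3 eq by simp
  next
    case 4
    then have "P = Q" using Pcases by blast
    then show ?thesis using 4 eq by simp
  qed
qed

lemma targets_split:
  assumes f: "fuses v (s - {v}) s" and P: "P \<subseteq> state_circles D s"
  defines "a \<equiv> circ (s - {v}) (v, 0)" and "b \<equiv> circ (s - {v}) (v, 2)" and "c \<equiv> circ s (v, 0)"
  shows "targets v (s, P) =
    (if c \<in> P then {(s - {v}, insert a (insert b (P - {c})))}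
     else {(s - {v}, insert a P), (s - {v}, insert b P)})"
proof -
  let ?t = "s - {v}"
  define R where "R = state_circles D ?t - {a, b}"
  have v: "v \<in> crossings D" using f by (simp add: fuses_def)
  have ab: "a \<noteq> b" "c \<notin> state_circles D ?t" "state_circles D s = insert c R" "circ s (v, 2) = c"
    using fuses_props[OF f] by (auto simp: a_def b_def c_def R_def)
  have abS: "a \<in> state_circles D ?t" "b \<in> state_circles D ?t" using v by (auto simp: a_def b_def)
  have S: "state_circles D ?t = insert a (insert b R)" "a \<notin> R" "b \<notin> R" "c \<notin> R" "finite R"
    "c \<noteq> a" "c \<noteq> b"
    using abS ab by (auto simp: R_def)
  define Q where "Q = P \<inter> R"
  have Qfin: "finite Q" "a \<notin> Q" "b \<notin> Q" "c \<notin> Q" "Q \<subseteq> R" using S by (auto simp: Q_def)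
  have cards: "card (state_circles D ?t) = card R + 2" "card (state_circles D s) = card R + 1"
    using S ab by simp_all
  have Pcases: "P = Q \<union> (P \<inter> {c})" using P S ab by (auto simp: Q_def)
  have R: "state_circles D s - {circ s (v, 0), circ s (v, 2)} = R"
    using ab S by (auto simp: c_def)
  \<comment> \<open>Here there is one circle more, so the number of positive circles has to rise by
    1.\<close>
  have tgt: "(?t, P') \<in> targets v (s, P) \<longleftrightarrow>
      P' \<subseteq> insert a (insert b R) \<and> P' \<inter> R = Q \<and> card P' = card P + 1" for P'
  proof (cases "P' \<subseteq> insert a (insert b R)")
    case True
    have "(\<forall>C\<in>R. C \<in> P \<longleftrightarrow> C \<in> P') \<longleftrightarrow> P' \<inter> R = Q" by (auto simp: Q_def)
    then show ?thesis
      using True P S cards untouched_circles[OF v, of s "\<lambda>C. C \<in> P \<longleftrightarrow> C \<in> P'"]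
      by (auto simp: targets_def tau_eq R)
  qed (simp add: targets_def S)
  have shape: "P' \<subseteq> insert a (insert b R) \<and> P' \<inter> R = Q \<longleftrightarrow>
      P' = Q \<or> P' = insert a Q \<or> P' = insert b Q \<or> P' = insert a (insert b Q)" for P'
    using Qfin(5) S(2,3) by auto
  have cards': "card (insert a Q) = card Q + 1" "card (insert b Q) = card Q + 1"
    "card (insert a (insert b Q)) = card Q + 2"
    using Qfin ab(1) by auto
  have mem: "(?t, P') \<in> targets v (s, P) \<longleftrightarrow> P' = Q \<and> card Q = card P + 1 \<or>
      (P' = insert a Q \<or> P' = insert b Q) \<and> card Q = card P \<or>
      P' = insert a (insert b Q) \<and> card Q + 1 = card P" (is "_ \<longleftrightarrow> ?M") for P'
  proof -
    have "(?t, P') \<in> targets v (s, P) \<longleftrightarrow>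
        (P' = Q \<or> P' = insert a Q \<or> P' = insert b Q \<or> P' = insert a (insert b Q)) \<and>
        card P' = card P + 1"
      using tgt[of P'] shape[of P'] by blast
    also have "\<dots> \<longleftrightarrow> ?M" 
    proof
      assume "(P' = Q \<or> P' = insert a Q \<or> P' = insert b Q \<or> P' = insert a (insert b Q)) \<and>
        card P' = card P + 1"
      then show ?M using cards' by (elim conjE disjE) simp_all
    next
      assume ?M
      then show "(P' = Q \<or> P' = insert a Q \<or> P' = insert b Q \<or> P' = insert a (insert b Q)) \<and>
        card P' = card P + 1"
        using cards' by (elim conjE disjE) simp_all
    qed
    finally show ?thesis .
  qed
  have eq: "targets v (s, P) = (if card Q = card P then {(?t, insert a Q), (?t, insert b Q)} else {}) \<union>
      (if card Q + 1 = card P then {(?t, insert a (insert b Q))} else {}) \<union>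
      (if card Q = card P + 1 then {(?t, Q)} else {})" (is "_ = ?rhs")
  proof (rule Set.set_eqI)
    fix S' show "S' \<in> targets v (s, P) \<longleftrightarrow> S' \<in> ?rhs"
    proof (cases "fst S' = ?t")
      case True
      then obtain P' where "S' = (?t, P')" by (cases S') auto
      then show ?thesis using mem[of P'] by auto
    qed (auto simp: targets_def split: if_splits)
  qed
  show ?thesis
  proof (cases "c \<in> P")
    case True
    then have "P = insert c Q" using Pcases by blast
    moreover from this have "card P = card Q + 1" "P - {c} = Q" using Qfin by auto
    ultimately show ?thesis using True eq by simp
  next
    case False
    then have "P = Q" using Pcases by blast
    then show ?thesis using False eq by simp
  qed
qed

section \<open>The edge maps commute\<close>

definition edge :: "nat \<Rightarrow> enhanced_state \<Rightarrow> (enhanced_state \<Rightarrow>\<^sub>0 int)" where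
  "edge v S = (\<Sum>T\<in>targets v S. frag_of T)"

text \<open>
  With \<open>-\<close> as the unit and \<open>+\<close> as the element of square zero, the chains of a state form an
  algebra generated by its circles; this is multiplication by the circle through \<open>h\<close>.  All edge
  maps commute with it, so they are determined by their values on the all-negative state.
\<close>

definition dot :: "nat \<times> nat \<Rightarrow> enhanced_state \<Rightarrow> (enhanced_state \<Rightarrow>\<^sub>0 int)" where
  "dot h S = (if circ (fst S) h \<in> snd S then 0 else frag_of (fst S, insert (circ (fst S) h) (snd S)))"

definition valid :: "kauffman_state \<Rightarrow> enhanced_state set" where
  "valid s = {(s, P) | P. P \<subseteq> state_circles D s}"

lemma targets_valid: "targets v S \<subseteq> valid (fst S - {v})"
  by (auto simp: targets_def valid_def)

lemma finite_valid: "finite (valid s)"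
proof -
  have "valid s = Pair s ` Pow (state_circles D s)" by (auto simp: valid_def)
  then show ?thesis by simp
qed

lemma finite_targets [simp]: "finite (targets v S)"
  using targets_valid finite_valid finite_subset by blast

lemma keys_edge: "Poly_Mapping.keys (edge v S) \<subseteq> valid (fst S - {v})"
proof -
  have "Poly_Mapping.keys (edge v S) \<subseteq> (\<Union>T\<in>targets v S. Poly_Mapping.keys (frag_of T))"
    unfolding edge_def by (rule keys_sum)
  then show ?thesis using targets_valid[of v S] by auto
qed

lemma edge_merge:
  assumes f: "fuses v s (s - {v})" and P: "P \<subseteq> state_circles D s"
  shows "edge v (s, P) =
    (if circ s (v, 0) \<in> P \<and> circ s (v, 2) \<in> P then 0
     else if circ s (v, 0) \<in> P \<or> circ s (v, 2) \<in> P
     then frag_of (s - {v}, insert (circ (s - {v}) (v, 0)) (P - {circ s (v, 0), circ s (v, 2)}))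
     else frag_of (s - {v}, P))"
  using targets_merge[OF assms] by (simp add: edge_def)

lemma edge_split:
  assumes f: "fuses v (s - {v}) s" and P: "P \<subseteq> state_circles D s"
  shows "edge v (s, P) =
    (if circ s (v, 0) \<in> P
     then frag_of (s - {v}, insert (circ (s - {v}) (v, 0)) (insert (circ (s - {v}) (v, 2)) (P - {circ s (v, 0)})))
     else frag_of (s - {v}, insert (circ (s - {v}) (v, 0)) P) +
       frag_of (s - {v}, insert (circ (s - {v}) (v, 2)) P))"
proof -
  let ?a = "circ (s - {v}) (v, 0)" and ?b = "circ (s - {v}) (v, 2)"
  have v: "v \<in> crossings D" using f by (simp add: fuses_def)
  have "insert ?a P \<noteq> insert ?b P" if "circ s (v, 0) \<notin> P"
  proof -
    have "?a \<noteq> ?b" using fuses_props[OF f] by simp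
    moreover have "?a \<notin> P"
      using P fuses_props[OF f] v that by auto
    ultimately show ?thesis by auto
  qed
  then show ?thesis using targets_split[OF assms] by (simp add: edge_def)
qed

text \<open>Merging is the multiplication and splitting the comultiplication of Z[X]/(X^2), and both
  are linear over the algebra. Dots are indexed by half-edges because the circle through
  \<open>h\<close> may change along the edge; the cases are whether it is one of the circles at
  \<open>v\<close>.\<close>

lemma edge_dot:
  assumes v: "v \<in> s" "s \<subseteq> crossings D" and P: "P \<subseteq> state_circles D s" and h: "h \<in> half_edges D"
  shows "frag_extend (edge v) (dot h (s, P)) = frag_extend (dot h) (edge v (s, P))"
proof -
  let ?t = "s - {v}" and ?k = "circ s h"
  have vC: "v \<in> crossings D" using v by auto
  have k: "insert ?k P \<subseteq> state_circles D s" using P h by simp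
  show ?thesis
  proof (cases "((v, 0), (v, 2)) \<in> linked D s s")
    case False
    then have f: "fuses v s ?t" using fuses_cases[OF v] by simp
    define a b c k where abck: "a = circ s (v, 0)" "b = circ s (v, 2)" "c = circ ?t (v, 0)" "k = circ s h"
    note E = edge_merge[OF f P, folded abck] edge_merge[OF f k, folded abck]
    have ab: "a \<noteq> b" using fuses_props[OF f] by (simp add: abck)
    have cP: "c \<notin> P" using fuses_props(3)[OF f] P by (auto simp: abck)
    have ct: "circ ?t h = (if k = a \<or> k = b then c else k)"
      using fuses_circ[OF f h] by (simp add: abck)
    have dk: "dot h (s, Q) = (if k \<in> Q then 0 else frag_of (s, insert k Q))"
      "dot h (?t, Q) = (if circ ?t h \<in> Q then 0 else frag_of (?t, insert (circ ?t h) Q))" for Q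
      by (simp_all add: dot_def abck)
    have diff: "P - {a, b} = P" if "a \<notin> P" "b \<notin> P" using that by auto
    consider "a = k" | "b = k" | "k \<noteq> a" "k \<noteq> b" by blast
    then show ?thesis
    proof cases
      case 1
      then show ?thesis using ab cP by (cases "a \<in> P"; cases "b \<in> P") (simp_all add: E dk ct diff)
    next
      case 2
      then show ?thesis using ab cP by (cases "a \<in> P"; cases "b \<in> P") (simp_all add: E dk ct diff)
    next
      case 3
      have "k \<noteq> c" using fuses_props(3)[OF f] circ_in[OF h, of s] unfolding abck by metis
      moreover have "insert k P - {a, b} = insert k (P - {a, b})" using 3 by auto
      ultimately show ?thesis using 3 ab cP
        by (cases "a \<in> P"; cases "b \<in> P"; cases "k \<in> P") (simp_all add: E dk ct insert_commute)
    qed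
  next
    case True
    then have f: "fuses v ?t s" using fuses_cases[OF v] by simp
    define a b c k k' where abck: "a = circ ?t (v, 0)" "b = circ ?t (v, 2)" "c = circ s (v, 0)"
      "k = circ s h" "k' = circ ?t h"
    note E = edge_split[OF f P, folded abck] edge_split[OF f k, folded abck]
    have ab: "a \<noteq> b" using fuses_props[OF f] by (simp add: abck)
    have "C \<noteq> a \<and> C \<noteq> b" if "C \<in> state_circles D s" for C
      using that vC fuses_props[OF f] by (auto simp: abck)
    then have abP: "a \<notin> P" "b \<notin> P" "k \<noteq> a" "k \<noteq> b" using P h by (auto simp: abck)
    have ct: "k = (if k' = a \<or> k' = b then c else k')"
      using fuses_circ[OF f h] by (simp add: abck)
    have dk: "dot h (s, Q) = (if k \<in> Q then 0 else frag_of (s, insert k Q))"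
      "dot h (?t, Q) = (if k' \<in> Q then 0 else frag_of (?t, insert k' Q))" for Q
      by (simp_all add: dot_def abck)
    consider "a = k'" | "b = k'" | "k' \<noteq> a" "k' \<noteq> b" by blast
    then show ?thesis
    proof cases
      case 1
      then have "c = k" using ct by simp
      then show ?thesis using 1 ab abP
        by (cases "c \<in> P") (simp_all add: E dk frag_extend_add insert_commute)
    next
      case 2
      then have "c = k" using ct by simp
      then show ?thesis using 2 ab abP
        by (cases "c \<in> P") (simp_all add: E dk frag_extend_add insert_commute)
    next
      case 3
      then have kk: "k' = k" using ct by simp
      have "k' \<noteq> c" using fuses_props(3)[OF f] circ_in[OF h, of ?t] unfolding abck by metis
      moreover from this have "insert k' P - {c} = insert k' (P - {c})" by auto
      ultimately show ?thesis using 3 ab abP kk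
        by (cases "c \<in> P"; cases "k' \<in> P") (simp_all add: E dk frag_extend_add insert_commute)
    qed
  qed
qed

lemma frag_extend_commute:
  assumes "\<And>S. S \<in> Poly_Mapping.keys x \<Longrightarrow> frag_extend f (g S) = frag_extend g' (f' S)"
  shows "frag_extend f (frag_extend g x) = frag_extend g' (frag_extend f' x)"
proof -
  have "frag_extend f (frag_extend g x) = frag_extend (\<lambda>S. frag_extend f (g S)) x" for f g
    by (simp add: frag_extend_def[of g] frag_extend_def[of "\<lambda>S. frag_extend f (g S)"]
        frag_extend_sum frag_extend_cmul o_def)
  then show ?thesis using assms frag_extend_eq[of x] by metis
qed

lemma edge_dot_chain:
  assumes "v \<in> s" "s \<subseteq> crossings D" "Poly_Mapping.keys x \<subseteq> valid s" "h \<in> half_edges D"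
  shows "frag_extend (edge v) (frag_extend (dot h) x) = frag_extend (dot h) (frag_extend (edge v) x)"
  using assms by (intro frag_extend_commute) (auto simp: valid_def edge_dot)

lemma dot_commute: "frag_extend (dot h) (dot k S) = frag_extend (dot k) (dot h S)"
  by (auto simp: dot_def insert_commute)

lemma edge_edge_dot:
  assumes "v \<in> s" "w \<in> s" "v \<noteq> w" "s \<subseteq> crossings D" "P \<subseteq> state_circles D s" "h \<in> half_edges D"
  shows "frag_extend (edge w) (frag_extend (edge v) (dot h (s, P))) =
    frag_extend (dot h) (frag_extend (edge w) (edge v (s, P)))"
proof -
  have "frag_extend (edge w) (frag_extend (dot h) (edge v (s, P))) =
      frag_extend (dot h) (frag_extend (edge w) (edge v (s, P)))"
    using assms keys_edge[of v "(s, P)"] by (intro edge_dot_chain[of _ "s - {v}"]) auto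
  then show ?thesis using edge_dot assms by simp
qed

text \<open>The ends of \<open>v\<close> lie on one circle; for \<open>v\<close> in
  \<open>s\<close>, reversing the marker at \<open>v\<close> cuts this circle in two.\<close>

definition splits :: "nat \<Rightarrow> kauffman_state \<Rightarrow> bool" where
  "splits v s \<longleftrightarrow> ((v, 0), (v, 2)) \<in> linked D s s"

text \<open>When the ends of \<open>v\<close> lie on different circles, this is multiplication by X
  \<otimes> 1 + 1 \<otimes> X, the value of the comultiplication at the unit.\<close>

definition two_dots :: "nat \<Rightarrow> (enhanced_state \<Rightarrow>\<^sub>0 int) \<Rightarrow> (enhanced_state \<Rightarrow>\<^sub>0 int)" where
  "two_dots v x = frag_extend (dot (v, 0)) x + frag_extend (dot (v, 2)) x"

lemma edge_unit:
  assumes "v \<in> s" "s \<subseteq> crossings D"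
  shows "edge v (s, {}) =
    (if splits v s then two_dots v (frag_of (s - {v}, {})) else frag_of (s - {v}, {}))"
  using fuses_cases[OF assms] by (auto simp: splits_def edge_merge edge_split two_dots_def dot_def)

lemma edge_edge_unit:
  assumes "v \<in> s" "w \<in> s" "v \<noteq> w" "s \<subseteq> crossings D"
  shows "frag_extend (edge w) (edge v (s, {})) =
    (let x = (if splits w (s - {v}) then two_dots w (frag_of (s - {v} - {w}, {}))
              else frag_of (s - {v} - {w}, {}))
     in if splits v s then two_dots v x else x)"
proof -
  let ?t = "s - {v}"
  have t: "w \<in> ?t" "?t \<subseteq> crossings D" using assms by auto
  have k: "Poly_Mapping.keys (frag_of (?t, {})) \<subseteq> valid ?t" by (auto simp: valid_def)
  \<comment> \<open>The dots left by a split at \<open>v\<close> pass through the edge map of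
    \<open>w\<close>, so each composite is a product of dots applied to an all-negative
    state.\<close>
  have "frag_extend (edge w) (frag_extend (dot (v, p)) (frag_of (?t, {}))) =
      frag_extend (dot (v, p)) (edge w (?t, {}))" if "p < 4" for p
    using edge_dot_chain[OF t k] assms that by auto
  then have "frag_extend (edge w) (two_dots v (frag_of (?t, {}))) = two_dots v (edge w (?t, {}))"
    by (simp add: two_dots_def frag_extend_add)
  then show ?thesis
    by (simp add: edge_unit[OF assms(1,4)] edge_unit[OF t] Let_def)
qed

lemma num_classes_step:
  assumes "v \<in> s" "s \<subseteq> crossings D"
  shows "int (num_classes D (s - {v}) (s - {v})) = int (num_classes D s s) + (if splits v s then 1 else - 1)"
proof -
  have v: "v \<in> crossings D" "v \<notin> s - {v}" "insert v s = s" "s - {v} \<subseteq> crossings D" using assms by auto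
  show ?thesis
    using num_circles_change[OF v(1,2)] split_iff[OF v(1,2,4)] v(3) by (simp add: splits_def)
qed

lemma fuse_new_pair:
  assumes "equiv X E" "(a, b) \<in> fuse E x y" "(a, b) \<notin> E"
  shows "(x, a) \<in> E \<and> (y, b) \<in> E \<or> (y, a) \<in> E \<and> (x, b) \<in> E"
  using assms by (auto simp: fuse_def)

text \<open>
  The case in which both orders of smoothing \<open>v\<close> and \<open>w\<close> split once, but at different crossings:
  then \<open>v\<close> and \<open>w\<close> touch the same circles in the end.
\<close>

lemma crossed_dots:
  assumes vw: "v \<in> s" "w \<in> s" "v \<noteq> w" "s \<subseteq> crossings D"
    and sp: "splits v s = splits w s" "splits w (s - {v}) = splits v (s - {w})"
      "splits v s \<noteq> splits w (s - {v})"
  defines "u \<equiv> s - {v} - {w}"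
  shows "two_dots v (frag_of (u, {})) = two_dots w (frag_of (u, {}))"
proof -
  let ?t = "s - {v}" and ?t' = "s - {w}"
  have u': "u = ?t' - {v}" by (auto simp: u_def)
  have sub: "w \<in> ?t" "v \<in> ?t'" "?t \<subseteq> crossings D" "?t' \<subseteq> crossings D" using vw by auto
  have H: "(v, p) \<in> half_edges D" "(w, p) \<in> half_edges D" if "p < 4" for p
    using that vw by auto
  have same: "(linked D u u `` {(v, 0)} = linked D u u `` {(w, 0)} \<and>
      linked D u u `` {(v, 2)} = linked D u u `` {(w, 2)}) \<or>
      (linked D u u `` {(v, 0)} = linked D u u `` {(w, 2)} \<and>
      linked D u u `` {(v, 2)} = linked D u u `` {(w, 0)})" (is ?same)
  proof -
    have pairs: ?same if "((v, 0), (w, 0)) \<in> linked D u u \<and> ((v, 2), (w, 2)) \<in> linked D u u \<or>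
        ((v, 0), (w, 2)) \<in> linked D u u \<and> ((v, 2), (w, 0)) \<in> linked D u u"
      using that equiv_class_eq[OF equiv_linked] by blast
    show ?thesis
    proof (cases "splits v s")
      case True
      then have f1: "fuses v ?t s" and f2: "fuses w ?t u"
        using sp fuses_cases[OF vw(1,4)] fuses_cases[OF sub(1,3)] by (auto simp: splits_def u_def)
      have mono: "linked D ?t ?t \<subseteq> linked D u u" using f2 by (auto simp: fuses_def fuse_def)
      \<comment> \<open>The ends of \<open>w\<close> share a circle of \<open>s\<close> and are
        separated by the split at \<open>v\<close>; so each of them goes with one end of
        \<open>v\<close>.\<close>
      have "((w, 0), (w, 2)) \<in> fuse (linked D ?t ?t) (v, 0) (v, 2)" "((w, 0), (w, 2)) \<notin> linked D ?t ?t"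
        using True sp f1 f2 by (auto simp: splits_def fuses_def)
      from fuse_new_pair[OF equiv_linked this]
      have "((v, 0), (w, 0)) \<in> linked D u u \<and> ((v, 2), (w, 2)) \<in> linked D u u \<or>
        ((v, 0), (w, 2)) \<in> linked D u u \<and> ((v, 2), (w, 0)) \<in> linked D u u"
        using mono by blast
      then show ?thesis by (rule pairs)
    next
      case False
      then have f1: "fuses v s ?t" and f2: "fuses w u ?t"
        using sp fuses_cases[OF vw(1,4)] fuses_cases[OF sub(1,3)] by (auto simp: splits_def u_def)
      have f3: "fuses v u ?t'" using False sp fuses_cases[OF sub(2,4)] by (auto simp: splits_def u')
      have mono: "linked D s s \<subseteq> linked D ?t ?t" using f1 by (auto simp: fuses_def fuse_def)
      \<comment> \<open>The ends of \<open>v\<close> have just been merged and are apart in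
        \<open>u\<close>; so it is the split at \<open>w\<close> that separates them.\<close>
      have v02: "((v, 0), (v, 2)) \<in> linked D ?t ?t" "((v, 0), (v, 2)) \<notin> linked D u u"
        using fuses_props(2)[OF f1] f3 H by (auto simp: circ_eq_iff fuses_def intro: linked_sym)
      then have "((v, 0), (v, 2)) \<in> fuse (linked D u u) (w, 0) (w, 2)"
        using f2 by (simp add: fuses_def)
      from fuse_new_pair[OF equiv_linked this v02(2)] linked_sym
      have "((v, 0), (w, 0)) \<in> linked D u u \<and> ((v, 2), (w, 2)) \<in> linked D u u \<or>
        ((v, 0), (w, 2)) \<in> linked D u u \<and> ((v, 2), (w, 0)) \<in> linked D u u"
        by blast
      then show ?thesis by (rule pairs)
    qed
  qed
  then show ?thesis by (auto simp: two_dots_def dot_def circ_def add.commute)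
qed

lemma two_dots_commute: "two_dots v (two_dots w (frag_of S)) = two_dots w (two_dots v (frag_of S))"
  by (simp add: two_dots_def frag_extend_add dot_commute[of "(v, _)"] algebra_simps)

text \<open>Linearity over dots reduces the claim to the all-negative state, where only the pattern
  of splits matters. Both orders end in the same state, so they have equally many splits. If there
  is one split, either the same crossing splits in both orders and the values agree, or
  \<open>crossed_dots\<close> applies.\<close>

lemma edge_edge:
  assumes vw: "v \<in> s" "w \<in> s" "v \<noteq> w" "s \<subseteq> crossings D" and P: "P \<subseteq> state_circles D s"
  shows "frag_extend (edge w) (edge v (s, P)) = frag_extend (edge v) (edge w (s, P))"
proof -
  let ?u = "s - {v} - {w}"
  have u: "s - {w} - {v} = ?u" by auto
  have sub: "w \<in> s - {v}" "v \<in> s - {w}" "s - {v} \<subseteq> crossings D" "s - {w} \<subseteq> crossings D"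
    using vw by auto
  have "(if splits v s then 1 else - 1) + (if splits w (s - {v}) then 1 else - 1) =
      (if splits w s then 1 else - 1) + (if splits v (s - {w}) then 1 else - 1 :: int)"
    using num_classes_step[OF vw(1,4)] num_classes_step[OF vw(2,4)]
      num_classes_step[OF sub(1,3)] num_classes_step[OF sub(2,4)] by (simp add: u)
  then have unit: "frag_extend (edge w) (edge v (s, {})) = frag_extend (edge v) (edge w (s, {}))"
    using crossed_dots[OF vw] two_dots_commute
    by (auto simp: edge_edge_unit[OF vw] edge_edge_unit[OF vw(2,1) vw(3)[symmetric] vw(4)] u Let_def
        split: if_splits)
  have "finite P" using P finite_subset finite_state_circles by blast
  then show ?thesis using P
  proof (induction P rule: finite_induct)
    case empty
    show ?case by (rule unit)
  next
    case (insert C P)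
    then obtain h where h: "h \<in> half_edges D" "C = circ s h" by (auto simp: state_circles_eq)
    have P: "P \<subseteq> state_circles D s" using insert by auto
    have "frag_extend (edge v) (dot h (s, P)) = edge v (s, insert C P)" for v
      using insert h by (simp add: dot_def)
    then show ?case
      using edge_edge_dot[OF vw P h(1)] edge_edge_dot[OF vw(2,1) vw(3)[symmetric] vw(4) P h(1)] insert
      by simp
  qed
qed

section \<open>The differential as a matrix\<close>

definition states :: "enhanced_state set" where
  "states = {S. fst S \<subseteq> crossings D \<and> snd S \<subseteq> state_circles D (fst S)}"

text \<open>The target degree is read off the source \<open>S\<close>, so that one matrix on all
  enhanced states contains the differentials of all degrees.\<close>

definition kh :: "enhanced_state \<Rightarrow> enhanced_state \<Rightarrow> int" where
  "kh S T =
     (if T \<in> enhanced_states D (state_sign D (fst S) - 2) (state_sign D (fst S) + 2 * tau D S)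
      then (- 1) ^ sign_exponent D S T * incidence D S T else 0)"

definition later :: "nat \<Rightarrow> kauffman_state \<Rightarrow> nat set" where
  "later v s = {w \<in> crossings D - s. v < w}"

lemma finite_states: "finite states"
proof -
  have "states \<subseteq> (\<Union>s\<in>Pow (crossings D). valid s)" by (auto simp: states_def valid_def)
  then show ?thesis using finite_valid by (rule_tac finite_subset) auto
qed

lemma state_sign_eq:
  assumes "s \<subseteq> crossings D"
  shows "state_sign D s = 2 * int (card s) - int (num_crossings D)"
proof -
  have "card (crossings D - s) = card (crossings D) - card s"
    using assms by (intro card_Diff_subset) (auto intro: finite_subset)
  moreover have "card s \<le> card (crossings D)" using assms by (intro card_mono) auto
  ultimately show ?thesis by (simp add: state_sign_def crossings_def)
qed

lemma state_sign_remove: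
  assumes "s \<subseteq> crossings D" "v \<in> s"
  shows "state_sign D (s - {v}) = state_sign D s - 2"
proof -
  have "finite s" using finite_subset[OF assms(1)] by simp
  then have "card s = Suc (card (s - {v}))" using assms by (metis card_Suc_Diff1)
  moreover have "s - {v} \<subseteq> crossings D" using assms by auto
  ultimately show ?thesis using assms by (simp add: state_sign_eq)
qed

lemma kh_targets:
  assumes S: "S \<in> states" and v: "v \<in> fst S" and T: "T \<in> targets v S"
  shows "kh S T = (- 1) ^ card (later v (fst S))"
proof -
  have d: "sym_diff (fst S) (fst T) = {v}" using v T by (auto simp: targets_def)
  have sg: "state_sign D (fst T) = state_sign D (fst S) - 2"
    using state_sign_remove[of "fst S" v] S v T by (simp add: states_def targets_def)
  have "T \<in> enhanced_states D (state_sign D (fst S) - 2) (state_sign D (fst S) + 2 * tau D S)"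
    using S T sg by (auto simp: enhanced_states_def targets_def states_def)
  moreover have "incidence D S T = 1"
    using d T by (auto simp: incidence_def targets_def)
  ultimately show ?thesis by (simp add: kh_def sign_exponent_def d later_def)
qed

text \<open>The markers differ at a single crossing, and the drop of the state sign by 2 fixes the
  direction of the change.\<close>

lemma kh_nonzero:
  assumes S: "S \<in> states" and nz: "kh S T \<noteq> 0"
  obtains v where "v \<in> fst S" "T \<in> targets v S"
proof -
  have T: "T \<in> enhanced_states D (state_sign D (fst S) - 2) (state_sign D (fst S) + 2 * tau D S)"
    and inc: "incidence D S T \<noteq> 0"
    using nz by (auto simp: kh_def split: if_splits)
  obtain v where v: "sym_diff (fst S) (fst T) = {v}"
    and agree: "\<forall>C\<in>state_circles D (fst S). \<not> touches C v \<longrightarrow> (C \<in> snd S \<longleftrightarrow> C \<in> snd T)"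
    using inc by (auto simp: incidence_def split: if_splits)
  have sub: "fst S \<subseteq> crossings D" "fst T \<subseteq> crossings D"
    using S T by (auto simp: states_def enhanced_states_def)
  have sg: "state_sign D (fst T) = state_sign D (fst S) - 2" and "tau D T = tau D S + 1"
    using T by (auto simp: enhanced_states_def)
  have other: "x \<in> fst S \<longleftrightarrow> x \<in> fst T" if "x \<noteq> v" for x
  proof -
    have "x \<notin> sym_diff (fst S) (fst T)" using that unfolding v by simp
    then show ?thesis by blast
  qed
  have this_one: "v \<in> fst S \<longleftrightarrow> v \<notin> fst T"
  proof -
    have "v \<in> sym_diff (fst S) (fst T)" unfolding v by simp
    then show ?thesis by blast
  qed
  have "v \<in> fst S"
  proof (rule ccontr)
    assume nv: "v \<notin> fst S"
    then have "v \<in> fst T" using this_one by simp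
    moreover have "fst T - {v} = fst S" using other nv by (intro Set.set_eqI) (metis DiffD1 DiffD2 DiffI insertI1 singletonD)
    ultimately show False using sg state_sign_remove[OF sub(2), of v] by simp
  qed
  moreover from this have "fst T = fst S - {v}"
    using other this_one by (intro Set.set_eqI) (metis DiffD1 DiffD2 DiffI insertI1 singletonD)
  moreover have "snd T \<subseteq> state_circles D (fst T)" using T by (simp add: enhanced_states_def)
  ultimately show thesis
    using that agree \<open>tau D T = tau D S + 1\<close> by (auto simp: targets_def)
qed

lemma targets_states: "S \<in> states \<Longrightarrow> T \<in> targets v S \<Longrightarrow> T \<in> states"
  by (auto simp: states_def targets_def)

lemma lookup_edge_edge:
  "Poly_Mapping.lookup (frag_extend (edge w) (edge v S)) U =
    int (card {T \<in> targets v S. U \<in> targets w T})"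
proof -
  have single: "Poly_Mapping.lookup (edge w T) U = (if U \<in> targets w T then 1 else 0)" for T
    by (simp add: edge_def lookup_sum)
  have "frag_extend (edge w) (edge v S) = (\<Sum>T\<in>targets v S. edge w T)"
    by (simp add: edge_def frag_extend_sum o_def)
  then have "Poly_Mapping.lookup (frag_extend (edge w) (edge v S)) U =
      (\<Sum>T\<in>targets v S. if U \<in> targets w T then 1 else 0)"
    by (simp add: lookup_sum single)
  then show ?thesis by (simp add: sum.If_cases Int_def)
qed

text \<open>All paths from \<open>S\<close> to \<open>U\<close> reverse the same two markers. The
  two orders have equally many paths because the edge maps commute, and they carry opposite
  signs.\<close>

lemma kh_square_zero: "square_zero_on kh states"
  unfolding square_zero_on_def
proof (intro ballI)
  fix S U assume S: "S \<in> states" and U: "U \<in> states"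
  show "(\<Sum>T\<in>states. kh S T * kh T U) = 0"
  proof (cases "\<exists>T\<in>states. kh S T * kh T U \<noteq> 0")
    case True
    then obtain T0 where T0: "T0 \<in> states" "kh S T0 \<noteq> 0" "kh T0 U \<noteq> 0" by auto
    obtain x where x: "x \<in> fst S" "T0 \<in> targets x S" using kh_nonzero[OF S T0(2)] .
    obtain y where y: "y \<in> fst T0" "U \<in> targets y T0" using kh_nonzero[OF T0(1,3)] .
    define v w where "v = min x y" and "w = max x y"
    have "x \<noteq> y" "x \<in> fst S" "y \<in> fst S" "fst U = fst S - {x, y}"
      using x y by (auto simp: targets_def)
    then have vw: "v < w" "v \<in> fst S" "w \<in> fst S" "fst U = fst S - {v, w}"
      by (auto simp: v_def w_def min_def max_def)
    define A where "A = {T \<in> targets v S. U \<in> targets w T}"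
    define B where "B = {T \<in> targets w S. U \<in> targets v T}"
    have sub: "A \<subseteq> states" "B \<subseteq> states" using targets_states[OF S] unfolding A_def B_def by blast+
    have fA: "fst T = fst S - {v}" if "T \<in> A" for T
      using that unfolding A_def targets_def by blast
    have fB: "fst T = fst S - {w}" if "T \<in> B" for T
      using that unfolding B_def targets_def by blast
    have disj: "A \<inter> B = {}" using fA fB vw by blast
    have fin: "finite A" "finite B" by (simp_all add: A_def B_def)
    have AB: "T \<in> A \<union> B" if T: "T \<in> states" "kh S T * kh T U \<noteq> 0" for T
    proof -
      from T have nz: "kh S T \<noteq> 0" "kh T U \<noteq> 0" by auto
      obtain x where x: "x \<in> fst S" "T \<in> targets x S" using kh_nonzero[OF S nz(1)] .
      obtain y where y: "y \<in> fst T" "U \<in> targets y T" using kh_nonzero[OF T(1) nz(2)] .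
      have "x \<noteq> y" "x \<in> fst S" "y \<in> fst S" "fst U = fst S - {x, y}"
        using x y by (auto simp: targets_def)
      then have "(x = v \<and> y = w) \<or> (x = w \<and> y = v)" using vw by blast
      then show ?thesis using x y by (auto simp: A_def B_def)
    qed
    let ?c = "(- 1) ^ card (later v (fst S)) * (- 1) ^ card (later w (fst S)) :: int"
    have "later w (fst S - {v}) = later w (fst S)"
      using vw(1) unfolding later_def by auto
    then have valA: "kh S T * kh T U = ?c" if "T \<in> A" for T
    proof -
      have "T \<in> targets v S" "U \<in> targets w T" "T \<in> states" "w \<in> fst T"
        using that sub fA[OF that] vw(1,3) by (auto simp: A_def)
      then show ?thesis
        using kh_targets[OF S vw(2)] kh_targets fA[OF that] \<open>later w (fst S - {v}) = _\<close> by simp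
    qed
    \<comment> \<open>The asymmetry behind the signs: once \<open>w\<close> is negative it counts
      among the later negative markers for \<open>v\<close>, whereas the marker at the smaller
      crossing \<open>v\<close> never counts for \<open>w\<close>.\<close>
    have "w \<in> crossings D" using S vw(3) by (auto simp: states_def)
    then have "later v (fst S - {w}) = insert w (later v (fst S))" "w \<notin> later v (fst S)"
      using vw(1,3) unfolding later_def by auto
    then have card_later: "card (later v (fst S - {w})) = Suc (card (later v (fst S)))"
      by (simp add: later_def)
    then have valB: "kh S T * kh T U = - ?c" if "T \<in> B" for T
    proof -
      have "T \<in> targets w S" "U \<in> targets v T" "T \<in> states" "v \<in> fst T"
        using that sub fB[OF that] vw(1,2) by (auto simp: B_def)
      then show ?thesis
        using kh_targets[OF S vw(3)] kh_targets fB[OF that] card_later by simp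
    qed
    have "int (card A) = int (card B)"
      using edge_edge[of v "fst S" w "snd S"] vw(1-3) S
      unfolding A_def B_def lookup_edge_edge[symmetric] by (simp add: states_def)
    moreover have "(\<Sum>T\<in>states. kh S T * kh T U) = (\<Sum>T\<in>A \<union> B. kh S T * kh T U)"
      using AB sub finite_states by (intro sum.mono_neutral_right) auto
    moreover have "\<dots> = (\<Sum>T\<in>A. ?c) + (\<Sum>T\<in>B. - ?c)"
      using fin disj valA valB by (simp add: sum.union_disjoint)
    ultimately show ?thesis by simp
  qed (auto intro!: sum.neutral)
qed

lemma kh_homogeneous: "homogeneous_on kh (enhanced_states D (i + 2) j) (enhanced_states D i j) states"
  unfolding homogeneous_on_def
proof (intro ballI impI)
  fix S T assume S: "S \<in> states" and T: "T \<in> states" and nz: "kh S T \<noteq> 0"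
  then have "T \<in> enhanced_states D (state_sign D (fst S) - 2) (state_sign D (fst S) + 2 * tau D S)"
    by (auto simp: kh_def split: if_splits)
  then show "S \<in> enhanced_states D (i + 2) j \<longleftrightarrow> T \<in> enhanced_states D i j"
    using S by (auto simp: enhanced_states_def states_def)
qed

text \<open>The table of \<open>targets_merge\<close> with the ends of \<open>v\<close> in either
  order: later \<open>e\<close> is the end on the circle of a base point and \<open>u\<close> the
  other one.\<close>

lemma merge_targets:
  assumes f: "fuses v s (s - {v})" and P: "P \<subseteq> state_circles D s"
    and eo: "{e, u} = {(v, 0), (v, 2)}"
  shows "circ s e \<in> P \<Longrightarrow> circ s u \<in> P \<Longrightarrow> targets v (s, P) = {}"
    and "circ s u \<notin> P \<Longrightarrow> targets v (s, P) =
      {(s - {v}, if circ s e \<in> P then insert (circ (s - {v}) e) (P - {circ s e}) else P)}"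
    and "circ (s - {v}) u = circ (s - {v}) e"
proof -
  have "e = (v, 0) \<and> u = (v, 2) \<or> e = (v, 2) \<and> u = (v, 0)" using eo by (auto simp: doubleton_eq_iff)
  note cases = this
  show same: "circ (s - {v}) u = circ (s - {v}) e"
    using cases fuses_props(2)[OF f] by (elim disjE conjE) simp_all
  show "targets v (s, P) = {}" if "circ s e \<in> P" "circ s u \<in> P"
    using cases that by (elim disjE conjE) (simp_all add: targets_merge[OF f P])
  show "targets v (s, P) =
      {(s - {v}, if circ s e \<in> P then insert (circ (s - {v}) e) (P - {circ s e}) else P)}"
    if u: "circ s u \<notin> P"
  proof -
    have "P - {circ s e, circ s u} = P - {circ s e}" "P - {circ s u, circ s e} = P - {circ s e}"
      using u by auto
    then show ?thesis
      using cases u same by (elim disjE conjE) (simp_all add: targets_merge[OF f P])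
  qed
qed

lemma split_targets:
  assumes f: "fuses v (s - {v}) s" and P: "P \<subseteq> state_circles D s"
    and eo: "{e, u} = {(v, 0), (v, 2)}"
  shows "targets v (s, P) =
    (if circ s e \<in> P
     then {(s - {v}, insert (circ (s - {v}) e) (insert (circ (s - {v}) u) (P - {circ s e})))}
     else {(s - {v}, insert (circ (s - {v}) e) P), (s - {v}, insert (circ (s - {v}) u) P)})"
proof -
  have "e = (v, 0) \<and> u = (v, 2) \<or> e = (v, 2) \<and> u = (v, 0)" using eo by (auto simp: doubleton_eq_iff)
  then consider "e = (v, 0)" "u = (v, 2)" | "e = (v, 2)" "u = (v, 0)" by blast
  then show ?thesis
    by cases (simp_all add: targets_split[OF f P] fuses_props(2)[OF f] insert_commute)
qed

text \<open>Multiples of X stay multiples of X: in a merge X gives X or 0, in a split X goes to X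
  \<otimes> X. Hence the states that are positive at a given half-edge span a subcomplex, and those
  negative there a quotient.\<close>

lemma positive_persists:
  assumes S: "S \<in> states" and v: "v \<in> fst S" and T: "T \<in> targets v S"
    and h: "h \<in> half_edges D" and pos: "circ (fst S) h \<in> snd S"
  shows "circ (fst T) h \<in> snd T"
proof -
  obtain s P where SP: "S = (s, P)" by (cases S)
  have s: "v \<in> s" "s \<subseteq> crossings D" and P: "P \<subseteq> state_circles D s" and hP: "circ s h \<in> P"
    using S v pos by (auto simp: states_def SP)
  show ?thesis
  proof (cases "((v, 0), (v, 2)) \<in> linked D s s")
    case False
    then have f: "fuses v s (s - {v})" using fuses_cases[OF s] by simp
    show ?thesis
      using T hP fuses_circ[OF f h] unfolding SP targets_merge[OF f P] by (auto split: if_splits)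
  next
    case True
    then have f: "fuses v (s - {v}) s" using fuses_cases[OF s] by simp
    have "circ (s - {v}) h \<noteq> circ s (v, 0)"
      using fuses_props(3)[OF f] circ_in[OF h, of "s - {v}"] by metis
    then show ?thesis
      using T hP fuses_circ[OF f h] unfolding SP targets_split[OF f P] by (auto split: if_splits)
  qed
qed

section \<open>Base points\<close>

text \<open>\<open>M\<close> is the set of base points, \<open>N\<close> the set of those on
  positive circles; the markers in \<open>t - s\<close> are free.\<close>

definition marked_states ::
    "kauffman_state \<Rightarrow> kauffman_state \<Rightarrow> (nat \<times> nat) set \<Rightarrow> (nat \<times> nat) set \<Rightarrow> enhanced_state set" where
  "marked_states s t M N = {S. s \<subseteq> fst S \<and> fst S \<subseteq> t \<and> snd S \<subseteq> state_circles D (fst S) \<and>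
     (\<forall>h\<in>M. circ (fst S) h \<in> snd S \<longleftrightarrow> h \<in> N)}"

definition transversal :: "kauffman_state \<Rightarrow> kauffman_state \<Rightarrow> (nat \<times> nat) set \<Rightarrow> bool" where
  "transversal s t M \<longleftrightarrow> M \<subseteq> half_edges D \<and>
     (\<forall>h\<in>half_edges D. \<exists>!m. m \<in> M \<and> (h, m) \<in> linked D s t)"

lemma marked_states_subset: "t \<subseteq> crossings D \<Longrightarrow> marked_states s t M N \<subseteq> states"
  by (auto simp: marked_states_def states_def)

lemma transversal_unique:
  assumes "transversal s t M" "m \<in> M" "m' \<in> M" "(m, m') \<in> linked D s t"
  shows "m = m'"
proof -
  have m: "m \<in> half_edges D" using assms by (auto simp: transversal_def)
  show ?thesis using m linked_refl[OF m, of s t] assms unfolding transversal_def by blast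
qed

lemma transversal_obtain:
  assumes "transversal s t M" "h \<in> half_edges D"
  obtains m where "m \<in> M" "(h, m) \<in> linked D s t"
  using assms unfolding transversal_def by blast

lemma transversalI:
  assumes "M \<subseteq> half_edges D"
    and "\<And>h. h \<in> half_edges D \<Longrightarrow> \<exists>m\<in>M. (h, m) \<in> linked D s t"
    and "\<And>m m'. m \<in> M \<Longrightarrow> m' \<in> M \<Longrightarrow> (m, m') \<in> linked D s t \<Longrightarrow> m = m'"
  shows "transversal s t M"
  unfolding transversal_def
proof (intro conjI ballI)
  fix h assume "h \<in> half_edges D"
  then obtain m where m: "m \<in> M" "(h, m) \<in> linked D s t" using assms(2) by blast
  show "\<exists>!m. m \<in> M \<and> (h, m) \<in> linked D s t"
  proof (intro ex1I[of _ m] conjI)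
    fix m' assume "m' \<in> M \<and> (h, m') \<in> linked D s t"
    then show "m' = m" using assms(3)[of m' m] m by (meson linked_sym linked_trans)
  qed (use m in auto)
qed (rule assms(1))

text \<open>Undoing the fusion cuts one component in two. Its base point \<open>p\<close> stays on
  the side of \<open>e\<close>; the side of \<open>u\<close> is left without one and receives
  \<open>u\<close> itself.\<close>

lemma transversal_fuse:
  assumes tr: "transversal s t M"
    and E: "linked D s t = fuse (linked D s' t') e u"
    and e: "e \<in> half_edges D" "u \<in> half_edges D" "(e, u) \<notin> linked D s' t'"
    and p: "p \<in> M" "(p, e) \<in> linked D s' t'"
  shows "u \<notin> M" "transversal s' t' (insert u M)"
proof -
  have sub: "linked D s' t' \<subseteq> linked D s t" unfolding E by (auto simp: fuse_def)
  have eu: "(e, u) \<in> linked D s t" unfolding E using equiv_fuse(2)[OF equiv_linked e(1,2)] .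
  have pu: "(p, u) \<notin> linked D s' t'" using p e(3) linked_sym linked_trans by blast
  have not_u: "(m, u) \<notin> linked D s' t'" if m: "m \<in> M" for m
  proof
    assume "(m, u) \<in> linked D s' t'"
    then have "(m, p) \<in> linked D s t" using sub eu p(2) linked_sym linked_trans by blast
    then have "m = p" using transversal_unique[OF tr m p(1)] by simp
    then show False using pu \<open>(m, u) \<in> linked D s' t'\<close> by simp
  qed
  show "u \<notin> M" using not_u linked_refl[OF e(2)] by blast
  show "transversal s' t' (insert u M)"
  proof (rule transversalI)
    show "insert u M \<subseteq> half_edges D" using tr e by (auto simp: transversal_def)
  next
    fix h assume h: "h \<in> half_edges D"
    obtain m where m: "m \<in> M" "(h, m) \<in> linked D s t" using transversal_obtain[OF tr h] .
    show "\<exists>m\<in>insert u M. (h, m) \<in> linked D s' t'"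
    proof (cases "(h, m) \<in> linked D s' t'")
      case False
      from fuse_new_pair[OF equiv_linked m(2)[unfolded E] False]
      have "(h, e) \<in> linked D s' t' \<or> (h, u) \<in> linked D s' t'" using linked_sym by blast
      then show ?thesis
      proof
        assume "(h, e) \<in> linked D s' t'"
        then have "(h, p) \<in> linked D s' t'" using p(2) linked_sym linked_trans by blast
        then show ?thesis using p(1) by blast
      qed blast
    qed (use m in blast)
  next
    fix m m' assume "m \<in> insert u M" "m' \<in> insert u M" "(m, m') \<in> linked D s' t'"
    then show "m = m'"
      using not_u linked_sym transversal_unique[OF tr] sub by blast
  qed
qed

text \<open>
  Following the arc from \<open>p\<close> through the smoothed crossings, one reaches an unsmoothed crossing
  unless the arc closes up, in which case it is a whole component.
\<close>

lemma adjacent_crossing: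
  assumes "(p, (w, q)) \<in> linked D s t" "w \<in> t - s"
  obtains v r where "v \<in> t - s" "(v, r) \<in> half_edges D"
    "\<And>u. s \<subseteq> u \<Longrightarrow> u \<subseteq> t \<Longrightarrow> (p, (v, r)) \<in> linked D u u"
proof (rule ccontr)
  note found = that
  assume none: "\<not> thesis"
  \<comment> \<open>The part of the arc from \<open>p\<close> that is common to all states between
    \<open>s\<close> and \<open>t\<close>. As long as it avoids \<open>t - s\<close>, every
    smoothing on it is the same in all these states, so it would be a full class of
    \<open>linked D s t\<close> and contain \<open>(w, q)\<close>.\<close>
  define Z where "Z = {x \<in> half_edges D. \<forall>u. s \<subseteq> u \<and> u \<subseteq> t \<longrightarrow> (p, x) \<in> linked D u u}"
  have Z: "fst x \<notin> t - s" if x: "x \<in> Z" for x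
  proof
    assume "fst x \<in> t - s"
    then have thesis using found[of "fst x" "snd x"] x unfolding Z_def by simp
    then show False using none by contradiction
  qed
  have "(w, q) \<in> Z"
    using assms(1)[unfolded linked_def]
  proof (induction rule: joined_induct)
    case (closed f z)
    then show ?case by (auto simp: smoothing_involution)
  next
    case base
    show ?case using assms(1) linked_in linked_refl by (auto simp: Z_def)
  next
    case (step z f)
    have go: "(z, f z) \<in> linked D u u" if u: "s \<subseteq> u" "u \<subseteq> t" for u
    proof (cases "f = glue D")
      case False
      have "fst z \<in> u \<longleftrightarrow> fst z \<in> s" "fst z \<in> u \<longleftrightarrow> fst z \<in> t" using Z[OF step(4)] u by auto
      then have "f z = smoothing u z" using step(3) False smoothing_cong by blast
      then show ?thesis using linked_smoothing(1)[OF step(2)] by simp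
    qed (use linked_glue[OF step(2)] in simp)
    have "(p, f z) \<in> linked D u u" if u: "s \<subseteq> u" "u \<subseteq> t" for u
      using linked_trans[OF _ go[OF u]] step(4) u by (simp add: Z_def)
    moreover have "f z \<in> half_edges D" using step(2,3) by (auto simp: smoothing_involution)
    ultimately show ?case by (simp add: Z_def)
  qed
  then show False using Z assms(2) by fastforce
qed

text \<open>The arc from the base point may arrive at an odd half-edge; with a positive marker at
  \<open>v\<close> it runs on to half-edge 0 or 2, the same one in all such states.\<close>

lemma corner_ends:
  assumes "(v, r) \<in> half_edges D"
  obtains e u where "{e, u} = {(v, 0), (v, 2)}" "\<And>w. v \<in> w \<Longrightarrow> ((v, r), e) \<in> linked D w w"
proof -
  have v: "v \<in> crossings D" using assms by simp
  note c = linked_corner(1,2)[OF v] linked_refl[OF assms]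
  have "(v, r) = (v, 0) \<or> (v, r) = (v, Suc 0) \<or> (v, r) = (v, 2) \<or> (v, r) = (v, 3)"
    using assms by auto
  then have "(\<forall>w. v \<in> w \<longrightarrow> ((v, r), (v, 0)) \<in> linked D w w) \<or>
      (\<forall>w. v \<in> w \<longrightarrow> ((v, r), (v, 2)) \<in> linked D w w)"
    using c linked_sym by (elim disjE) auto
  then show thesis
    using that[of "(v, 0)" "(v, 2)"] that[of "(v, 2)" "(v, 0)"] by (auto simp: insert_commute)
qed

text \<open>The counterpart for a negative marker, where an odd half-edge continues to the other
  end.\<close>

lemma corner_ends':
  assumes "(v, r) \<in> half_edges D"
  obtains e u where "{e, u} = {(v, 0), (v, 2)}" "\<And>w. v \<notin> w \<Longrightarrow> ((v, r), e) \<in> linked D w w"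
proof -
  have v: "v \<in> crossings D" using assms by simp
  note c = linked_corner(3,4)[OF v] linked_refl[OF assms]
  have "(v, r) = (v, 0) \<or> (v, r) = (v, Suc 0) \<or> (v, r) = (v, 2) \<or> (v, r) = (v, 3)"
    using assms by auto
  then have "(\<forall>w. v \<notin> w \<longrightarrow> ((v, r), (v, 0)) \<in> linked D w w) \<or>
      (\<forall>w. v \<notin> w \<longrightarrow> ((v, r), (v, 2)) \<in> linked D w w)"
    using c linked_sym by (elim disjE) auto
  then show thesis
    using that[of "(v, 0)" "(v, 2)"] that[of "(v, 2)" "(v, 0)"] by (auto simp: insert_commute)
qed

section \<open>Smoothing a crossing\<close>

lemma marked_states_finite: "t \<subseteq> crossings D \<Longrightarrow> finite (marked_states s t M N)"
  by (rule finite_subset[OF marked_states_subset finite_states])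

lemma kh_adds_no_crossing:
  assumes "S \<in> states" "v \<in> fst T" "v \<notin> fst S"
  shows "kh S T = 0"
proof (rule ccontr)
  assume "kh S T \<noteq> 0"
  then obtain w where "T \<in> targets w S" using kh_nonzero[OF assms(1)] by metis
  then show False using assms(2,3) unfolding targets_def by blast
qed

lemma kh_unit: "S \<in> states \<Longrightarrow> v \<in> fst S \<Longrightarrow> T \<in> targets v S \<Longrightarrow> kh S T * kh S T = 1"
  by (simp add: kh_targets flip: power_mult_distrib)

lemma kh_targets_removed:
  assumes "S \<in> states" "kh S T \<noteq> 0" "v \<in> fst S" "v \<notin> fst T"
  shows "T \<in> targets v S"
proof -
  obtain w where w: "w \<in> fst S" "T \<in> targets w S" using kh_nonzero[OF assms(1,2)] .
  then have "fst T = fst S - {w}" by (simp add: targets_def)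
  then have "w = v" using assms(3,4) by blast
  then show ?thesis using w by simp
qed

lemma kh_positive_persists:
  assumes "S \<in> states" "kh S T \<noteq> 0" "h \<in> half_edges D" "circ (fst S) h \<in> snd S"
  shows "circ (fst T) h \<in> snd T"
  using kh_nonzero[OF assms(1,2)] positive_persists[OF assms(1) _ _ assms(3,4)] by metis

lemma end_cases:
  assumes "{e, u} = {(v, 0), (v, 2)}"
  shows "e = (v, 0) \<and> u = (v, 2) \<or> e = (v, 2) \<and> u = (v, 0)"
  using assms by (auto simp: doubleton_eq_iff)

lemma fuses_ends:
  assumes f: "fuses v s w" and eo: "{e, u} = {(v, 0), (v, 2)}"
  shows "e \<in> half_edges D" "u \<in> half_edges D" "circ s e \<noteq> circ s u" "circ w u = circ w e"
    "circ w e \<notin> state_circles D s"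
    "state_circles D w = insert (circ w e) (state_circles D s - {circ s e, circ s u})"
    "h \<in> half_edges D \<Longrightarrow>
      circ w h = (if circ s h = circ s e \<or> circ s h = circ s u then circ w e else circ s h)"
proof -
  have v: "v \<in> crossings D" using f by (simp add: fuses_def)
  note props = fuses_props[OF f]
  have c: "circ w e = circ w (v, 0)" "circ w u = circ w (v, 0)"
    and s: "{circ s e, circ s u} = {circ s (v, 0), circ s (v, 2)}"
    using end_cases[OF eo] props(2) by auto
  show "e \<in> half_edges D" "u \<in> half_edges D" using end_cases[OF eo] v by auto
  show "circ s e \<noteq> circ s u" using end_cases[OF eo] props(1) by auto
  show "circ w u = circ w e" using c by simp
  show "circ w e \<notin> state_circles D s" using c props(3) by simp
  show "state_circles D w = insert (circ w e) (state_circles D s - {circ s e, circ s u})"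
    unfolding c s by (rule props(4))
  have "circ s h = circ s e \<or> circ s h = circ s u \<longleftrightarrow>
      circ s h = circ s (v, 0) \<or> circ s h = circ s (v, 2)"
    using end_cases[OF eo] by auto
  then show "circ w h = (if circ s h = circ s e \<or> circ s h = circ s u then circ w e else circ s h)"
    if "h \<in> half_edges D"
    using fuses_circ[OF f that] c by simp
qed

text \<open>With \<open>v\<close> positive, the states \<open>Y\<close> whose circle at
  \<open>u\<close> is positive survive as a subcomplex. Those in \<open>A\<close>, where it is
  negative, are merged with a unit when \<open>v\<close> is reversed, and this is a bijection onto
  the states \<open>B\<close> with \<open>v\<close> negative.\<close>

lemma exact_bridge:
  assumes st: "s \<subseteq> t" "t \<subseteq> crossings D" and v: "v \<in> t" "v \<notin> s"
    and tr: "transversal s t M" and N: "N \<subseteq> M"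
    and sq: "square_zero_on kh (marked_states s t M N)"
    and hom: "homogeneous_on kh Q P states"
    and bridge: "((v, 0), (v, 2)) \<notin> linked D (insert v s) t"
    and eo: "{e, u} = {(v, 0), (v, 2)}" and p: "p \<in> M"
    and pe: "\<And>w. s \<subseteq> w \<Longrightarrow> w \<subseteq> t \<Longrightarrow> v \<in> w \<Longrightarrow> (p, e) \<in> linked D w w"
    and IH: "square_zero_on kh (marked_states (insert v s) t (insert u M) (insert u N)) \<Longrightarrow>
      exact_on kh Q P (marked_states (insert v s) t (insert u M) (insert u N))"
  shows "exact_on kh Q P (marked_states s t M N)"
proof -
  let ?X = "marked_states s t M N"
  define Y where "Y = marked_states (insert v s) t (insert u M) (insert u N)"
  define A where "A = {S \<in> ?X. v \<in> fst S \<and> circ (fst S) u \<notin> snd S}"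
  define B where "B = {S \<in> ?X. v \<notin> fst S}"
  have vC: "v \<in> crossings D" using st v by auto
  have MH: "M \<subseteq> half_edges D" using tr by (simp add: transversal_def)
  have pH: "p \<in> half_edges D" using p MH by auto
  have Xst: "?X \<subseteq> states" using marked_states_subset[OF st(2)] .
  have finX: "finite ?X" using marked_states_finite[OF st(2)] .
  \<comment> \<open>The ends of \<open>v\<close> are apart even with the other crossings still
    unsmoothed, hence in every state with \<open>v\<close> positive; reversing \<open>v\<close>
    always merges.\<close>
  have fus: "fuses v w (w - {v})" if w: "insert v s \<subseteq> w" "w \<subseteq> t" for w
  proof -
    have "linked D w w \<subseteq> linked D (insert v s) t" using w by (intro linked_mono) auto
    then have "((v, 0), (v, 2)) \<notin> linked D w w" using bridge by blast
    then show ?thesis using fuses_cases(1)[of v w] w st by auto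
  qed
  have eH: "e \<in> half_edges D" "u \<in> half_edges D" using end_cases[OF eo] vC by auto
  have circ_p: "circ w p = circ w e" if "insert v s \<subseteq> w" "w \<subseteq> t" for w
    using pe[of w] that circ_eq_iff[OF pH eH(1)] by simp
  have eu_st: "linked D s t = fuse (linked D (insert v s) t) e u"
    using linked_add_crossing[OF vC v(2,1) st(1)] end_cases[OF eo]
    by (auto simp: fuse_def)
  have eu: "(e, u) \<notin> linked D (insert v s) t"
    using end_cases[OF eo] bridge linked_sym by blast
  have "linked D t t \<subseteq> linked D (insert v s) t" using st v by (intro linked_mono) auto
  then have pe': "(p, e) \<in> linked D (insert v s) t" using pe[of t] st v by auto
  note trY = transversal_fuse[OF tr eu_st eH eu p pe']
  \<comment> \<open>A component has only one base point, so the circles at \<open>v\<close> carry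
    none but \<open>p\<close>.\<close>
  have near: "h = p" if h: "h \<in> M" "circ w h = circ w e \<or> circ w h = circ w u"
    and w: "insert v s \<subseteq> w" "w \<subseteq> t" for h w
  proof -
    have "linked D w w \<subseteq> linked D s t" using w by (intro linked_mono) auto
    moreover have "h \<in> half_edges D" using h MH by auto
    ultimately have "(h, e) \<in> linked D s t \<or> (h, u) \<in> linked D s t"
      using h(2) eH by (auto simp: circ_eq_iff)
    moreover have "(e, u) \<in> linked D s t"
      unfolding eu_st using equiv_fuse(2)[OF equiv_linked eH] .
    moreover have "(p, e) \<in> linked D s t" using pe' by (auto simp: eu_st fuse_def)
    ultimately have "(h, p) \<in> linked D s t" using linked_sym linked_trans by blast
    then show ?thesis using transversal_unique[OF tr h(1) p] by simp
  qed
  have X: "?X = Y \<union> (A \<union> B)" "Y \<inter> (A \<union> B) = {}"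
  proof -
    have "(\<forall>h\<in>insert u M. circ w h \<in> R \<longleftrightarrow> h \<in> insert u N) \<longleftrightarrow>
        circ w u \<in> R \<and> (\<forall>h\<in>M. circ w h \<in> R \<longleftrightarrow> h \<in> N)" for w R
      using trY(1) by auto
    then have "Y = {S \<in> ?X. v \<in> fst S \<and> circ (fst S) u \<in> snd S}"
      unfolding Y_def marked_states_def by (simp only: insert_subset) auto
    then show "?X = Y \<union> (A \<union> B)" "Y \<inter> (A \<union> B) = {}" unfolding A_def B_def by blast+
  qed
  have memY: "S \<in> ?X" "v \<in> fst S" "circ (fst S) u \<in> snd S" if "S \<in> Y" for S
  proof -
    show SX: "S \<in> ?X" using that X by blast
    then have "S \<notin> A" "S \<notin> B" using that X by blast+
    then show "v \<in> fst S" "circ (fst S) u \<in> snd S" using SX unfolding A_def B_def by blast+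
  qed
  \<comment> \<open>Into \<open>A\<close>: a positive circle at \<open>u\<close> stays positive.
    Into \<open>B\<close>: if the circle at \<open>e\<close> is positive too, the product is 0; if
    it is negative, the merged circle, which contains \<open>p\<close>, becomes positive against the
    sign prescribed at \<open>p\<close>.\<close>
  have sub: "kh y z = 0" if y: "y \<in> Y" and z: "z \<in> A \<union> B" for y z
  proof (rule ccontr)
    assume nz: "kh y z \<noteq> 0"
    have yst: "y \<in> states" using memY(1)[OF y] Xst by blast
    have zu: "circ (fst z) u \<in> snd z"
      using kh_positive_persists[OF yst nz eH(2) memY(3)[OF y]] .
    then have vz: "v \<notin> fst z" and zX: "z \<in> ?X" using z unfolding A_def B_def by blast+
    obtain w R where yw: "y = (w, R)" by (cases y)
    have zt: "z \<in> targets v y" using kh_targets_removed[OF yst nz memY(2)[OF y] vz] .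
    have w: "insert v s \<subseteq> w" "w \<subseteq> t" "R \<subseteq> state_circles D w"
      using memY[OF y] by (auto simp: yw marked_states_def)
    note f = fus[OF w(1,2)]
    have fz: "fst z = w - {v}" using zt by (simp add: targets_def yw)
    show False
    proof (cases "circ w e \<in> R")
      case True
      then show False using merge_targets(1)[OF f w(3) eo] memY(3)[OF y] zt by (simp add: yw)
    next
      case False
      have "circ w p \<in> R \<longleftrightarrow> p \<in> N"
        using memY(1)[OF y] p by (simp add: yw marked_states_def)
      then have "p \<notin> N" using False circ_p[OF w(1,2)] by simp
      then have "circ (w - {v}) p \<notin> snd z" using zX p fz by (simp add: marked_states_def)
      moreover have "circ (w - {v}) p = circ (w - {v}) u"
        using fuses_ends(4,7)[OF f eo] pH circ_p[OF w(1,2)] by simp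
      ultimately show False using zu fz by simp
    qed
  qed
  have sqs: "square_zero_on kh Y" "square_zero_on kh (A \<union> B)"
    using square_zero_on_sub[OF finX sq X sub] by auto
  \<comment> \<open>Multiplication by the unit: the merged circle inherits the sign at
    \<open>e\<close>, and with it the sign of \<open>p\<close>.\<close>
  define f where "f = (\<lambda>(w, R). (w - {v},
    if circ w e \<in> R then insert (circ (w - {v}) e) (R - {circ w e}) else R))"
  define g where "g = (\<lambda>(w, R). (insert v w,
    if circ w e \<in> R then insert (circ (insert v w) e) (R - {circ w e}) else R))"
  have Aw: "insert v s \<subseteq> w \<and> w \<subseteq> t \<and> R \<subseteq> state_circles D w \<and> circ w u \<notin> R \<and>
      (\<forall>h\<in>M. circ w h \<in> R \<longleftrightarrow> h \<in> N)" if "(w, R) \<in> A" for w R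
    using that by (auto simp: A_def marked_states_def)
  have Bw: "s \<subseteq> w \<and> w \<subseteq> t \<and> v \<notin> w \<and> R \<subseteq> state_circles D w \<and>
      (\<forall>h\<in>M. circ w h \<in> R \<longleftrightarrow> h \<in> N)" if "(w, R) \<in> B" for w R
    using that by (auto simp: B_def marked_states_def)
  have tgtA: "targets v S = {f S}" if S: "S \<in> A" for S
  proof -
    obtain w R where wR: "S = (w, R)" by (cases S)
    then have w: "insert v s \<subseteq> w" "w \<subseteq> t" "R \<subseteq> state_circles D w" "circ w u \<notin> R"
      using Aw S by blast+
    show ?thesis using merge_targets(2)[OF fus[OF w(1,2)] w(3) eo w(4)] by (simp add: wR f_def)
  qed
  have bij: "bij_betw f A B"
  proof (rule bij_betwI[of f A B g])
    show "f \<in> A \<rightarrow> B"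
    proof
      fix S assume S: "S \<in> A"
      obtain w R where wR: "S = (w, R)" by (cases S)
      note w = Aw[OF S[unfolded wR]]
      have fw: "fuses v w (w - {v})" using fus w by blast
      let ?c = "circ (w - {v}) e"
      let ?R = "if circ w e \<in> R then insert ?c (R - {circ w e}) else R"
      note fe = fuses_ends[OF fw eo]
      have "?R \<subseteq> state_circles D (w - {v})"
        using w fe(6) by (auto split: if_splits)
      moreover have "circ (w - {v}) h \<in> ?R \<longleftrightarrow> circ w h \<in> R" if h: "h \<in> M" for h
      proof (cases "circ w h = circ w e \<or> circ w h = circ w u")
        case True
        then have "circ w h = circ w e" "circ (w - {v}) h = ?c"
          using near[OF h] circ_p w fe(7)[of h] h MH by auto
        moreover have "?c \<notin> R" using fe(5) w by auto
        ultimately show ?thesis by simp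
      next
        case False
        then have "circ (w - {v}) h = circ w h" using fe(7)[of h] h MH w by auto
        moreover have "circ w h \<noteq> ?c" using fe(5) circ_in[of h w] h MH by (metis subsetD)
        ultimately show ?thesis using False by simp
      qed
      ultimately show "f S \<in> B"
        using w v(2) by (auto simp: B_def marked_states_def f_def wR)
    qed
    show "g \<in> B \<rightarrow> A"
    proof
      fix S assume S: "S \<in> B"
      obtain w R where wR: "S = (w, R)" by (cases S)
      note w = Bw[OF S[unfolded wR]]
      let ?w = "insert v w"
      have iw: "insert v s \<subseteq> ?w" "?w \<subseteq> t" "?w - {v} = w" using w v by auto
      note fw = fus[OF iw(1,2), unfolded iw(3)]
      let ?c = "circ w e"
      let ?R = "if ?c \<in> R then insert (circ ?w e) (R - {?c}) else R"
      note fe = fuses_ends[OF fw eo]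
      have R: "?R \<subseteq> state_circles D ?w" "circ ?w u \<notin> ?R"
        using w fe(3,5,6) eH circ_in[of u ?w] by (auto split: if_splits)
      have eR: "circ ?w e \<notin> R" using w fe(5,6) circ_in[OF eH(1), of ?w] by auto
      moreover have "circ ?w h \<in> ?R \<longleftrightarrow> circ w h \<in> R" if h: "h \<in> M" for h
      proof (cases "circ ?w h = circ ?w e \<or> circ ?w h = circ ?w u")
        case True
        then have "circ ?w h = circ ?w e" "circ w h = ?c"
          using near[OF h _ iw(1,2)] circ_p[OF iw(1,2)] fe(7)[of h] h MH by auto
        then show ?thesis using eR by simp
      next
        case False
        then have "circ w h = circ ?w h" using fe(7)[of h] h MH by auto
        moreover have "circ ?w h \<noteq> ?c" using fe(5) circ_in[of h ?w] h MH by (metis subsetD)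
        ultimately show ?thesis using False by simp
      qed
      ultimately show "g S \<in> A"
        using w v(2) iw R by (auto simp: A_def marked_states_def g_def wR)
    qed
    show "g (f S) = S" if S: "S \<in> A" for S
    proof -
      obtain w R where wR: "S = (w, R)" by (cases S)
      note w = Aw[OF S[unfolded wR]]
      have iw: "insert v w = w" using w by auto
      have "circ (w - {v}) e \<notin> R" using fuses_ends(5)[OF fus eo, of w] w by auto
      then show ?thesis
        by (auto simp: wR f_def g_def iw)
    qed
    show "f (g S) = S" if S: "S \<in> B" for S
    proof -
      obtain w R where wR: "S = (w, R)" by (cases S)
      note w = Bw[OF S[unfolded wR]]
      let ?w = "insert v w"
      have iw: "insert v s \<subseteq> ?w" "?w \<subseteq> t" "?w - {v} = w" using w v by auto
      note fe = fuses_ends[OF fus[OF iw(1,2), unfolded iw(3)] eo]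
      have "circ ?w e \<notin> R" using w fe(5,6) circ_in[OF eH(1), of ?w] by auto
      then show ?thesis using iw(3)
        by (auto simp: wR f_def g_def)
    qed
  qed
  have ABst: "A \<subseteq> states" "B \<subseteq> states" using Xst unfolding A_def B_def by blast+
  have AB: "exact_on kh Q P (A \<union> B)"
  proof (rule exact_on_matching[OF _ sqs(2) _ refl _ _ bij])
    show "finite (A \<union> B)" using finX X by (auto intro: finite_subset)
    show "homogeneous_on kh Q P (A \<union> B)" using homogeneous_on_subset[OF hom] ABst by blast
    show "A \<inter> B = {}" by (auto simp: A_def B_def)
    have vA: "v \<in> fst S" if "S \<in> A" for S using that by (simp add: A_def)
    have vB: "v \<notin> fst S" if "S \<in> B" for S using that by (simp add: B_def)
    show "kh z y = 0" if "y \<in> A" "z \<in> B" for y z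
      using kh_adds_no_crossing[OF _ vA vB] that ABst by blast
    show "kh y (f y) * kh y (f y) = 1" if "y \<in> A" for y
      using kh_unit[OF _ vA[OF that], of "f y"] tgtA[OF that] that ABst by blast
    show "kh y z = 0" if "y \<in> A" "z \<in> B" "z \<noteq> f y" for y z
      using kh_targets_removed[OF _ _ vA[OF that(1)] vB[OF that(2)]] tgtA[OF that(1)] that ABst
      by blast
  qed
  show ?thesis
    using exact_on_extension[OF finX sq homogeneous_on_subset[OF hom Xst] X sub _ AB]
      IH sqs(1) by (simp add: Y_def)
qed


lemma fuses_ends_gone:
  assumes f: "fuses v s w" and eo: "{e, u} = {(v, 0), (v, 2)}"
  shows "circ s e \<notin> state_circles D w" "circ s u \<notin> state_circles D w"
proof -
  note fe = fuses_ends[OF f eo]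
  have "circ s e \<noteq> circ w e" using fe(5) circ_in[OF fe(1), of s] by metis
  then show "circ s e \<notin> state_circles D w" by (simp add: fe(6))
  have "circ s u \<noteq> circ w e" using fe(5) circ_in[OF fe(2), of s] by metis
  then show "circ s u \<notin> state_circles D w" by (simp add: fe(6))
qed

text \<open>Dual to \<open>exact_bridge\<close>: the negative smoothing cuts, reversing
  \<open>v\<close> always splits, and the states \<open>Z\<close> with a negative circle at
  \<open>u\<close> survive as a quotient. The states \<open>A\<close> with \<open>v\<close> positive
  cancel against those in \<open>B\<close>, where \<open>v\<close> is negative and the circle at
  \<open>u\<close> positive.\<close>

lemma exact_loop:
  assumes st: "s \<subseteq> t" "t \<subseteq> crossings D" and v: "v \<in> t" "v \<notin> s"
    and tr: "transversal s t M" and N: "N \<subseteq> M"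
    and sq: "square_zero_on kh (marked_states s t M N)"
    and hom: "homogeneous_on kh Q P states"
    and loop: "((v, 0), (v, 2)) \<notin> linked D s (t - {v})"
    and eo: "{e, u} = {(v, 0), (v, 2)}" and p: "p \<in> M"
    and pe: "\<And>w. s \<subseteq> w \<Longrightarrow> w \<subseteq> t \<Longrightarrow> v \<notin> w \<Longrightarrow> (p, e) \<in> linked D w w"
    and IH: "square_zero_on kh (marked_states s (t - {v}) (insert u M) N) \<Longrightarrow>
      exact_on kh Q P (marked_states s (t - {v}) (insert u M) N)"
  shows "exact_on kh Q P (marked_states s t M N)"
proof -
  let ?X = "marked_states s t M N"
  define Z where "Z = marked_states s (t - {v}) (insert u M) N"
  define A where "A = {S \<in> ?X. v \<in> fst S}"
  define B where "B = {S \<in> ?X. v \<notin> fst S \<and> circ (fst S) u \<in> snd S}"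
  have vC: "v \<in> crossings D" using st v by auto
  have MH: "M \<subseteq> half_edges D" using tr by (simp add: transversal_def)
  have pH: "p \<in> half_edges D" using p MH by auto
  have Xst: "?X \<subseteq> states" using marked_states_subset[OF st(2)] .
  have finX: "finite ?X" using marked_states_finite[OF st(2)] .
  have fus: "fuses v (w - {v}) w" if w: "insert v s \<subseteq> w" "w \<subseteq> t" for w
  proof -
    have "linked D (w - {v}) (w - {v}) \<subseteq> linked D s (t - {v})"
      using w v by (intro linked_mono) auto
    then have "((v, 0), (v, 2)) \<notin> linked D (w - {v}) (w - {v})" using loop by blast
    moreover have "v \<notin> w - {v}" "w - {v} \<subseteq> crossings D" "insert v w = w" using w st by auto
    ultimately have "((v, 0), (v, 2)) \<in> linked D w w"
      using split_iff[OF vC, of "w - {v}"] by simp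
    then show ?thesis using fuses_cases(2)[of v w] w st by auto
  qed
  have eH: "e \<in> half_edges D" "u \<in> half_edges D" using end_cases[OF eo] vC by auto
  have circ_p: "circ w p = circ w e" if "s \<subseteq> w" "w \<subseteq> t" "v \<notin> w" for w
    using pe[of w] that circ_eq_iff[OF pH eH(1)] by simp
  have eu_st: "linked D s t = fuse (linked D s (t - {v})) e u"
    using linked_remove_crossing[OF vC v(2,1) st(1)] end_cases[OF eo]
    by (auto simp: fuse_def)
  have eu: "(e, u) \<notin> linked D s (t - {v})"
    using end_cases[OF eo] loop linked_sym by blast
  have "linked D (t - {v}) (t - {v}) \<subseteq> linked D s (t - {v})"
    using st v by (intro linked_mono) auto
  moreover have "(p, e) \<in> linked D (t - {v}) (t - {v})" using st v by (intro pe) auto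
  ultimately have pe': "(p, e) \<in> linked D s (t - {v})" by blast
  note trZ = transversal_fuse[OF tr eu_st eH eu p pe']
  have near: "h = p" if h: "h \<in> M" "circ w h = circ w e \<or> circ w h = circ w u"
    and w: "s \<subseteq> w" "w \<subseteq> t" for h w
  proof -
    have "linked D w w \<subseteq> linked D s t" using w by (intro linked_mono) auto
    moreover have "h \<in> half_edges D" using h MH by auto
    ultimately have "(h, e) \<in> linked D s t \<or> (h, u) \<in> linked D s t"
      using h(2) eH by (auto simp: circ_eq_iff)
    moreover have "(e, u) \<in> linked D s t"
      unfolding eu_st using equiv_fuse(2)[OF equiv_linked eH] .
    moreover have "(p, e) \<in> linked D s t" using pe' by (auto simp: eu_st fuse_def)
    ultimately have "(h, p) \<in> linked D s t" using linked_sym linked_trans by blast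
    then show ?thesis using transversal_unique[OF tr h(1) p] by simp
  qed
  have X: "?X = (A \<union> B) \<union> Z" "(A \<union> B) \<inter> Z = {}"
  proof -
    have "(\<forall>h\<in>insert u M. circ w h \<in> R \<longleftrightarrow> h \<in> N) \<longleftrightarrow>
        circ w u \<notin> R \<and> (\<forall>h\<in>M. circ w h \<in> R \<longleftrightarrow> h \<in> N)" for w R
      using trZ(1) N by auto
    then have "Z = {S \<in> ?X. v \<notin> fst S \<and> circ (fst S) u \<notin> snd S}"
      unfolding Z_def marked_states_def by (simp only: subset_Diff_insert) auto
    then show "?X = (A \<union> B) \<union> Z" "(A \<union> B) \<inter> Z = {}" unfolding A_def B_def by blast+
  qed
  have memZ: "S \<in> ?X" "v \<notin> fst S" "circ (fst S) u \<notin> snd S" if "S \<in> Z" for S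
  proof -
    show SX: "S \<in> ?X" using that X by blast
    then have "S \<notin> A" "S \<notin> B" using that X by blast+
    then show "v \<notin> fst S" "circ (fst S) u \<notin> snd S" using SX unfolding A_def B_def by blast+
  qed
  have ABst: "A \<subseteq> states" "B \<subseteq> states" using Xst unfolding A_def B_def by blast+
  have vA: "v \<in> fst S" if "S \<in> A" for S using that by (simp add: A_def)
  have vB: "v \<notin> fst S" "circ (fst S) u \<in> snd S" if "S \<in> B" for S using that by (simp_all add: B_def)
  have Aw: "insert v s \<subseteq> w \<and> w \<subseteq> t \<and> R \<subseteq> state_circles D w \<and>
      (\<forall>h\<in>M. circ w h \<in> R \<longleftrightarrow> h \<in> N)" if "(w, R) \<in> A" for w R
    using that by (auto simp: A_def marked_states_def)
  have Bw: "s \<subseteq> w \<and> w \<subseteq> t \<and> v \<notin> w \<and> R \<subseteq> state_circles D w \<and> circ w u \<in> R \<and>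
      (\<forall>h\<in>M. circ w h \<in> R \<longleftrightarrow> h \<in> N)" if "(w, R) \<in> B" for w R
    using that by (auto simp: B_def marked_states_def)
  \<comment> \<open>The term of the comultiplication with \<open>u\<close> positive; the circle at
    \<open>e\<close> then keeps the sign of the circle that was split.\<close>
  define f where "f = (\<lambda>(w, R). (w - {v},
    if circ w e \<in> R then insert (circ (w - {v}) e) (insert (circ (w - {v}) u) (R - {circ w e}))
    else insert (circ (w - {v}) u) R))"
  define g where "g = (\<lambda>(w, R). (insert v w,
    if circ w e \<in> R then insert (circ (insert v w) e) (R - {circ w e} - {circ w u})
    else R - {circ w u}))"
  have tgtA: "targets v S = (if circ (fst S) e \<in> snd S then {f S}
      else {(fst S - {v}, insert (circ (fst S - {v}) e) (snd S)), f S})" if S: "S \<in> A" for S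
  proof -
    obtain w R where wR: "S = (w, R)" by (cases S)
    then have w: "insert v s \<subseteq> w" "w \<subseteq> t" "R \<subseteq> state_circles D w"
      using Aw S by blast+
    show ?thesis using split_targets[OF fus[OF w(1,2)] w(3) eo] by (simp add: wR f_def)
  qed
  have wrong: "circ (w - {v}) u \<notin> insert (circ (w - {v}) e) R"
    if w: "(w, R) \<in> A" for w R
  proof -
    have fw: "fuses v (w - {v}) w" using fus Aw[OF w] by blast
    note fe = fuses_ends[OF fw eo]
    have "circ (w - {v}) u \<notin> R" using fuses_ends_gone(2)[OF fw eo] Aw[OF w] by blast
    then show ?thesis using fe(3) by simp
  qed
  \<comment> \<open>The only term with \<open>u\<close> negative comes from a split negative circle
    and makes the circle at \<open>e\<close> positive; this would change the sign at
    \<open>p\<close>.\<close>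
  have sub: "kh y z = 0" if y: "y \<in> A \<union> B" and z: "z \<in> Z" for y z
  proof (rule ccontr)
    assume nz: "kh y z \<noteq> 0"
    have yst: "y \<in> states" using y ABst by blast
    have yu: "circ (fst y) u \<notin> snd y"
      using kh_positive_persists[OF yst nz eH(2)] memZ(3)[OF z] by blast
    then have yA: "y \<in> A" using y vB(2) by blast
    obtain w R where yw: "y = (w, R)" by (cases y)
    note wA = yA[unfolded yw]
    note w = Aw[OF wA]
    have fw: "fuses v (w - {v}) w" using fus w by blast
    note fe = fuses_ends[OF fw eo]
    have zt: "z \<in> targets v y" using kh_targets_removed[OF yst nz vA[OF yA] memZ(2)[OF z]] .
    have fz: "fst z = w - {v}" using zt by (simp add: targets_def yw)
    have "circ (w - {v}) u \<in> snd (f y)" by (simp add: f_def yw)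
    moreover have "circ (w - {v}) u \<notin> snd z" using memZ(3)[OF z] fz by simp
    ultimately have no: "circ w e \<notin> R" and z_eq: "z = (w - {v}, insert (circ (w - {v}) e) R)"
      using zt tgtA[OF yA] by (auto simp: yw split: if_splits)
    have "circ (w - {v}) p = circ (w - {v}) e" using w v by (intro circ_p) auto
    moreover from this have "circ w p = circ w e" using fe(7)[OF pH] by simp
    moreover have "circ w p \<in> R \<longleftrightarrow> p \<in> N" using w p by blast
    moreover have "circ (w - {v}) p \<in> snd z \<longleftrightarrow> p \<in> N"
      using memZ(1)[OF z] p fz by (simp add: marked_states_def)
    ultimately show False using no by (simp add: z_eq)
  qed
  have sqs: "square_zero_on kh (A \<union> B)" "square_zero_on kh Z"
    using square_zero_on_sub[OF finX sq X sub] by auto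
  have bij: "bij_betw f A B"
  proof (rule bij_betwI[of f A B g])
    show "f \<in> A \<rightarrow> B"
    proof
      fix S assume S: "S \<in> A"
      obtain w R where wR: "S = (w, R)" by (cases S)
      note w = Aw[OF S[unfolded wR]]
      have fw: "fuses v (w - {v}) w" using fus w by blast
      have sw: "s \<subseteq> w - {v}" "w - {v} \<subseteq> t" using w v by auto
      note fe = fuses_ends[OF fw eo]
      let ?R = "if circ w e \<in> R
        then insert (circ (w - {v}) e) (insert (circ (w - {v}) u) (R - {circ w e}))
        else insert (circ (w - {v}) u) R"
      have "?R \<subseteq> state_circles D (w - {v})"
        using w fe(6) circ_in[OF eH(1), of "w - {v}"] circ_in[OF eH(2), of "w - {v}"]
        by (auto split: if_splits)
      moreover have "circ (w - {v}) h \<in> ?R \<longleftrightarrow> circ w h \<in> R" if h: "h \<in> M" for h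
      proof (cases "circ (w - {v}) h = circ (w - {v}) e \<or> circ (w - {v}) h = circ (w - {v}) u")
        case True
        then have "h = p" using near[OF h _ sw] by simp
        then have he: "circ (w - {v}) h = circ (w - {v}) e" using circ_p[OF sw] by simp
        then have "circ w h = circ w e" using fe(7)[of h] h MH by auto
        moreover have "circ (w - {v}) e \<notin> R"
          using w fuses_ends_gone(1)[OF fw eo] by blast
        ultimately show ?thesis using he fe(3) by simp
      next
        case False
        then have "circ w h = circ (w - {v}) h" using fe(7)[of h] h MH by auto
        moreover have "circ (w - {v}) h \<noteq> circ w e"
          using fe(5) circ_in[of h "w - {v}"] h MH by (metis subsetD)
        ultimately show ?thesis using False by simp
      qed
      ultimately show "f S \<in> B"
        using w sw by (auto simp: B_def marked_states_def f_def wR)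
    qed
    show "g \<in> B \<rightarrow> A"
    proof
      fix S assume S: "S \<in> B"
      obtain w R where wR: "S = (w, R)" by (cases S)
      note w = Bw[OF S[unfolded wR]]
      let ?w = "insert v w"
      have iw: "insert v s \<subseteq> ?w" "?w \<subseteq> t" "?w - {v} = w" using w v by auto
      note fw = fus[OF iw(1,2), unfolded iw(3)]
      note fe = fuses_ends[OF fw eo]
      have sw: "s \<subseteq> w" "w \<subseteq> t" "v \<notin> w" using w by auto
      let ?R = "if circ w e \<in> R then insert (circ ?w e) (R - {circ w e} - {circ w u})
        else R - {circ w u}"
      have R: "?R \<subseteq> state_circles D ?w"
        using w fe(6) by (auto split: if_splits)
      have eR: "circ ?w e \<notin> R" using w fe(5) by auto
      have "circ ?w h \<in> ?R \<longleftrightarrow> circ w h \<in> R" if h: "h \<in> M" for h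
      proof (cases "circ w h = circ w e \<or> circ w h = circ w u")
        case True
        then have "h = p" using near[OF h _ sw(1,2)] by simp
        then have he: "circ w h = circ w e" using circ_p[OF sw] by simp
        then have "circ ?w h = circ ?w e" using fe(7)[of h] h MH by auto
        then show ?thesis using he eR by simp
      next
        case False
        then have "circ ?w h = circ w h" using fe(7)[of h] h MH by auto
        moreover have "circ w h \<noteq> circ ?w e"
          using fe(5) circ_in[of h w] h MH by (metis subsetD)
        ultimately show ?thesis using False by simp
      qed
      then show "g S \<in> A"
        using w iw R by (auto simp: A_def marked_states_def g_def wR)
    qed
    show "g (f S) = S" if S: "S \<in> A" for S
    proof -
      obtain w R where wR: "S = (w, R)" by (cases S)
      note wA = S[unfolded wR]
      note w = Aw[OF wA]
      have fw: "fuses v (w - {v}) w" using fus w by blast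
      note fe = fuses_ends[OF fw eo]
      have iw: "insert v w = w" using w by auto
      have "circ (w - {v}) e \<notin> R"
        using w fuses_ends_gone(1)[OF fw eo] by blast
      moreover have "circ (w - {v}) u \<notin> R" using wrong[OF wA] by simp
      ultimately show ?thesis using fe(3)
        by (auto simp: wR f_def g_def iw)
    qed
    show "f (g S) = S" if S: "S \<in> B" for S
    proof -
      obtain w R where wR: "S = (w, R)" by (cases S)
      note w = Bw[OF S[unfolded wR]]
      let ?w = "insert v w"
      have iw: "insert v s \<subseteq> ?w" "?w \<subseteq> t" "w - {v} = w" "?w - {v} = w" using w v by auto
      note fe = fuses_ends[OF fus[OF iw(1,2), unfolded iw(4)] eo]
      have "circ ?w e \<notin> R" using w fe(5) by auto
      then show ?thesis using iw(3) w fe(3)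
        by (auto simp: wR f_def g_def)
    qed
  qed
  have AB: "exact_on kh Q P (A \<union> B)"
  proof (rule exact_on_matching[OF _ sqs(1) _ refl _ _ bij])
    show "finite (A \<union> B)" using finX X by (auto intro: finite_subset)
    show "homogeneous_on kh Q P (A \<union> B)" using homogeneous_on_subset[OF hom] ABst by blast
    show "A \<inter> B = {}" by (auto simp: A_def B_def)
    show "kh z y = 0" if "y \<in> A" "z \<in> B" for y z
      using kh_adds_no_crossing[OF _ vA vB(1)] that ABst by blast
    show "kh y (f y) * kh y (f y) = 1" if "y \<in> A" for y
    proof -
      have "f y \<in> targets v y" using tgtA[OF that] by simp
      then show ?thesis using kh_unit[OF _ vA[OF that]] that ABst by blast
    qed
    show "kh y z = 0" if y: "y \<in> A" and z: "z \<in> B" and ne: "z \<noteq> f y" for y z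
    proof (rule ccontr)
      assume "kh y z \<noteq> 0"
      then have "z \<in> targets v y"
        using kh_targets_removed[OF _ _ vA[OF y] vB(1)[OF z]] y ABst by blast
      then have "z = (fst y - {v}, insert (circ (fst y - {v}) e) (snd y))"
        using tgtA[OF y] ne by (auto split: if_splits)
      then show False using wrong[of "fst y" "snd y"] y vB(2)[OF z] by simp
    qed
  qed
  show ?thesis
    using exact_on_extension[OF finX sq homogeneous_on_subset[OF hom Xst] X sub AB]
      IH sqs(2) by (simp add: Z_def)
qed

text \<open>For \<open>s = t\<close> every circle has one base point, so the single generator has
  \<open>card N\<close> positive and \<open>card (M - N)\<close> negative circles, and the excluded
  number is its 2 tau - sigma. Every smoothing preserves this number. \<open>square_zero_on\<close>
  is a hypothesis so that the smaller complexes can inherit it as subcomplexes or quotients.\<close>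

lemma exact_marked_states:
  assumes "s \<subseteq> t" "t \<subseteq> crossings D" "transversal s t M" "N \<subseteq> M"
    and "square_zero_on kh (marked_states s t M N)"
    and "j - 2 * i \<noteq> 2 * int (num_classes D t t) + int (num_crossings D) - 2 * int (card t)
      - 4 * int (card (M - N))"
  shows "exact_on kh (enhanced_states D (i + 2) j) (enhanced_states D i j) (marked_states s t M N)"
  using assms
proof (induction "card (t - s)" arbitrary: s t M N rule: less_induct)
  case less
  note st = less.prems(1,2) and tr = less.prems(3) and N = less.prems(4) and sq = less.prems(5)
  let ?Q = "enhanced_states D (i + 2) j" and ?P = "enhanced_states D i j"
  have hom: "homogeneous_on kh ?Q ?P states" by (rule kh_homogeneous)
  have fint: "finite t" using finite_subset[OF st(2)] by simp
  have MH: "M \<subseteq> half_edges D" using tr by (simp add: transversal_def)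
  have finM: "finite M" using finite_subset[OF MH] by simp
  show ?case
  proof (cases "s = t")
    case True
    have bij: "bij_betw (circ t) M (state_circles D t)"
    proof (rule bij_betwI')
      fix x y assume xy: "x \<in> M" "y \<in> M"
      show "(circ t x = circ t y) = (x = y)"
        using transversal_unique[OF tr xy] circ_eq_iff[of x y t] xy MH True by auto
    next
      fix x assume "x \<in> M"
      then show "circ t x \<in> state_circles D t" using MH by auto
    next
      fix C assume "C \<in> state_circles D t"
      then obtain h where h: "h \<in> half_edges D" "C = circ t h" by (auto simp: state_circles_eq)
      obtain m where m: "m \<in> M" "(h, m) \<in> linked D s t" using transversal_obtain[OF tr h(1)] .
      then have "C = circ t m" using h MH True circ_eq_iff[of h m t] by auto
      then show "\<exists>x\<in>M. C = circ t x" using m by blast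
    qed
    have "S \<notin> ?P" if S: "S \<in> marked_states s t M N" for S
    proof
      assume SP: "S \<in> ?P"
      obtain R where R: "S = (t, R)" "R \<subseteq> state_circles D t" "\<And>h. h \<in> M \<Longrightarrow> circ t h \<in> R \<longleftrightarrow> h \<in> N"
        using S True by (cases S) (auto simp: marked_states_def)
      have "R = circ t ` N"
        using bij R(2,3) N unfolding bij_betw_def by (auto 0 3)
      moreover have "inj_on (circ t) N" using bij N unfolding bij_betw_def by (meson inj_on_subset)
      ultimately have "card R = card N" by (simp add: card_image)
      moreover have "card M = num_classes D t t"
        using bij_betw_same_card[OF bij] card_state_circles by simp
      moreover have "card (M - N) = card M - card N" "card N \<le> card M"
        using N finM finite_subset[OF N finM] by (simp_all add: card_Diff_subset card_mono)
      ultimately show False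
        using SP less.prems(6) st(2) R(1,2) card_state_circles
        by (auto simp: enhanced_states_def state_sign_eq tau_eq)
    qed
    then have empty: "marked_states s t M N \<inter> ?P = {}" by blast
    show ?thesis
      unfolding exact_on_def empty by (auto simp: boundary_def intro!: exI[of _ "\<lambda>_. 0"])
  next
    case False
    then obtain w where w: "w \<in> t - s" using st by auto
    then have "(w, 0) \<in> half_edges D" using st by auto
    then obtain p where p: "p \<in> M" "((w, 0), p) \<in> linked D s t" using transversal_obtain[OF tr] by metis
    obtain v r where vr: "v \<in> t - s" "(v, r) \<in> half_edges D"
      and arc: "\<And>u. s \<subseteq> u \<Longrightarrow> u \<subseteq> t \<Longrightarrow> (p, (v, r)) \<in> linked D u u"
      using adjacent_crossing[OF linked_sym[OF p(2)] w] by metis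
    have v: "v \<in> t" "v \<notin> s" "v \<in> crossings D" using vr st by auto
    have smaller: "card (t - insert v s) < card (t - s)" "card (t - {v} - s) < card (t - s)"
      using v fint by (intro psubset_card_mono; blast)+
    have ct: "int (card (t - {v})) = int (card t) - 1"
      using card_Suc_Diff1[OF fint v(1)] by linarith
    have sub1: "insert v s \<subseteq> t" and sub2: "s \<subseteq> t - {v}" "t - {v} \<subseteq> crossings D"
      using st v by auto
    have add: "linked D s t = fuse (linked D (insert v s) t) (v, 0) (v, 2)"
      and remove: "linked D s t = fuse (linked D s (t - {v})) (v, 0) (v, 2)"
      by (rule linked_add_crossing[OF v(3,2,1) st(1)], rule linked_remove_crossing[OF v(3,2,1) st(1)])
    have eH: "(v, 0) \<in> half_edges D" "(v, 2) \<in> half_edges D" using v by auto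
    consider (bridge) "((v, 0), (v, 2)) \<notin> linked D (insert v s) t"
      | (loop) "((v, 0), (v, 2)) \<notin> linked D s (t - {v})"
      | (neither) "((v, 0), (v, 2)) \<in> linked D (insert v s) t" "((v, 0), (v, 2)) \<in> linked D s (t - {v})"
      by blast
    then show ?thesis
    proof cases
      case bridge
      obtain e u where eu: "{e, u} = {(v, 0), (v, 2)}"
        and end_e: "\<And>w. v \<in> w \<Longrightarrow> ((v, r), e) \<in> linked D w w"
        using corner_ends[OF vr(2)] by metis
      have pe: "(p, e) \<in> linked D w w" if "s \<subseteq> w" "w \<subseteq> t" "v \<in> w" for w
        using linked_trans[OF arc end_e] that by blast
      have E: "linked D s t = fuse (linked D (insert v s) t) e u"
        and ne: "(e, u) \<notin> linked D (insert v s) t" and H: "e \<in> half_edges D" "u \<in> half_edges D"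
        using add bridge end_cases[OF eu] linked_sym eH by (auto simp: fuse_def)
      have "linked D t t \<subseteq> linked D (insert v s) t" using st v by (intro linked_mono) auto
      then have "(p, e) \<in> linked D (insert v s) t" using pe[of t] st v by auto
      note tr' = transversal_fuse[OF tr E H ne p(1) this]
      \<comment> \<open>The new base point is positive and \<open>t\<close> is unchanged, so the
        diagonal does not move.\<close>
      have "insert u M - insert u N = M - N" using tr'(1) by auto
      then have "exact_on kh ?Q ?P (marked_states (insert v s) t (insert u M) (insert u N))"
        if "square_zero_on kh (marked_states (insert v s) t (insert u M) (insert u N))"
        using less.hyps[OF smaller(1) sub1 st(2) tr'(2) _ that] N less.prems(6) by auto
      with pe show ?thesis
        by (rule exact_bridge[OF st v(1,2) tr N sq hom bridge eu p(1)])
    next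
      case loop
      obtain e u where eu: "{e, u} = {(v, 0), (v, 2)}"
        and end_e: "\<And>w. v \<notin> w \<Longrightarrow> ((v, r), e) \<in> linked D w w"
        using corner_ends'[OF vr(2)] by metis
      have pe: "(p, e) \<in> linked D w w" if "s \<subseteq> w" "w \<subseteq> t" "v \<notin> w" for w
        using linked_trans[OF arc end_e] that by blast
      have E: "linked D s t = fuse (linked D s (t - {v})) e u"
        and ne: "(e, u) \<notin> linked D s (t - {v})" and H: "e \<in> half_edges D" "u \<in> half_edges D"
        using remove loop end_cases[OF eu] linked_sym eH by (auto simp: fuse_def)
      have mono: "linked D (t - {v}) (t - {v}) \<subseteq> linked D s (t - {v})"
        using st v by (intro linked_mono) auto
      moreover have "(p, e) \<in> linked D (t - {v}) (t - {v})" using st v by (intro pe) auto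
      ultimately have "(p, e) \<in> linked D s (t - {v})" by blast
      note tr' = transversal_fuse[OF tr E H ne p(1) this]
      \<comment> \<open>Balance of the diagonal: one more circle gives +2, one element less in
        \<open>t\<close> gives +2, and one more negative base point gives -4.\<close>
      have "insert u M - N = insert u (M - N)" "u \<notin> M - N" using tr'(1) N by auto
      then have cM: "card (insert u M - N) = card (M - N) + 1" using finM by simp
      have "((v, 0), (v, 2)) \<notin> linked D (t - {v}) (t - {v})" using loop mono by blast
      moreover have "insert v t = t" using v by auto
      ultimately have "num_classes D (t - {v}) (t - {v}) = num_classes D t t + 1"
        using num_classes_step[OF v(1) st(2)] split_iff[of v "t - {v}"] v sub2
        by (auto simp: splits_def)
      then have "exact_on kh ?Q ?P (marked_states s (t - {v}) (insert u M) N)"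
        if "square_zero_on kh (marked_states s (t - {v}) (insert u M) N)"
        using less.hyps[OF smaller(2) sub2 tr'(2) _ that] N less.prems(6) by (auto simp: cM ct)
      with pe show ?thesis
        by (rule exact_loop[OF st v(1,2) tr N sq hom loop eu p(1)])
    next
      case neither
      let ?X = "marked_states s t M N"
      let ?Y = "marked_states s (t - {v}) M N" and ?Z = "marked_states (insert v s) t M N"
      have finX: "finite ?X" using marked_states_finite[OF st(2)] .
      have Xst: "?X \<subseteq> states" using marked_states_subset[OF st(2)] .
      have same: "linked D (insert v s) t = linked D s t" "linked D s (t - {v}) = linked D s t"
        using add remove neither fuse_absorb[OF equiv_linked] by simp_all
      have X: "?X = ?Y \<union> ?Z" "?Y \<inter> ?Z = {}"
        unfolding marked_states_def using v by auto
      have sub: "kh y z = 0" if "y \<in> ?Y" "z \<in> ?Z" for y z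
      proof (rule kh_adds_no_crossing)
        show "y \<in> states" using that(1) X Xst by blast
        show "v \<in> fst z" "v \<notin> fst y" using that by (auto simp: marked_states_def)
      qed
      note sqs = square_zero_on_sub[OF finX sq X sub]
      have trs: "transversal s (t - {v}) M" "transversal (insert v s) t M"
        using tr by (simp_all add: transversal_def same)
      \<comment> \<open>With the number of components unchanged, defect 0 before and after shows
        that one circle of \<open>t\<close> is lost: -2, balanced by +2 from the smaller
        \<open>t\<close>.\<close>
      have "defect D s t = 0" "defect D s (t - {v}) = 0"
        using defect_eq_0 st sub2 by simp_all
      moreover have "card (t - s) = Suc (card (t - {v} - s))"
        using v fint by (metis DiffI Diff_insert Diff_insert2 card_Suc_Diff1 finite_Diff)
      moreover have "num_classes D s (t - {v}) = num_classes D s t"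
        by (simp add: num_classes_def same)
      ultimately have "int (num_classes D (t - {v}) (t - {v})) = int (num_classes D t t) - 1"
        by (simp add: defect_def)
      then have "exact_on kh ?Q ?P ?Y"
        using less.hyps[OF smaller(2) sub2 trs(1) N sqs(1)] less.prems(6) by (simp add: ct)
      moreover have "exact_on kh ?Q ?P ?Z"
        using less.hyps[OF smaller(1) sub1 st(2) trs(2) N sqs(2)] less.prems(6) by simp
      ultimately show ?thesis
        using exact_on_extension[OF finX sq homogeneous_on_subset[OF hom Xst] X sub] by blast
    qed
  qed
qed

end

section \<open>The homology groups\<close>

text \<open>Once cycles are boundaries, each coset of the image by a cycle is the image itself, and
  the quotient has one element.\<close>

lemma trivial_homology:
  assumes exact: "\<And>x. Poly_Mapping.keys x \<subseteq> enhanced_states D i j \<Longrightarrow> differential D i j x = 0 \<Longrightarrow>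
    \<exists>y. Poly_Mapping.keys y \<subseteq> enhanced_states D (i + 2) j \<and> differential D (i + 2) j y = x"
  shows "trivial_group (khovanov_homology D i j)"
proof -
  let ?C = "chain_group D i j" and ?d = "differential D (i + 2) j"
  let ?K = "kernel ?C (chain_group D (i - 2) j) (differential D i j)"
  let ?I = "?d ` carrier (chain_group D (i + 2) j)"
  let ?G = "subgroup_generated ?C ?K"
  interpret C: group ?C by (simp add: chain_group_def)
  have mem: "x \<in> ?I \<longleftrightarrow> (\<exists>y. Poly_Mapping.keys y \<subseteq> enhanced_states D (i + 2) j \<and> ?d y = x)" for x
    by (simp add: chain_group_def image_iff Bex_def eq_commute)
  have zero: "0 \<in> ?I" unfolding mem by (rule exI[of _ 0]) (simp add: differential_def)
  have add: "x + y \<in> ?I" if xy: "x \<in> ?I" "y \<in> ?I" for x y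
  proof -
    obtain a b where "Poly_Mapping.keys a \<subseteq> enhanced_states D (i + 2) j" "?d a = x"
      "Poly_Mapping.keys b \<subseteq> enhanced_states D (i + 2) j" "?d b = y"
      using xy unfolding mem by blast
    then show ?thesis unfolding mem
      using Poly_Mapping.keys_add[of a b]
      by (intro exI[of _ "a + b"]) (auto simp: differential_def frag_extend_add)
  qed
  have minus: "- x \<in> ?I" if x: "x \<in> ?I" for x
  proof -
    obtain a where "Poly_Mapping.keys a \<subseteq> enhanced_states D (i + 2) j" "?d a = x"
      using x unfolding mem by blast
    then show ?thesis unfolding mem
      by (intro exI[of _ "- a"]) (auto simp: differential_def frag_extend_minus)
  qed
  have carrier: "?I \<subseteq> carrier ?C"
  proof
    fix x assume "x \<in> ?I"
    then obtain y where x: "x = ?d y" by auto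
    have "Poly_Mapping.keys x \<subseteq> enhanced_states D i j"
      unfolding x differential_def
      by (rule order_trans[OF keys_frag_extend], rule UN_least, rule order_trans[OF keys_sum]) auto
    then show "x \<in> carrier ?C" by (simp add: chain_group_def)
  qed
  have sub: "subgroup ?I ?C"
  proof (rule C.subgroupI)
    show "inv\<^bsub>?C\<^esub> x \<in> ?I" if "x \<in> ?I" for x
    proof -
      have "Poly_Mapping.keys x \<subseteq> enhanced_states D i j"
        using subsetD[OF carrier that] by (simp add: chain_group_def)
      then show ?thesis using minus[OF that] by (simp add: chain_group_def)
    qed
    show "x \<otimes>\<^bsub>?C\<^esub> y \<in> ?I" if "x \<in> ?I" "y \<in> ?I" for x y
      using add[OF that] by (simp add: chain_group_def)
  qed (use zero carrier in auto)
  have "?K \<subseteq> ?I"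
  proof
    fix x assume "x \<in> ?K"
    then have "Poly_Mapping.keys x \<subseteq> enhanced_states D i j" "differential D i j x = 0"
      by (simp_all add: kernel_def chain_group_def)
    then show "x \<in> ?I" using exact unfolding mem by simp
  qed
  then have "generate ?C (carrier ?C \<inter> ?K) \<subseteq> ?I"
    by (intro C.generate_subgroup_incl[OF _ sub]) blast
  then have GI: "carrier ?G \<subseteq> ?I"
    by (simp add: carrier_subgroup_generated)
  have mult: "x \<otimes>\<^bsub>?G\<^esub> y = x + y" for x y by (simp add: chain_group_def)
  have coset: "r_coset ?G ?I a = ?I" if a: "a \<in> ?I" for a
  proof -
    have "x \<in> r_coset ?G ?I a" if "x \<in> ?I" for x
      unfolding r_coset_def mult by (rule UN_I[OF add[OF that minus[OF a]]]) simp
    then show ?thesis using add a unfolding r_coset_def mult by blast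
  qed
  have "\<one>\<^bsub>?G\<^esub> \<in> carrier ?G"
    by (rule monoid.one_closed[OF group.is_monoid[OF C.group_subgroup_generated]])
  moreover have "r_coset ?G ?I a = ?I" if "a \<in> carrier ?G" for a
    using coset that GI by blast
  ultimately have one: "carrier (?G Mod ?I) = {?I}"
    unfolding carrier_FactGroup by blast
  have "set_mult ?G ?I ?I = ?I"
  proof -
    have "x \<in> set_mult ?G ?I ?I" if "x \<in> ?I" for x
      unfolding set_mult_def mult by (rule UN_I[OF that], rule UN_I[OF zero]) simp
    then show ?thesis using add unfolding set_mult_def mult by blast
  qed
  then have "group (?G Mod ?I)"
    by (intro groupI) (auto simp: one)
  then show ?thesis
    unfolding khovanov_homology_def trivial_group_def one by simp
qed

context planar_diagram
begin

lemma lookup_differential: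
  assumes "Poly_Mapping.keys x \<subseteq> enhanced_states D i j"
  shows "Poly_Mapping.lookup (differential D i j x) T = boundary kh states (Poly_Mapping.lookup x) T"
proof -
  have sub: "enhanced_states D k l \<subseteq> states" for k l by (auto simp: enhanced_states_def states_def)
  have fin: "finite (enhanced_states D k j)" for k by (rule finite_subset[OF sub finite_states])
  define c where "c = (\<lambda>S T. (- 1) ^ sign_exponent D S T * incidence D S T)"
  have coeff: "Poly_Mapping.lookup (\<Sum>S'\<in>enhanced_states D (i - 2) j. frag_cmul (c S S') (frag_of S')) T = kh S T"
    if "S \<in> enhanced_states D i j" for S
  proof -
    have "Poly_Mapping.lookup (\<Sum>S'\<in>enhanced_states D (i - 2) j. frag_cmul (c S S') (frag_of S')) T =
        (\<Sum>S'\<in>enhanced_states D (i - 2) j. if S' = T then c S T else 0)"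
      by (simp add: lookup_sum if_distrib cong: if_cong) (intro sum.cong; simp)
    also have "\<dots> = (if T \<in> enhanced_states D (i - 2) j then c S T else 0)"
      using fin by simp
    also have "\<dots> = kh S T"
      using that by (auto simp: kh_def c_def enhanced_states_def)
    finally show ?thesis .
  qed
  have "Poly_Mapping.lookup (differential D i j x) T = (\<Sum>S\<in>Poly_Mapping.keys x. Poly_Mapping.lookup x S * kh S T)"
    unfolding differential_def frag_extend_def c_def[symmetric] lookup_sum lookup_frag_cmul
    using assms coeff unfolding c_def by (intro sum.cong) (auto simp: lookup_sum)
  also have "\<dots> = boundary kh states (Poly_Mapping.lookup x) T"
    unfolding boundary_def using assms sub finite_states
    by (intro sum.mono_neutral_left) (auto simp: in_keys_iff)
  finally show ?thesis .
qed

lemma trivial_homology_exact_on: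
  assumes "exact_on kh (enhanced_states D (i + 2) j) (enhanced_states D i j) states"
  shows "trivial_group (khovanov_homology D i j)"
proof (rule trivial_homology)
  fix x assume x: "Poly_Mapping.keys x \<subseteq> enhanced_states D i j" and dx: "differential D i j x = 0"
  have sub: "enhanced_states D k l \<subseteq> states" for k l by (auto simp: enhanced_states_def states_def)
  have "S \<in> states \<inter> enhanced_states D i j" if "Poly_Mapping.lookup x S \<noteq> 0" for S
    using that x sub[of i j] by (auto simp: in_keys_iff)
  moreover have "boundary kh states (Poly_Mapping.lookup x) T = 0" for T
    unfolding lookup_differential[OF x, symmetric] dx by simp
  ultimately obtain y where y: "\<And>S. y S \<noteq> 0 \<Longrightarrow> S \<in> states \<inter> enhanced_states D (i + 2) j"
    "\<And>T. T \<in> states \<Longrightarrow> boundary kh states y T = Poly_Mapping.lookup x T"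
    using exact_onE[OF assms, of "Poly_Mapping.lookup x"] by metis
  define z where "z = (\<Sum>S\<in>states. frag_cmul (y S) (frag_of S))"
  have "Poly_Mapping.lookup z T = (\<Sum>S\<in>states. if S = T then y T else 0)" for T
    unfolding z_def lookup_sum by (intro sum.cong) auto
  then have z: "Poly_Mapping.lookup z = y" using finite_states y(1) by fastforce
  then have keys: "Poly_Mapping.keys z \<subseteq> enhanced_states D (i + 2) j"
    using y(1) by (auto simp: in_keys_iff)
  have "Poly_Mapping.lookup (differential D (i + 2) j z) T = Poly_Mapping.lookup x T" for T
  proof (cases "T \<in> states")
    case True
    then show ?thesis using y(2) by (simp add: lookup_differential[OF keys] z)
  next
    case False
    then have "T \<notin> enhanced_states D k l" for k l using sub by blast
    then have "kh S T = 0" for S by (simp add: kh_def)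
    moreover have "T \<notin> Poly_Mapping.keys x" using False x sub by blast
    ultimately show ?thesis
      by (simp add: lookup_differential[OF keys] boundary_def in_keys_iff)
  qed
  then have "differential D (i + 2) j z = x" by (rule poly_mapping_eqI)
  then show "\<exists>y. Poly_Mapping.keys y \<subseteq> enhanced_states D (i + 2) j \<and> differential D (i + 2) j y = x"
    using keys by blast
qed

text \<open>One component needs one base point. The sign \<open>+\<close> there gives a subcomplex
  on the upper diagonal; the sign \<open>-\<close> gives the quotient, whose diagonal is lower by 4
  because \<open>M - N\<close> has one element.\<close>

lemma exact_on_states:
  assumes conn: "num_classes D {} (crossings D) = 1"
    and out: "j - 2 * i \<noteq> 2 * int (num_classes D (crossings D) (crossings D)) - int (num_crossings D)"
      "j - 2 * i \<noteq> 2 * int (num_classes D (crossings D) (crossings D)) - int (num_crossings D) - 4"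
  shows "exact_on kh (enhanced_states D (i + 2) j) (enhanced_states D i j) states"
proof -
  let ?Q = "enhanced_states D (i + 2) j" and ?P = "enhanced_states D i j" and ?C = "crossings D"
  obtain K where K: "half_edges D // linked D {} ?C = {K}"
    using conn unfolding num_classes_def by (rule card_1_singletonE)
  then obtain p where p: "p \<in> half_edges D" "K = linked D {} ?C `` {p}"
    by (metis insertI1 quotientE)
  have "(h, p) \<in> linked D {} ?C" if "h \<in> half_edges D" for h
  proof -
    have "linked D {} ?C `` {h} = linked D {} ?C `` {p}"
      using quotientI[OF that, of "linked D {} ?C"] K p by simp
    then show ?thesis using linked_refl[OF p(1), of "{}" ?C] by auto
  qed
  then have tr: "transversal {} ?C {p}" using p by (intro transversalI) auto
  let ?Y = "marked_states {} ?C {p} {p}" and ?Z = "marked_states {} ?C {p} {}"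
  have X: "states = ?Y \<union> ?Z" "?Y \<inter> ?Z = {}"
    unfolding states_def marked_states_def by auto
  have sub: "kh y z = 0" if y: "y \<in> ?Y" and z: "z \<in> ?Z" for y z
  proof (rule ccontr)
    assume "kh y z \<noteq> 0"
    moreover have "y \<in> states" using y X by blast
    moreover have "circ (fst y) p \<in> snd y" using y by (simp add: marked_states_def)
    ultimately have "circ (fst z) p \<in> snd z" using kh_positive_persists p(1) by blast
    then show False using z by (simp add: marked_states_def)
  qed
  note sqs = square_zero_on_sub[OF finite_states kh_square_zero X sub]
  have N: "card ?C = num_crossings D" by (simp add: crossings_def)
  have "exact_on kh ?Q ?P ?Y"
    using exact_marked_states[OF _ _ tr _ sqs(1)] out by (simp add: N)
  moreover have "exact_on kh ?Q ?P ?Z"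
    using exact_marked_states[OF _ _ tr _ sqs(2)] out by (simp add: N)
  ultimately show ?thesis
    using exact_on_extension[OF finite_states kh_square_zero kh_homogeneous X sub] by blast
qed

end

section \<open>Regions of an alternating diagram and the number of circles\<close>

context gauss_diagram
begin

lemma turn_in [simp]: "h \<in> half_edges D \<Longrightarrow> turn k h \<in> half_edges D"
  by (cases h) (simp add: turn_def)

text \<open>At every half-edge \<open>turn 1\<close> is the smoothing by one of the two extreme
  states, and conversely \<open>turn 3\<close> is \<open>turn 1\<close> three times.\<close>

lemma connected_pieces_eq: "connected_pieces D = half_edges D // linked D {} (crossings D)"
proof -
  let ?J = "joined {turn 1, glue D} (half_edges D)"
  have t1: "(x, turn 1 x) \<in> ?J" and g: "(x, glue D x) \<in> ?J" if "x \<in> half_edges D" for x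
    using that by (simp_all add: joined_step)
  have "turn 3 x = turn 1 (turn 1 (turn 1 x))" for x :: "nat \<times> nat"
    by (simp add: turn_def mod_simps add.commute)
  then have t3: "(x, turn 3 x) \<in> ?J" if "x \<in> half_edges D" for x
    using joined_trans[OF joined_trans[OF t1[OF that] t1] t1] that by simp
  have sm: "(x, smoothing s x) \<in> ?J" if "x \<in> half_edges D" for x s
    using t1[OF that] t3[OF that] by (simp add: smoothing_def)
  have "?J \<subseteq> linked D {} (crossings D)"
  proof (rule joined_least[OF equiv_linked])
    fix f x assume f: "f \<in> {turn 1, glue D}" and x: "x \<in> half_edges D"
    have "turn 1 x = smoothing {} x \<or> turn 1 x = smoothing (crossings D) x"
      using x by (cases x) (simp add: smoothing_def)
    then show "(x, f x) \<in> linked D {} (crossings D)"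
      using f linked_glue[OF x] linked_smoothing[OF x] by auto
  qed
  moreover have "linked D {} (crossings D) \<subseteq> ?J"
  proof (rule subrelI)
    fix x y assume xy: "(x, y) \<in> linked D {} (crossings D)"
    from xy show "(x, y) \<in> ?J"
      unfolding linked_def
    proof (induction rule: joined_induct)
      case base
      show ?case using linked_in[OF xy] by (simp add: joined_refl)
    next
      case (step z f)
      have "(z, f z) \<in> ?J" using step(3) g[OF step(2)] sm[OF step(2)] by auto
      with step(4) show ?case by (rule joined_trans)
    qed (auto simp: smoothing_involution)
  qed
  ultimately have "?J = linked D {} (crossings D)" by blast
  then show ?thesis unfolding connected_pieces_def by (subst joined_classes_eq) auto
qed

text \<open>
  In an alternating diagram the corners of a region have constant parity, and walking around
  it traces a circle of \<open>s\<^sub>+\<close> or of \<open>s\<^sub>-\<close> according to this parity.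
\<close>

lemma region_class:
  assumes alt: "alternating D"
    and s: "\<And>y. y \<in> half_edges D \<Longrightarrow> even (snd y) \<noteq> b \<Longrightarrow> smoothing s y = turn 3 y"
    and h: "h \<in> half_edges D" "even (snd h) = b"
  shows "joined {turn 3 \<circ> glue D} (half_edges D) `` {h} =
    linked D s s `` {h} \<inter> {x. even (snd x) = b}"
proof -
  let ?f = "turn 3 \<circ> glue D"
  let ?J = "joined {?f} (half_edges D)"
  have glue_parity: "even (snd (glue D x)) \<longleftrightarrow> odd (snd x)" if "x \<in> half_edges D" for x
    using alt that by (auto simp: alternating_def)
  have sm_parity: "even (snd (smoothing s x)) \<longleftrightarrow> odd (snd x)" if "x \<in> half_edges D" for x
    using that by (auto elim!: half_edge_cases split: if_splits)
  have f_in: "?f x \<in> half_edges D" if "x \<in> half_edges D" for x using that by simp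
  have f_eq: "?f x = smoothing s (glue D x)" if "x \<in> half_edges D" "even (snd x) = b" for x
    using s[of "glue D x"] glue_parity[OF that(1)] that by simp
  have forward: "(x, ?f x) \<in> ?J" if "x \<in> half_edges D" for x
    using that by (intro joined_step) auto
  have inj: "inj_on ?f (half_edges D)"
  proof (rule inj_onI)
    fix x y assume xy: "x \<in> half_edges D" "y \<in> half_edges D" "?f x = ?f y"
    have "turn 1 (turn 3 z) = z" if "z \<in> half_edges D" for z
      using that by (cases z) (simp add: turn_def mod_simps)
    then have "glue D x = glue D y" using xy by (metis comp_apply glue_in)
    then show "x = y" using xy by (metis glue_glue)
  qed
  \<comment> \<open>\<open>?f\<close> permutes a finite set, so a predecessor already lies on the
    forward orbit.\<close>
  have backward: "(?f x, x) \<in> ?J" if x: "x \<in> half_edges D" for x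
  proof -
    let ?A = "?J `` {x}"
    have AH: "?A \<subseteq> half_edges D" by (auto simp: joined_def)
    have "?f y \<in> ?A" if "y \<in> ?A" for y
      using joined_trans[OF _ forward] that AH by blast
    then have "?f ` ?A \<subseteq> ?A" by blast
    then have "?f ` ?A = ?A"
      using inj AH finite_subset[OF AH] by (intro endo_inj_surj) (auto intro: inj_on_subset)
    moreover have "x \<in> ?A" using x joined_refl by auto
    moreover have "?f ` ?A \<subseteq> ?J `` {?f x}"
    proof
      fix w assume "w \<in> ?f ` ?A"
      then obtain y where y: "(x, y) \<in> ?J" "w = ?f y" by auto
      from y(1) have "(?f x, ?f y) \<in> ?J"
      proof (induction rule: joined_induct)
        case (step z f)
        then show ?case using joined_trans[OF _ forward[OF f_in[OF step(2)]]] by (simp del: o_apply)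
      qed (use joined_refl[OF f_in[OF x]] f_in in \<open>auto simp del: o_apply\<close>)
      then show "w \<in> ?J `` {?f x}" using y by simp
    qed
    ultimately show ?thesis by blast
  qed
  have 1: "(h, x) \<in> linked D s s \<and> even (snd x) = b" if "(h, x) \<in> ?J" for x
    using that
  proof (induction rule: joined_induct)
    case base
    then show ?case using h linked_refl by simp
  next
    case (step z f)
    then have z: "z \<in> half_edges D" "even (snd z) = b" "f z = smoothing s (glue D z)"
      using f_eq by auto
    have "(z, f z) \<in> linked D s s"
      unfolding z(3) using linked_trans[OF linked_glue linked_smoothing(1)] z(1) by simp
    moreover have "even (snd (f z)) = b"
      unfolding z(3) using sm_parity glue_parity z by simp
    ultimately show ?case using step linked_trans by blast
  qed (use f_in in auto)
  \<comment> \<open>Parities alternate along a circle, and a half-edge of the wrong parity is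
    represented by its glued partner.\<close>
  have 2: "if even (snd x) = b then (h, x) \<in> ?J else (h, glue D x) \<in> ?J"
    if "(h, x) \<in> linked D s s" for x
    using that unfolding linked_def
  proof (induction rule: joined_induct)
    case base
    then show ?case using h joined_refl by simp
  next
    case (step z f)
    then consider "f = glue D" | "f = smoothing s" by auto
    then show ?case
    proof cases
      case 1
      then show ?thesis using step glue_parity[of z] by (auto split: if_splits)
    next
      case 2
      show ?thesis
      proof (cases "even (snd z) = b")
        case True
        let ?w = "smoothing s z"
        have w: "?w \<in> half_edges D" "even (snd ?w) \<noteq> b"
          using smoothing_involution(1)[OF step(2)] sm_parity[OF step(2)] True by auto
        have "?f (glue D ?w) = z"
          using s[OF w] w(1) smoothing_involution(3)[OF step(2), of s] by simp
        then have "(z, glue D ?w) \<in> ?J" using backward[of "glue D ?w"] w by simp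
        moreover have "(h, z) \<in> ?J" using step(4) True by simp
        ultimately have "(h, glue D ?w) \<in> ?J" by (rule joined_trans[rotated])
        then show ?thesis using w(2) 2 by simp
      next
        case False
        then have "smoothing s z = ?f (glue D z)" using s step by simp
        moreover have "(h, glue D z) \<in> ?J" using step False by simp
        moreover have "even (snd (smoothing s z)) = b" using sm_parity step False by simp
        ultimately show ?thesis
          using 2 joined_trans[OF _ forward[OF glue_in[OF step(2)]]] by simp
      qed
    qed
  qed (auto simp: smoothing_involution)
  show ?thesis
  proof (rule Set.set_eqI)
    fix x show "x \<in> ?J `` {h} \<longleftrightarrow> x \<in> linked D s s `` {h} \<inter> {x. even (snd x) = b}"
      using 1[of x] 2[of x] by auto
  qed
qed

text \<open>Parity is a checkerboard colouring of the regions: the even ones are the circles of the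
  all-positive state cut down to even half-edges, the odd ones those of the all-negative state cut
  down to odd half-edges. Gluing changes parity, so every circle has half-edges of both parities and
  the cut neither loses nor identifies circles.\<close>

lemma card_regions:
  assumes alt: "alternating D"
  shows "card (regions D) = num_classes D (crossings D) (crossings D) + num_classes D {} {}"
proof -
  let ?H = "half_edges D" and ?C = "crossings D"
  let ?J = "joined {turn 3 \<circ> glue D} ?H"
  let ?par = "\<lambda>b. {x :: nat \<times> nat. even (snd x) = b}"
  let ?R = "\<lambda>s b. (\<lambda>K. K \<inter> ?par b) ` (?H // linked D s s)"
  have reg: "regions D = ?H // ?J" unfolding regions_def by (subst joined_classes_eq) auto
  have cls: "?J `` {h} = linked D s s `` {h} \<inter> ?par b"
    if "s = ?C \<and> b \<or> s = {} \<and> \<not> b" "h \<in> ?H" "even (snd h) = b" for s b h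
    using that by (intro region_class[OF alt]) (auto simp: smoothing_def half_edges_def)
  have rep: "\<exists>h'\<in>?H. even (snd h') = b \<and> linked D s s `` {h} = linked D s s `` {h'}"
    if "h \<in> ?H" for h s b
  proof (cases "even (snd h) = b")
    case False
    then have "even (snd (glue D h)) = b" using alt that by (auto simp: alternating_def)
    then show ?thesis
      using equiv_class_eq[OF equiv_linked linked_glue[OF that]] glue_in[OF that] by blast
  qed (use that in blast)
  have eq: "?H // ?J = ?R ?C True \<union> ?R {} False"
  proof (rule Set.set_eqI, rule iffI)
    fix K assume "K \<in> ?H // ?J"
    then obtain h where h: "h \<in> ?H" "K = ?J `` {h}" by (auto elim: quotientE)
    show "K \<in> ?R ?C True \<union> ?R {} False"
    proof (cases "even (snd h)")
      case True
      then have "K = linked D ?C ?C `` {h} \<inter> ?par True" using cls[of ?C True h] h by simp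
      then show ?thesis using h by (blast intro: quotientI)
    next
      case False
      then have "K = linked D {} {} `` {h} \<inter> ?par False" using cls[of "{}" False h] h by simp
      then show ?thesis using h by (blast intro: quotientI)
    qed
  next
    fix K assume "K \<in> ?R ?C True \<union> ?R {} False"
    then obtain s b h where sb: "s = ?C \<and> b \<or> s = {} \<and> \<not> b" and h: "h \<in> ?H"
      and K: "K = linked D s s `` {h} \<inter> ?par b"
      by (auto elim!: quotientE)
    obtain h' where h': "h' \<in> ?H" "even (snd h') = b" "linked D s s `` {h} = linked D s s `` {h'}"
      using rep[OF h] by blast
    then have "K = ?J `` {h'}" using cls[OF sb h'(1,2)] K by simp
    then show "K \<in> ?H // ?J" using h' by (simp add: quotientI)
  qed
  have ne: "K \<inter> ?par b \<noteq> {}" if K: "K \<in> ?H // linked D s s" for K s b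
  proof -
    obtain h where h: "h \<in> ?H" "K = linked D s s `` {h}" using K by (rule quotientE)
    then obtain h' where "h' \<in> ?H" "even (snd h') = b" "K = linked D s s `` {h'}"
      using rep[OF h(1), of b s] by auto
    then show ?thesis using linked_refl[of h' s s] by auto
  qed
  have disj: "?R ?C True \<inter> ?R {} False = {}"
  proof (rule ccontr)
    assume "\<not> ?thesis"
    then obtain K L where "K \<in> ?H // linked D ?C ?C" and eq: "K \<inter> ?par True = L \<inter> ?par False"
      by blast
    then obtain x where "x \<in> K \<inter> ?par True" using ne by blast
    moreover from this have "x \<in> ?par False" using eq by blast
    ultimately show False by simp
  qed
  have cardR: "card (?R s b) = num_classes D s s" for s b
    unfolding num_classes_def
  proof (rule card_image, rule inj_onI)
    fix K L assume KL: "K \<in> ?H // linked D s s" "L \<in> ?H // linked D s s" "K \<inter> ?par b = L \<inter> ?par b"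
    then have "K \<inter> L \<noteq> {}" using ne[OF KL(1), of b] by blast
    then show "K = L" using quotient_disj[OF equiv_linked KL(1,2)] by blast
  qed
  have finR: "finite (?R s b)" for s b
    by (simp add: finite_quotient[OF finite_half_edges equiv_type[OF equiv_linked]])
  show ?thesis unfolding reg eq card_Un_disjoint[OF finR finR disj] cardR ..
qed

end

theorem corollaryX5p5:
  fixes D :: link_diagram
  assumes "is_link_diagram D"
    and "alternating D"
    and "non_split D"
    and "\<not> (\<exists>c. nugatory D c)"
  shows "H_thick2 D 0 0 \<and> H_thick D 1"
proof -
  let ?N = "num_crossings D"
  let ?sp = "card (state_circles D (state_plus D))" and ?sm = "card (state_circles D (state_minus D))"
  have "?sp + ?sm = ?N + 2 \<and> (\<forall>i j. \<not> (int ?N - 2 * int ?sm \<le> j - 2 * i \<and> j - 2 * i \<le> 2 * int ?sp - int ?N)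
      \<longrightarrow> trivial_group (khovanov_homology D i j))"
  proof (cases "?N = 0")
    \<comment> \<open>Without crossings the diagram is one free circle, which has no half-edge to
      serve as a base point; its two generators are inspected directly.\<close>
    case True
    then have H: "half_edges D = {}" "crossings D = {}" by (simp_all add: half_edges_def crossings_def)
    then have "free_circles D = 1"
      using assms(3) by (simp add: non_split_def connected_pieces_def joined_classes_def)
    then have circles: "state_circles D s = {Inr 0}" for s
      by (auto simp: state_circles_def joined_classes_def H)
    have bound: "\<bar>j - 2 * i\<bar> \<le> 2" if "S \<in> enhanced_states D i j" for S i j
    proof -
      have "fst S = {}" and "snd S = {} \<or> snd S = {Inr 0}"
        using that by (auto simp: enhanced_states_def H circles)
      then show ?thesis
        using that by (auto simp: enhanced_states_def state_sign_def tau_def H circles)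
    qed
    have "trivial_group (khovanov_homology D i j)" if out: "\<not> \<bar>j - 2 * i\<bar> \<le> 2" for i j
    proof (rule trivial_homology)
      fix x :: "enhanced_state \<Rightarrow>\<^sub>0 int"
      assume "Poly_Mapping.keys x \<subseteq> enhanced_states D i j"
      moreover have "enhanced_states D i j = {}" using bound out by blast
      ultimately have "x = 0" by simp
      then show "\<exists>y. Poly_Mapping.keys y \<subseteq> enhanced_states D (i + 2) j \<and> differential D (i + 2) j y = x"
        by (intro exI[of _ 0]) (simp add: differential_def)
    qed
    then show ?thesis by (auto simp: circles True)
  next
    case False
    interpret gauss_diagram D
      using assms(1) by unfold_locales (auto simp: is_link_diagram_def)
    have "(0, 0) \<in> half_edges D" using False by (simp add: crossings_def)
    then have "connected_pieces D \<noteq> {}" unfolding connected_pieces_eq quotient_def by blast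
    moreover have "finite (connected_pieces D)"
      by (simp add: connected_pieces_eq finite_quotient[OF finite_half_edges equiv_type[OF equiv_linked]])
    ultimately have "card (connected_pieces D) \<noteq> 0" by simp
    then have one: "card (connected_pieces D) = 1" "free_circles D = 0"
      using assms(3) by (auto simp: non_split_def)
    then have conn: "num_classes D {} (crossings D) = 1"
      by (simp add: num_classes_def connected_pieces_eq)
    have euler: "num_classes D (crossings D) (crossings D) + num_classes D {} {} = ?N + 2"
      using assms(1) one card_regions[OF assms(2)] by (simp add: is_link_diagram_def)
    interpret planar_diagram D
    proof
      show "defect D {} (crossings D) = 0"
        using conn euler by (simp add: defect_def crossings_def)
    qed (rule one(2))
    have circles: "?sp = num_classes D (crossings D) (crossings D)" "?sm = num_classes D {} {}"
      by (simp_all add: card_state_circles state_plus_def state_minus_def)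
    \<comment> \<open>By \<open>euler\<close> the lower bound N - 2 |s-| equals 2 |s+| - N - 4, so
      the two ends of the interval are the two diagonals, and outside the interval both are
      avoided.\<close>
    show ?thesis
      using euler exact_on_states[OF conn] trivial_homology_exact_on by (auto simp: circles)
  qed
  \<comment> \<open>For k1 = k2 = 0 the bound required in \<open>H_thick\<close> is half of |s+| +
    |s-| - N = 2, that is 1.\<close>
  then show ?thesis
    by (auto simp: H_thick2_def H_thick_def Let_def intro!: exI[of _ 0])
qed

end
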